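(* Let $H$ be a finite dimensional quasi-Hopf algebra over a field $\mathbf k$ with modulus $\mu$, let $\mathcal L$ be its (one dimensional) space of left cointegrals, and let $\gamma:H\to\mathbf k$ be the unique algebra morphism with $a\triangleright\lambda=\gamma(a)\lambda$ for all $a\in H$, $\lambda\in\mathcal L$, where $a\triangleright\lambda:=E(\lambda\leftharpoonup S^{-1}(a))$. Then $\gamma=\mu$, and the modular automorphism of any nonzero $\lambda\in\mathcal L$ is given by $$\theta_\lambda(a)=S\big(S(a)\leftharpoonup\mu\big),\qquad a\in H .$$ In particular, $H$ is unimodular (i.e. $\mu=\epsilon$) if and only if $\lambda(ab)=\lambda(bS^2(a))$ for all $\lambda\in\mathcal L$ and all $a,b\in H$.
   Context: Quasi-Hopf algebras. $\mathbf k$ is a field, algebras are unital. A quasi-bialgebra $(H,\Delta,\epsilon,\phi)$ is a unital $\mathbf k$-algebra $H$ with unital algebra morphisms $\Delta:H\to H\otimes H$, $\epsilon:H\to\mathbf k$ and an invertible $\phi\in H\otimes H\otimes H$ such that $(\mathrm{id}\otimes\Delta)(\Delta(a))\,\phi=\phi\,(\Delta\otimes\mathrm{id})(\Delta(a))$ for all $a\in H$; $(\mathrm{id}\otimes\mathrm{id}\otimes\Delta)(\phi)(\Delta\otimes\mathrm{id}\otimes\mathrm{id})(\phi)=(\mathbf 1\otimes\phi)(\mathrm{id}\otimes\Delta\otimes\mathrm{id})(\phi)(\phi\otimes\mathbf 1)$; $(\epsilon\otimes\mathrm{id})\circ\Delta=\mathrm{id}=(\mathrm{id}\otimes\epsilon)\circ\Delta$;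 $(\mathrm{id}\otimes\epsilon\otimes\mathrm{id})(\phi)=\mathbf 1\otimes\mathbf 1$. Write $\Delta(a)=a_{(1)}\otimes a_{(2)}$, $\Delta^{op}(a)=a_{(2)}\otimes a_{(1)}$, $\phi=X^j\otimes Y^j\otimes Z^j$, $\phi^{-1}=\bar X^j\otimes\bar Y^j\otimes\bar Z^j$ (summation suppressed); for $x=x^1\otimes x^2$ put $x^{21}=x^2\otimes x^1$. $H$ is a quasi-Hopf algebra if there are an algebra anti-morphism $S:H\to H$ and $\alpha,\beta\in H$ with $S(a_{(1)})\alpha a_{(2)}=\epsilon(a)\alpha$, $a_{(1)}\beta S(a_{(2)})=\epsilon(a)\beta$ for all $a$, and $X^j\beta S(Y^j)\alpha Z^j=\mathbf 1=S(\bar X^j)\alpha\bar Y^j\beta S(\bar Z^j)$. Standing conventions: $S$ is invertible and $\epsilon(\alpha)=\epsilon(\beta)=1$. Notation. $\hat H=\mathrm{Hom}_{\mathbf k}(H,\mathbf k)$; $(\varphi\leftharpoonup a)(b)=\varphi(ab)$ for $\varphi\in\hat H$; $a\leftharpoonup\varphi:=\varphi(a_{(1)})a_{(2)}$. Special elements. $q_R=q_R^1\otimes q_R^2:=X^i\otimes S^{-1}(\alpha Z^i)Y^i$, $p_R:=\bar X^i\otimes\bar Y^i\beta S(\bar Z^i)$. With $T^i\otimes U^i\otimes V^i\otimes W^i:=(\mathbf 1\otimes\phi^{-1})(\mathrm{id}\otimes\mathrm{id}\otimes\Delta)(\phi)$ let $g:=S(U^i)\alpha V^i\otimes S(T^i)\alpha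 W^i$. Drinfeld's element $f:=(S\otimes S)(\Delta^{op}(\bar X^i))\,g\,\Delta(\bar Y^i\beta S(\bar Z^i))$ is invertible. Put $h:=(S^{-1}\otimes S^{-1})(f^{21})$, $U:=f^{-1}(S\otimes S)(q_R^{21})$, $V:=(S^{-1}\otimes S^{-1})(p_R^{21})h$ and $\bar\Delta(a):=V\Delta(a)U$. Left cointegrals. Let $\{b_i\}$ be a basis of $H$ with dual basis $\{b^i\}\subset\hat H$. Define $E:\hat H\to\hat H$ by $E(\psi)(a)=\sum_i(b^i\otimes\psi)\big(\bar\Delta(S^{-1}(q_R^1)\,a\,S^2(q_R^2b_i)S(\beta))\big)$ (a projection). The space of left cointegrals is $\mathcal L:=E(\hat H)=\{\lambda\in\hat H\mid E(\lambda)=\lambda\}$; it is one dimensional and every nonzero $\lambda\in\mathcal L$ is nondegenerate. Modulus. For a nondegenerate functional $\omega$ on $H$ its modular automorphism $\theta_\omega$ is the algebra automorphism with $\omega(ab)=\omega(b\theta_\omega(a))$ for all $a,b$. The modulus of $H$ is the algebra morphism $\mu:=\epsilon\circ\theta_\omega^{-1}:H\to\mathbf k$, which is independent of the choice of $\omega$; equivalently $la=\mu(a)l$ for every left integral $l$ (i.e. $l\in H$ with $al=\epsilon(a)l$ for all $a$). *)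

theory Defs
  imports Complex_Main
begin

section \<open>Tensor powers\<close>

text \<open>
  Let \<open>H\<close> be a vector space over a field \<open>k\<close>. The tensor power of order \<open>n\<close> is realised
  inside the dual of the space of \<open>n\<close>-linear forms on \<open>H\<close>: the pure tensor of a list
  \<open>[x1, ..., xn]\<close> is evaluation at this list, and the tensor power consists of the finite sums
  of pure tensors. Over a field this is a model of the tensor product, because multilinear
  forms separate the elements of the algebraic tensor product. Tensors take the value 0 on
  functions that are not \<open>n\<close>-linear forms, so that equality of functions is equality of tensors.
\<close>

type_synonym ('k, 'a) tensor = "('a list \<Rightarrow> 'k) \<Rightarrow> 'k"

record ('k, 'a) quasi_hopf_data =
  scal :: "'k \<Rightarrow> 'a \<Rightarrow> 'a"
  comult :: "'a \<Rightarrow> ('k, 'a) tensor"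
  counit :: "'a \<Rightarrow> 'k"
  reassoc :: "('k, 'a) tensor"
  antipode :: "'a \<Rightarrow> 'a"
  elem_alpha :: 'a
  elem_beta :: 'a

text \<open>Only the values of \<open>F\<close> on lists of length \<open>n\<close> matter.\<close>

definition multilinear ::
    "('k::field, 'a::ring_1) quasi_hopf_data \<Rightarrow> nat \<Rightarrow> ('a list \<Rightarrow> 'k) \<Rightarrow> bool" where
  "multilinear H n F \<longleftrightarrow>
     (\<forall>w i. length w = n \<longrightarrow> i < n \<longrightarrow>
        Vector_Spaces.linear (scal H) (*) (\<lambda>x. F (w[i := x])))"

definition pure :: "('k::field, 'a::ring_1) quasi_hopf_data \<Rightarrow> 'a list \<Rightarrow> ('k, 'a) tensor" where
  "pure H w = (\<lambda>F. if multilinear H (length w) F then F w else 0)"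

definition tensors :: "('k::field, 'a::ring_1) quasi_hopf_data \<Rightarrow> nat \<Rightarrow> ('k, 'a) tensor set" where
  "tensors H n =
     {t. \<exists>ws. (\<forall>w\<in>set ws. length w = n) \<and> t = (\<lambda>F. \<Sum>w\<leftarrow>ws. pure H w F)}"

text \<open>
  If \<open>G\<close> is a multilinear map on lists of length \<open>n\<close> with values in some tensor power, then
  \<open>tensor_lift t G\<close> is the value at the tensor \<open>t\<close> of order \<open>n\<close> of the linear map
  induced by \<open>G\<close>: it sends \<open>\<Sum> x1 \<otimes> ... \<otimes> xn\<close> to
  \<open>\<Sum> G [x1, ..., xn]\<close>. The functions \<open>sweedler2\<close>, \<open>sweedler3\<close> and \<open>sweedler4\<close> name the legs
  of \<open>t\<close>, so that \<open>sweedler2 t (\<lambda>x y. G x y)\<close> is what is written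
  \<open>G(t1, t2)\<close> for \<open>t = t1 \<otimes> t2\<close> with suppressed summation.
\<close>

definition tensor_lift ::
    "('k, 'a) tensor \<Rightarrow> ('a list \<Rightarrow> ('k, 'a) tensor) \<Rightarrow> ('k, 'a) tensor" where
  "tensor_lift t G = (\<lambda>F. t (\<lambda>w. G w F))"

definition sweedler2 ::
    "('k, 'a) tensor \<Rightarrow> ('a \<Rightarrow> 'a \<Rightarrow> ('k, 'a) tensor) \<Rightarrow> ('k, 'a) tensor" where
  "sweedler2 t G = tensor_lift t (\<lambda>w. G (w ! 0) (w ! 1))"

definition sweedler3 ::
    "('k, 'a) tensor \<Rightarrow> ('a \<Rightarrow> 'a \<Rightarrow> 'a \<Rightarrow> ('k, 'a) tensor) \<Rightarrow> ('k, 'a) tensor" where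
  "sweedler3 t G = tensor_lift t (\<lambda>w. G (w ! 0) (w ! 1) (w ! 2))"

definition sweedler4 ::
    "('k, 'a) tensor \<Rightarrow> ('a \<Rightarrow> 'a \<Rightarrow> 'a \<Rightarrow> 'a \<Rightarrow> ('k, 'a) tensor) \<Rightarrow> ('k, 'a) tensor" where
  "sweedler4 t G = tensor_lift t (\<lambda>w. G (w ! 0) (w ! 1) (w ! 2) (w ! 3))"

definition tensor_prod ::
    "('k::field, 'a::ring_1) quasi_hopf_data \<Rightarrow> ('k, 'a) tensor \<Rightarrow> ('k, 'a) tensor \<Rightarrow> ('k, 'a) tensor"
    (infixr \<open>\<otimes>\<index>\<close> 75) where
  "s \<otimes>\<^bsub>H\<^esub> t = tensor_lift s (\<lambda>v. tensor_lift t (\<lambda>w. pure H (v @ w)))"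

text \<open>The multiplication of the tensor power algebra; both factors must have the same order.\<close>

definition tensor_mult ::
    "('k::field, 'a::ring_1) quasi_hopf_data \<Rightarrow> ('k, 'a) tensor \<Rightarrow> ('k, 'a) tensor \<Rightarrow> ('k, 'a) tensor"
    (infixl \<open>\<odot>\<index>\<close> 70) where
  "s \<odot>\<^bsub>H\<^esub> t = tensor_lift s (\<lambda>v. tensor_lift t (\<lambda>w. pure H (map2 (*) v w)))"

definition tensor_one :: "('k::field, 'a::ring_1) quasi_hopf_data \<Rightarrow> nat \<Rightarrow> ('k, 'a) tensor" where
  "tensor_one H n = pure H (replicate n 1)"

definition is_tensor_inverse ::
    "('k::field, 'a::ring_1) quasi_hopf_data \<Rightarrow> nat \<Rightarrow> ('k, 'a) tensor \<Rightarrow> ('k, 'a) tensor \<Rightarrow> bool" where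
  "is_tensor_inverse H n t s \<longleftrightarrow>
     s \<in> tensors H n \<and> t \<odot>\<^bsub>H\<^esub> s = tensor_one H n \<and> s \<odot>\<^bsub>H\<^esub> t = tensor_one H n"

definition tensor_inverse ::
    "('k::field, 'a::ring_1) quasi_hopf_data \<Rightarrow> nat \<Rightarrow> ('k, 'a) tensor \<Rightarrow> ('k, 'a) tensor" where
  "tensor_inverse H n t = (THE s. is_tensor_inverse H n t s)"

text \<open>
  The first tensor power is identified with \<open>H\<close> by \<open>x \<mapsto> pure H [x]\<close>; the following is the
  inverse of this identification.
\<close>

definition elem_of :: "('k::field, 'a::ring_1) quasi_hopf_data \<Rightarrow> ('k, 'a) tensor \<Rightarrow> 'a" where
  "elem_of H t = (THE x. t = pure H [x])"


section \<open>Quasi-Hopf algebras\<close>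

locale quasi_bialgebra = vector_space "scal H"
  for H :: "('k::field, 'a::ring_1) quasi_hopf_data" +
  assumes scal_mult_left: "scal H c (x * y) = scal H c x * y"
    and scal_mult_right: "scal H c (x * y) = x * scal H c y"
    and comult_closed: "comult H x \<in> tensors H 2"
    and comult_add: "comult H (x + y) = (\<lambda>F. comult H x F + comult H y F)"
    and comult_scal: "comult H (scal H c x) = (\<lambda>F. c * comult H x F)"
    and comult_one: "comult H 1 = tensor_one H 2"
    and comult_mult: "comult H (x * y) = comult H x \<odot>\<^bsub>H\<^esub> comult H y"
    and counit_linear: "Vector_Spaces.linear (scal H) (*) (counit H)"
    and counit_one: "counit H 1 = 1"
    and counit_mult: "counit H (x * y) = counit H x * counit H y"
    and reassoc_closed: "reassoc H \<in> tensors H 3"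
    and reassoc_invertible: "\<exists>s. is_tensor_inverse H 3 (reassoc H) s"
    and quasi_coassoc:
      "sweedler2 (comult H a) (\<lambda>x y. pure H [x] \<otimes>\<^bsub>H\<^esub> comult H y) \<odot>\<^bsub>H\<^esub> reassoc H =
       reassoc H \<odot>\<^bsub>H\<^esub> sweedler2 (comult H a) (\<lambda>x y. comult H x \<otimes>\<^bsub>H\<^esub> pure H [y])"
    and pentagon:
      "sweedler3 (reassoc H) (\<lambda>x y z. pure H [x] \<otimes>\<^bsub>H\<^esub> pure H [y] \<otimes>\<^bsub>H\<^esub> comult H z) \<odot>\<^bsub>H\<^esub>
       sweedler3 (reassoc H) (\<lambda>x y z. comult H x \<otimes>\<^bsub>H\<^esub> pure H [y] \<otimes>\<^bsub>H\<^esub> pure H [z]) =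
       (tensor_one H 1 \<otimes>\<^bsub>H\<^esub> reassoc H) \<odot>\<^bsub>H\<^esub>
       sweedler3 (reassoc H) (\<lambda>x y z. pure H [x] \<otimes>\<^bsub>H\<^esub> comult H y \<otimes>\<^bsub>H\<^esub> pure H [z]) \<odot>\<^bsub>H\<^esub>
       (reassoc H \<otimes>\<^bsub>H\<^esub> tensor_one H 1)"
    and counit_left:
      "sweedler2 (comult H a) (\<lambda>x y. pure H [scal H (counit H x) y]) = pure H [a]"
    and counit_right:
      "sweedler2 (comult H a) (\<lambda>x y. pure H [scal H (counit H y) x]) = pure H [a]"
    and counit_reassoc:
      "sweedler3 (reassoc H) (\<lambda>x y z. pure H [scal H (counit H y) x, z]) = tensor_one H 2"

definition reassoc_inv :: "('k::field, 'a::ring_1) quasi_hopf_data \<Rightarrow> ('k, 'a) tensor" where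
  "reassoc_inv H = tensor_inverse H 3 (reassoc H)"

text \<open>
  The last three assumptions, \<open>antipode_bij\<close>, \<open>counit_alpha\<close> and \<open>counit_beta\<close>, are standing
  conventions and not part of the notion of a quasi-Hopf algebra as such.
\<close>

locale quasi_hopf_algebra = quasi_bialgebra H
  for H :: "('k::field, 'a::ring_1) quasi_hopf_data" +
  assumes antipode_linear: "Vector_Spaces.linear (scal H) (scal H) (antipode H)"
    and antipode_one: "antipode H 1 = 1"
    and antipode_mult: "antipode H (x * y) = antipode H y * antipode H x"
    and antipode_alpha:
      "sweedler2 (comult H a) (\<lambda>x y. pure H [antipode H x * elem_alpha H * y]) =
       pure H [scal H (counit H a) (elem_alpha H)]"
    and antipode_beta:
      "sweedler2 (comult H a) (\<lambda>x y. pure H [x * elem_beta H * antipode H y]) =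
       pure H [scal H (counit H a) (elem_beta H)]"
    and antipode_reassoc:
      "sweedler3 (reassoc H) (\<lambda>X Y Z. pure H [X * elem_beta H * antipode H Y * elem_alpha H * Z]) =
       pure H [1]"
    and antipode_reassoc_inv:
      "sweedler3 (reassoc_inv H)
         (\<lambda>X Y Z. pure H [antipode H X * elem_alpha H * Y * elem_beta H * antipode H Z]) =
       pure H [1]"
    and antipode_bij: "bij (antipode H)"
    and counit_alpha: "counit H (elem_alpha H) = 1"
    and counit_beta: "counit H (elem_beta H) = 1"


section \<open>Special elements\<close>

abbreviation antipode_inv :: "('k, 'a) quasi_hopf_data \<Rightarrow> 'a \<Rightarrow> 'a" where
  "antipode_inv H \<equiv> inv (antipode H)"

definition tensor_flip ::
    "('k::field, 'a::ring_1) quasi_hopf_data \<Rightarrow> ('k, 'a) tensor \<Rightarrow> ('k, 'a) tensor" where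
  "tensor_flip H t = sweedler2 t (\<lambda>x y. pure H [y, x])"

definition tensor_map2 ::
    "('k::field, 'a::ring_1) quasi_hopf_data \<Rightarrow> ('a \<Rightarrow> 'a) \<Rightarrow> ('k, 'a) tensor \<Rightarrow> ('k, 'a) tensor" where
  "tensor_map2 H f t = sweedler2 t (\<lambda>x y. pure H [f x, f y])"

definition qR :: "('k::field, 'a::ring_1) quasi_hopf_data \<Rightarrow> ('k, 'a) tensor" where
  "qR H = sweedler3 (reassoc H) (\<lambda>X Y Z. pure H [X, antipode_inv H (elem_alpha H * Z) * Y])"

definition pR :: "('k::field, 'a::ring_1) quasi_hopf_data \<Rightarrow> ('k, 'a) tensor" where
  "pR H = sweedler3 (reassoc_inv H) (\<lambda>X Y Z. pure H [X, Y * elem_beta H * antipode H Z])"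

definition drinfeld_g :: "('k::field, 'a::ring_1) quasi_hopf_data \<Rightarrow> ('k, 'a) tensor" where
  "drinfeld_g H =
     sweedler4
       ((tensor_one H 1 \<otimes>\<^bsub>H\<^esub> reassoc_inv H) \<odot>\<^bsub>H\<^esub>
        sweedler3 (reassoc H) (\<lambda>x y z. pure H [x] \<otimes>\<^bsub>H\<^esub> pure H [y] \<otimes>\<^bsub>H\<^esub> comult H z))
       (\<lambda>T U V W. pure H [antipode H U * elem_alpha H * V, antipode H T * elem_alpha H * W])"

definition drinfeld_f :: "('k::field, 'a::ring_1) quasi_hopf_data \<Rightarrow> ('k, 'a) tensor" where
  "drinfeld_f H =
     sweedler3 (reassoc_inv H)
       (\<lambda>X Y Z. tensor_map2 H (antipode H) (tensor_flip H (comult H X)) \<odot>\<^bsub>H\<^esub>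
                drinfeld_g H \<odot>\<^bsub>H\<^esub>
                comult H (Y * elem_beta H * antipode H Z))"

definition elem_h :: "('k::field, 'a::ring_1) quasi_hopf_data \<Rightarrow> ('k, 'a) tensor" where
  "elem_h H = tensor_map2 H (antipode_inv H) (tensor_flip H (drinfeld_f H))"

definition elem_U :: "('k::field, 'a::ring_1) quasi_hopf_data \<Rightarrow> ('k, 'a) tensor" where
  "elem_U H =
     tensor_inverse H 2 (drinfeld_f H) \<odot>\<^bsub>H\<^esub> tensor_map2 H (antipode H) (tensor_flip H (qR H))"

definition elem_V :: "('k::field, 'a::ring_1) quasi_hopf_data \<Rightarrow> ('k, 'a) tensor" where
  "elem_V H = tensor_map2 H (antipode_inv H) (tensor_flip H (pR H)) \<odot>\<^bsub>H\<^esub> elem_h H"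

definition comult_bar :: "('k::field, 'a::ring_1) quasi_hopf_data \<Rightarrow> 'a \<Rightarrow> ('k, 'a) tensor" where
  "comult_bar H a = elem_V H \<odot>\<^bsub>H\<^esub> comult H a \<odot>\<^bsub>H\<^esub> elem_U H"


section \<open>Left cointegrals\<close>

definition dual_space :: "('k::field, 'a::ring_1) quasi_hopf_data \<Rightarrow> ('a \<Rightarrow> 'k) set" where
  "dual_space H = {\<psi>. Vector_Spaces.linear (scal H) (*) \<psi>}"

text \<open>
  Here \<open>B\<close> is a finite basis of \<open>H\<close>, and \<open>\<lambda>x. module.representation (scal H) B x b\<close> is the element
  of the dual basis that belongs to \<open>b \<in> B\<close>. A tensor of order 2 is evaluated at
  \<open>\<phi> \<otimes> \<psi>\<close> by applying it to the bilinear form \<open>(x, y) \<mapsto> \<phi> x * \<psi> y\<close>.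
\<close>

definition cointegral_proj ::
    "('k::field, 'a::ring_1) quasi_hopf_data \<Rightarrow> 'a set \<Rightarrow> ('a \<Rightarrow> 'k) \<Rightarrow> ('a \<Rightarrow> 'k)" where
  "cointegral_proj H B \<psi> = (\<lambda>a. \<Sum>b\<in>B.
     comult_bar H
       (elem_of H (sweedler2 (qR H)
          (\<lambda>q1 q2. pure H [antipode_inv H q1 * a * antipode H (antipode H (q2 * b)) *
                           antipode H (elem_beta H)])))
       (\<lambda>w. module.representation (scal H) B (w ! 0) b * \<psi> (w ! 1)))"

definition left_cointegrals ::
    "('k::field, 'a::ring_1) quasi_hopf_data \<Rightarrow> 'a set \<Rightarrow> ('a \<Rightarrow> 'k) set" where
  "left_cointegrals H B = cointegral_proj H B ` dual_space H"

definition cointegral_act ::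
    "('k::field, 'a::ring_1) quasi_hopf_data \<Rightarrow> 'a set \<Rightarrow> 'a \<Rightarrow> ('a \<Rightarrow> 'k) \<Rightarrow> ('a \<Rightarrow> 'k)" where
  "cointegral_act H B a \<psi> = cointegral_proj H B (\<lambda>b. \<psi> (antipode_inv H a * b))"

definition algebra_character ::
    "('k::field, 'a::ring_1) quasi_hopf_data \<Rightarrow> ('a \<Rightarrow> 'k) \<Rightarrow> bool" where
  "algebra_character H \<chi> \<longleftrightarrow>
     Vector_Spaces.linear (scal H) (*) \<chi> \<and> \<chi> 1 = 1 \<and> (\<forall>a b. \<chi> (a * b) = \<chi> a * \<chi> b)"

definition is_cointegral_character ::
    "('k::field, 'a::ring_1) quasi_hopf_data \<Rightarrow> 'a set \<Rightarrow> ('a \<Rightarrow> 'k) \<Rightarrow> bool" where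
  "is_cointegral_character H B \<gamma> \<longleftrightarrow>
     algebra_character H \<gamma> \<and>
     (\<forall>a. \<forall>\<psi>\<in>left_cointegrals H B. cointegral_act H B a \<psi> = (\<lambda>b. \<gamma> a * \<psi> b))"


section \<open>Modular automorphisms and the modulus\<close>

definition nondegenerate ::
    "('k::field, 'a::ring_1) quasi_hopf_data \<Rightarrow> ('a \<Rightarrow> 'k) \<Rightarrow> bool" where
  "nondegenerate H \<omega> \<longleftrightarrow>
     \<omega> \<in> dual_space H \<and>
     (\<forall>a. (\<forall>b. \<omega> (a * b) = 0) \<longrightarrow> a = 0) \<and>
     (\<forall>b. (\<forall>a. \<omega> (a * b) = 0) \<longrightarrow> b = 0)"

definition algebra_automorphism ::
    "('k::field, 'a::ring_1) quasi_hopf_data \<Rightarrow> ('a \<Rightarrow> 'a) \<Rightarrow> bool" where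
  "algebra_automorphism H \<theta> \<longleftrightarrow>
     Vector_Spaces.linear (scal H) (scal H) \<theta> \<and> \<theta> 1 = 1 \<and>
     (\<forall>a b. \<theta> (a * b) = \<theta> a * \<theta> b) \<and> bij \<theta>"

definition is_modular_automorphism ::
    "('k::field, 'a::ring_1) quasi_hopf_data \<Rightarrow> ('a \<Rightarrow> 'k) \<Rightarrow> ('a \<Rightarrow> 'a) \<Rightarrow> bool" where
  "is_modular_automorphism H \<omega> \<theta> \<longleftrightarrow>
     nondegenerate H \<omega> \<and> algebra_automorphism H \<theta> \<and> (\<forall>a b. \<omega> (a * b) = \<omega> (b * \<theta> a))"

text \<open>The modulus does not depend on the choice of the nondegenerate functional \<open>\<omega>\<close>.\<close>

definition modulus :: "('k::field, 'a::ring_1) quasi_hopf_data \<Rightarrow> 'a \<Rightarrow> 'k" where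
  "modulus H = (THE \<mu>. \<exists>\<omega> \<theta>. is_modular_automorphism H \<omega> \<theta> \<and> \<mu> = counit H \<circ> inv \<theta>)"

text \<open>The right action of a functional on \<open>H\<close>, \<open>\<phi>(a1) a2\<close> in Sweedler notation.\<close>

definition hit_right ::
    "('k::field, 'a::ring_1) quasi_hopf_data \<Rightarrow> 'a \<Rightarrow> ('a \<Rightarrow> 'k) \<Rightarrow> 'a" where
  "hit_right H a \<phi> = elem_of H (sweedler2 (comult H a) (\<lambda>x y. pure H [scal H (\<phi> x) y]))"

end

theory Submission
  imports Defs
begin

text \<open>
  Every identity in a tensor power is obtained from quasi-coassociativity and the pentagon by collapsing
  \<open>S(a1) \<alpha> a2\<close> and \<open>a1 \<beta> S(a2)\<close>. The main simplification is the formula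
  \<open>U = \<Delta>(S(x) \<alpha> y) p\<^sub>R (1 \<otimes> S(z))\<close> with \<open>\<phi>\<inverse> = x \<otimes> y \<otimes> z\<close>, which does not involve Drinfeld's element \<open>f\<close>;
  \<open>V\<close> is its mirror image in the opposite algebra. Hence the twisted comultiplication is coassociative up
  to conjugation by \<open>\<phi>\<close>, without any relation between \<open>f\<close> and \<open>\<phi>\<close> in the third tensor power.

  The transpose \<open>P\<close> of \<open>E\<close> takes values in the elements \<open>r\<close> with \<open>r S(c) = \<epsilon>(c) r\<close>. Writing
  \<open>\<psi>0 \<otimes> \<psi>1\<close> for the coaction on the dual given by the twisted comultiplication, and \<open>\<psi>\<cdot>a\<close> for the form
  \<open>b \<mapsto> \<psi>(b S(a))\<close>, one shows that \<open>E(\<psi>)\<close> is coinvariant on the image of \<open>P\<close> and that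
  \<open>E(\<psi>0)\<cdot>\<psi>1 = \<psi>\<close>. So \<open>E\<close> is a nonzero projection and \<open>a \<mapsto> \<lambda>\<cdot>a\<close> is injective for each nonzero cointegral
  \<open>\<lambda>\<close>, hence onto the dual by counting dimensions; coinvariance then makes any two cointegrals proportional.

  Finally \<open>E(\<psi>)(S\<inverse>(a) b) = E(a1 \<cdot> \<psi>)(b S(a2))\<close>, so \<open>\<lambda>(S\<inverse>(a) b) = \<gamma>(a1) \<lambda>(b S(a2))\<close>, which is the formula
  for the modular automorphism; and \<open>\<gamma>(a1) \<gamma>(S(a2)) = \<epsilon>(a)\<close> identifies \<open>\<gamma>\<close> with the modulus.
\<close>

section \<open>Finite sums over tensors\<close>

text \<open>Iterating the twisted coaction leaves a \<phi>\<inverse> on the left and a \<phi> on the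
  right. The elements r serve to remove this obstacle: the first leg of \<phi> reaches r as S(X) and
  becomes \<epsilon>(X), so \<phi> disappears, while \<phi>\<inverse> assembles into
  \<open>p\<^sub>R\<close> and cancels against the \<open>q\<^sub>R\<close> in the definition of E.

  The formula for U solves f U = (S \<otimes> S)(q21), q21 being the flipped
  \<open>q\<^sub>R\<close>. Indeed f intertwines \<Delta>(S(a)) with S \<otimes> S of the flipped
  \<Delta>(a), and f \<Delta>(\<alpha>) = g; so f can be computed on every \<Delta>(S(a) \<alpha>
  b). With U at hand, f\<inverse> = \<Delta>(S(p1)) U (p2 \<otimes> 1) for \<open>p\<^sub>R\<close>
  = p1 \<otimes> p2, and the invertibility of f is a result.

  The modulus is a definite description over all nondegenerate forms. Each of them is a translate of
  \<lambda> by some c, its modular automorphism is that of \<lambda> conjugated by c, and characters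
  do not see the conjugation.\<close>

definition sum2 :: "'a set \<Rightarrow> ('a \<Rightarrow> 'a \<Rightarrow> 'k::field) \<Rightarrow> ('a \<Rightarrow> 'a \<Rightarrow> 'k) \<Rightarrow> 'k" where
  "sum2 B k F = (\<Sum>x\<in>B. \<Sum>y\<in>B. k x y * F x y)"

definition sum3 :: "'a set \<Rightarrow> ('a \<Rightarrow> 'a \<Rightarrow> 'a \<Rightarrow> 'k::field) \<Rightarrow> ('a \<Rightarrow> 'a \<Rightarrow> 'a \<Rightarrow> 'k) \<Rightarrow> 'k" where
  "sum3 B k F = (\<Sum>x\<in>B. \<Sum>y\<in>B. \<Sum>z\<in>B. k x y z * F x y z)"

lemma sum2_product: "sum2 B k F = (\<Sum>w\<in>B \<times> B. k (fst w) (snd w) * F (fst w) (snd w))"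
  by (simp add: sum2_def sum.cartesian_product case_prod_beta)

lemma sum3_product: "sum3 B k F =
    (\<Sum>w\<in>B \<times> B \<times> B. k (fst w) (fst (snd w)) (snd (snd w)) * F (fst w) (fst (snd w)) (snd (snd w)))"
  by (simp add: sum3_def sum.cartesian_product case_prod_beta)

lemma weighted_sum_swap:
  fixes k :: "'i \<Rightarrow> 'k::comm_ring" and l :: "'j \<Rightarrow> 'k"
  shows "(\<Sum>i\<in>I. k i * (\<Sum>j\<in>J. l j * F i j)) = (\<Sum>j\<in>J. l j * (\<Sum>i\<in>I. k i * F i j))"
  unfolding sum_distrib_left by (subst sum.swap) (simp add: mult.left_commute)

lemma sum2_sum2: "sum2 B k (\<lambda>x y. sum2 B l (\<lambda>u v. F x y u v)) = sum2 B l (\<lambda>u v. sum2 B k (\<lambda>x y. F x y u v))"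
  unfolding sum2_product by (rule weighted_sum_swap)

lemma sum2_sum3: "sum2 B k (\<lambda>x y. sum3 B l (\<lambda>u v w. F x y u v w)) = sum3 B l (\<lambda>u v w. sum2 B k (\<lambda>x y. F x y u v w))"
  unfolding sum2_product sum3_product by (rule weighted_sum_swap)

lemma sum3_sum3: "sum3 B k (\<lambda>x y z. sum3 B l (\<lambda>u v w. F x y z u v w)) = sum3 B l (\<lambda>u v w. sum3 B k (\<lambda>x y z. F x y z u v w))"
  unfolding sum3_product by (rule weighted_sum_swap)

lemma sum2_sum: "sum2 B k (\<lambda>x y. \<Sum>i\<in>I. F i x y) = (\<Sum>i\<in>I. sum2 B k (F i))"
  unfolding sum2_product sum_distrib_left by (rule sum.swap)

lemma sum3_sum: "sum3 B k (\<lambda>x y z. \<Sum>i\<in>I. F i x y z) = (\<Sum>i\<in>I. sum3 B k (F i))"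
  unfolding sum3_product sum_distrib_left by (rule sum.swap)

lemma sum2_cmult: "sum2 B k (\<lambda>x y. c * F x y) = c * sum2 B k F"
  unfolding sum2_product sum_distrib_left by (simp add: mult.left_commute)

lemma sum3_cmult: "sum3 B k (\<lambda>x y z. c * F x y z) = c * sum3 B k F"
  unfolding sum3_product sum_distrib_left by (simp add: mult.left_commute)

lemma sum2_multc: "sum2 B k (\<lambda>x y. F x y * c) = sum2 B k F * c"
  unfolding sum2_product sum_distrib_right by (simp add: mult.assoc)

lemma sum3_multc: "sum3 B k (\<lambda>x y z. F x y z * c) = sum3 B k F * c"
  unfolding sum3_product sum_distrib_right by (simp add: mult.assoc)

lemmas sum23_scalar = sum2_cmult sum3_cmult sum2_multc sum3_multc

section \<open>Multilinear forms and their expansion in a basis\<close>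

locale multilinear_forms =
  fixes scale :: "'k::field \<Rightarrow> 'a::ab_group_add \<Rightarrow> 'a"
begin

text \<open>Stated by the defining equations, so that linearity of nested sums follows from
  introduction rules; \<open>linear_iff_lin\<close> compares it with
  \<open>Vector_Spaces.linear\<close>.\<close>

definition lin :: "('a \<Rightarrow> 'k) \<Rightarrow> bool" where
  "lin f \<longleftrightarrow> (\<forall>x y. f (x + y) = f x + f y) \<and> (\<forall>c x. f (scale c x) = c * f x)"

definition endo :: "('a \<Rightarrow> 'a) \<Rightarrow> bool" where
  "endo g \<longleftrightarrow> (\<forall>x y. g (x + y) = g x + g y) \<and> (\<forall>c x. g (scale c x) = scale c (g x))"

definition bilin :: "('a \<Rightarrow> 'a \<Rightarrow> 'k) \<Rightarrow> bool" where
  "bilin F \<longleftrightarrow> (\<forall>y. lin (\<lambda>x. F x y)) \<and> (\<forall>x. lin (\<lambda>y. F x y))"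

definition trilin :: "('a \<Rightarrow> 'a \<Rightarrow> 'a \<Rightarrow> 'k) \<Rightarrow> bool" where
  "trilin F \<longleftrightarrow> (\<forall>y z. lin (\<lambda>x. F x y z)) \<and> (\<forall>x z. lin (\<lambda>y. F x y z)) \<and> (\<forall>x y. lin (\<lambda>z. F x y z))"

definition quadlin :: "('a \<Rightarrow> 'a \<Rightarrow> 'a \<Rightarrow> 'a \<Rightarrow> 'k) \<Rightarrow> bool" where
  "quadlin F \<longleftrightarrow> (\<forall>y z w. lin (\<lambda>x. F x y z w)) \<and> (\<forall>x z w. lin (\<lambda>y. F x y z w)) \<and>
     (\<forall>x y w. lin (\<lambda>z. F x y z w)) \<and> (\<forall>x y z. lin (\<lambda>w. F x y z w))"

lemma bilinI: "\<lbrakk>\<And>y. lin (\<lambda>x. F x y); \<And>x. lin (\<lambda>y. F x y)\<rbrakk> \<Longrightarrow> bilin F"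
  by (simp add: bilin_def)

lemma trilinI: "\<lbrakk>\<And>y z. lin (\<lambda>x. F x y z); \<And>x z. lin (\<lambda>y. F x y z); \<And>x y. lin (\<lambda>z. F x y z)\<rbrakk> \<Longrightarrow> trilin F"
  by (simp add: trilin_def)

lemma quadlinI: "\<lbrakk>\<And>y z w. lin (\<lambda>x. F x y z w); \<And>x z w. lin (\<lambda>y. F x y z w);
    \<And>x y w. lin (\<lambda>z. F x y z w); \<And>x y z. lin (\<lambda>w. F x y z w)\<rbrakk> \<Longrightarrow> quadlin F"
  by (simp add: quadlin_def)

lemma lin_comp: "\<lbrakk>lin f; endo g\<rbrakk> \<Longrightarrow> lin (\<lambda>x. f (g x))"
  by (simp add: lin_def endo_def)

lemma bilin_comp:
  assumes "bilin F" "endo g"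
  shows "lin (\<lambda>x. F (g x) b)" "lin (\<lambda>x. F a (g x))"
  using assms by (simp_all add: bilin_def lin_comp[of "\<lambda>x. F x b"] lin_comp[of "\<lambda>x. F a x"])

lemma trilin_comp:
  assumes "trilin F" "endo g"
  shows "lin (\<lambda>x. F (g x) b c)" "lin (\<lambda>x. F a (g x) c)" "lin (\<lambda>x. F a b (g x))"
  using assms by (simp_all add: trilin_def lin_comp[of "\<lambda>x. F x b c"] lin_comp[of "\<lambda>x. F a x c"] lin_comp[of "\<lambda>x. F a b x"])

lemma quadlin_comp:
  assumes "quadlin F" "endo g"
  shows "lin (\<lambda>x. F (g x) b c d)" "lin (\<lambda>x. F a (g x) c d)" "lin (\<lambda>x. F a b (g x) d)" "lin (\<lambda>x. F a b c (g x))"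
  using assms by (simp_all add: quadlin_def lin_comp[of "\<lambda>x. F x b c d"] lin_comp[of "\<lambda>x. F a x c d"]
    lin_comp[of "\<lambda>x. F a b x d"] lin_comp[of "\<lambda>x. F a b c x"])

lemma lin_cmult: "lin f \<Longrightarrow> lin (\<lambda>x. c * f x)"
  and lin_multc: "lin f \<Longrightarrow> lin (\<lambda>x. f x * c)"
  by (simp_all add: lin_def algebra_simps)

lemma lin_sum: "(\<And>i. lin (F i)) \<Longrightarrow> lin (\<lambda>x. \<Sum>i\<in>I. F i x)"
  by (simp add: lin_def sum.distrib sum_distrib_left)

lemma lin_sum2: "(\<And>u v. lin (\<lambda>x. F x u v)) \<Longrightarrow> lin (\<lambda>x. sum2 B k (F x))"
  unfolding sum2_def by (intro lin_sum lin_cmult)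

lemma lin_sum3: "(\<And>u v w. lin (\<lambda>x. F x u v w)) \<Longrightarrow> lin (\<lambda>x. sum3 B k (F x))"
  unfolding sum3_def by (intro lin_sum lin_cmult)

lemma endo_comp: "endo f \<Longrightarrow> endo g \<Longrightarrow> endo (\<lambda>x. f (g x))"
  by (simp add: endo_def)

lemma endo_id: "endo (\<lambda>x. x)"
  by (simp add: endo_def)

end

locale dual_basis = multilinear_forms scale + finite_dimensional_vector_space scale B
  for scale :: "'k::field \<Rightarrow> 'a::ab_group_add \<Rightarrow> 'a" and B :: "'a set"
begin

definition dual :: "'a \<Rightarrow> 'a \<Rightarrow> 'k" where "dual b x = representation B x b"

lemma lin_dual: "endo g \<Longrightarrow> lin (\<lambda>x. dual b (g x))"
proof (rule lin_comp)
  show "lin (dual b)"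
    unfolding lin_def dual_def
    by (simp add: representation_add representation_scale independent_Basis span_Basis)
qed

lemma dual_expand: "x = (\<Sum>b\<in>B. scale (dual b x) b)"
  unfolding dual_def by (rule sum_representation_eq[symmetric]) (auto simp: independent_Basis span_Basis finite_Basis)

lemma lin_sum_scale:
  assumes "lin f"
  shows "f (\<Sum>i\<in>I. scale (c i) (h i)) = (\<Sum>i\<in>I. c i * f (h i))"
proof -
  have [simp]: "f 0 = 0" using assms unfolding lin_def by (metis add.right_neutral add_left_imp_eq)
  show ?thesis
    by (induction I rule: infinite_finite_induct) (use assms in \<open>auto simp: lin_def\<close>)
qed

lemma lin_expand: "lin f \<Longrightarrow> f x = (\<Sum>b\<in>B. dual b x * f b)"
  by (rule trans[OF arg_cong[where f=f, OF dual_expand]]) (rule lin_sum_scale)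

text \<open>Coordinates separate points. Identities between elements of H are therefore tested on
  linear forms.\<close>

lemma lin_ext: "(\<And>f. lin f \<Longrightarrow> f x = f y) \<Longrightarrow> x = y"
proof -
  assume eq: "\<And>f. lin f \<Longrightarrow> f x = f y"
  have "dual b x = dual b y" for b by (rule eq[OF lin_dual[OF endo_id]])
  then have "(\<Sum>b\<in>B. scale (dual b x) b) = (\<Sum>b\<in>B. scale (dual b y) b)" by simp
  then show "x = y" unfolding dual_expand[symmetric] .
qed

lemma bilin_expand:
  assumes F: "bilin F"
  shows "F x y = (\<Sum>b\<in>B. \<Sum>c\<in>B. dual b x * dual c y * F b c)"
proof -
  have "F x y = (\<Sum>b\<in>B. dual b x * F b y)"
    using F by (intro lin_expand[of "\<lambda>x. F x y"]) (simp add: bilin_def)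
  also have "\<dots> = (\<Sum>b\<in>B. dual b x * (\<Sum>c\<in>B. dual c y * F b c))"
  proof -
    have "F b y = (\<Sum>c\<in>B. dual c y * F b c)" for b
      using F by (intro lin_expand) (simp add: bilin_def)
    then show ?thesis by simp
  qed
  finally show ?thesis by (simp only: sum_distrib_left mult.assoc)
qed

end

section \<open>Calculus in quasi-Hopf algebras\<close>

text \<open>
  The multiplication is a parameter, so that the opposite algebra, with \<open>\<phi>\<close> and \<open>\<phi>\<inverse>\<close> as well as
  \<open>S\<close> and \<open>S\<inverse>\<close> interchanged, is another instance: each statement about \<open>p\<^sub>R\<close> and \<open>U\<close>
  thereby yields its mirror image about \<open>q\<^sub>R\<close> and \<open>V\<close>.

  A tensor \<open>t = \<Sum> t1 \<otimes> t2\<close> enters through the functional \<open>F \<mapsto> \<Sum> F(t1, t2)\<close>: \<open>D a\<close>, \<open>Phi\<close>, \<open>Psi\<close>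
  below belong to \<open>\<Delta>(a)\<close>, \<open>\<phi>\<close>, \<open>\<phi>\<inverse>\<close>, and \<open>PR\<close>, \<open>QR\<close>, \<open>UR\<close>, \<open>VR\<close>, \<open>GR\<close>, \<open>FR\<close>, \<open>WR\<close>, \<open>Db a\<close>
  to \<open>p\<^sub>R\<close>, \<open>q\<^sub>R\<close>, \<open>U\<close>, \<open>V\<close>, \<open>g\<close>, \<open>f\<close>, \<open>f\<inverse>\<close> and the twisted comultiplication of \<open>a\<close>.
\<close>

locale quasi_hopf_calculus = dual_basis scale B
  for scale :: "'k::field \<Rightarrow> 'a::ab_group_add \<Rightarrow> 'a" and B :: "'a set" +
  fixes mul :: "'a \<Rightarrow> 'a \<Rightarrow> 'a" (infixl \<open>\<cdot>\<close> 75)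
    and one :: 'a
    and comul_coeff :: "'a \<Rightarrow> 'a \<Rightarrow> 'a \<Rightarrow> 'k"
    and phi_coeff psi_coeff :: "'a \<Rightarrow> 'a \<Rightarrow> 'a \<Rightarrow> 'k"
    and eps :: "'a \<Rightarrow> 'k"
    and S T :: "'a \<Rightarrow> 'a"
    and al be :: 'a
  assumes endo_mul_right: "endo (\<lambda>x. x \<cdot> c)"
    and endo_mul_left: "endo (\<lambda>x. c \<cdot> x)"
    and mul_assoc [simp]: "x \<cdot> y \<cdot> z = x \<cdot> (y \<cdot> z)"
    and one_mul [simp]: "one \<cdot> x = x"
    and mul_one [simp]: "x \<cdot> one = x"
    and comul_coeff_lin: "lin (\<lambda>a. comul_coeff a b c)"
    and comul_one: "bilin F \<Longrightarrow> sum2 B (comul_coeff one) F = F one one"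
    and comul_mul: "bilin F \<Longrightarrow> sum2 B (comul_coeff (a \<cdot> b)) F =
      sum2 B (comul_coeff a) (\<lambda>x y. sum2 B (comul_coeff b) (\<lambda>u v. F (x \<cdot> u) (y \<cdot> v)))"
    and eps_lin: "lin eps"
    and eps_one [simp]: "eps one = 1"
    and eps_mul [simp]: "eps (x \<cdot> y) = eps x * eps y"
    and phi_psi: "trilin G \<Longrightarrow> sum3 B phi_coeff (\<lambda>X Y Z. sum3 B psi_coeff (\<lambda>x y z. G (X \<cdot> x) (Y \<cdot> y) (Z \<cdot> z))) = G one one one"
    and psi_phi: "trilin G \<Longrightarrow> sum3 B psi_coeff (\<lambda>X Y Z. sum3 B phi_coeff (\<lambda>x y z. G (X \<cdot> x) (Y \<cdot> y) (Z \<cdot> z))) = G one one one"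
    and quasi_coassoc: "trilin G \<Longrightarrow>
      sum2 B (comul_coeff a) (\<lambda>x y. sum2 B (comul_coeff y) (\<lambda>u v. sum3 B phi_coeff (\<lambda>X Y Z. G (x \<cdot> X) (u \<cdot> Y) (v \<cdot> Z)))) =
      sum2 B (comul_coeff a) (\<lambda>x y. sum2 B (comul_coeff x) (\<lambda>u v. sum3 B phi_coeff (\<lambda>X Y Z. G (X \<cdot> u) (Y \<cdot> v) (Z \<cdot> y))))"
    and pentagon: "quadlin K \<Longrightarrow>
      sum3 B phi_coeff (\<lambda>X Y Z. sum3 B phi_coeff (\<lambda>X' Y' Z'. sum2 B (comul_coeff Z) (\<lambda>u v. sum2 B (comul_coeff X') (\<lambda>s t.
        K (X \<cdot> s) (Y \<cdot> t) (u \<cdot> Y') (v \<cdot> Z'))))) =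
      sum3 B phi_coeff (\<lambda>x y z. sum3 B phi_coeff (\<lambda>X Y Z. sum3 B phi_coeff (\<lambda>X' Y' Z'. sum2 B (comul_coeff Y) (\<lambda>u v.
        K (X \<cdot> X') (x \<cdot> (u \<cdot> Y')) (y \<cdot> (v \<cdot> Z')) (z \<cdot> Z)))))"
    and counit_l: "lin f \<Longrightarrow> sum2 B (comul_coeff a) (\<lambda>x y. eps x * f y) = f a"
    and counit_r: "lin f \<Longrightarrow> sum2 B (comul_coeff a) (\<lambda>x y. eps y * f x) = f a"
    and counit_phi: "bilin F \<Longrightarrow> sum3 B phi_coeff (\<lambda>X Y Z. eps Y * F X Z) = F one one"
    and S_endo: "endo S"
    and S_T [simp]: "S (T x) = x"
    and T_S [simp]: "T (S x) = x"
    and S_one [simp]: "S one = one"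
    and S_mul [simp]: "S (x \<cdot> y) = S y \<cdot> S x"
    and antipode_al: "lin f \<Longrightarrow> sum2 B (comul_coeff a) (\<lambda>x y. f (S x \<cdot> (al \<cdot> y))) = eps a * f al"
    and antipode_be: "lin f \<Longrightarrow> sum2 B (comul_coeff a) (\<lambda>x y. f (x \<cdot> (be \<cdot> S y))) = eps a * f be"
    and antipode_phi: "lin f \<Longrightarrow> sum3 B phi_coeff (\<lambda>X Y Z. f (X \<cdot> (be \<cdot> (S Y \<cdot> (al \<cdot> Z))))) = f one"
    and antipode_psi: "lin f \<Longrightarrow> sum3 B psi_coeff (\<lambda>X Y Z. f (S X \<cdot> (al \<cdot> (Y \<cdot> (be \<cdot> S Z))))) = f one"
    and eps_al [simp]: "eps al = 1"
    and eps_be [simp]: "eps be = 1"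
begin

abbreviation "D a \<equiv> sum2 B (comul_coeff a)"
abbreviation "Phi \<equiv> sum3 B phi_coeff"
abbreviation "Psi \<equiv> sum3 B psi_coeff"

section \<open>Linearity rules, the counit and the inverse reassociator\<close>

lemma lin_D: "endo g \<Longrightarrow> lin (\<lambda>x. D (g x) F)"
  unfolding sum2_def by (intro lin_sum lin_multc lin_comp[OF comul_coeff_lin])

lemma lin_eps: "endo g \<Longrightarrow> lin (\<lambda>x. eps (g x))"
  by (rule lin_comp[OF eps_lin])

lemma T_mul [simp]: "T (x \<cdot> y) = T y \<cdot> T x"
  by (metis S_T S_mul T_S)

lemma T_one [simp]: "T one = one"
  by (metis S_one T_S)

lemma T_endo: "endo T"
  using S_endo unfolding endo_def by (metis S_T T_S)

lemmas endo_S = endo_comp[OF S_endo]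
lemmas endo_T = endo_comp[OF T_endo]
lemmas endo_ml = endo_comp[OF endo_mul_left]
lemmas endo_mr = endo_comp[OF endo_mul_right]

lemmas mlin = bilinI trilinI quadlinI lin_D lin_sum2 lin_sum3 lin_eps lin_cmult lin_multc
  endo_S endo_T endo_ml endo_mr endo_id

text \<open>Normal form of nested independent summations: \<open>\<phi>\<inverse>\<close> outermost, then \<open>\<phi>\<close>, then \<open>\<Delta>\<close>.\<close>

lemmas D_Phi = sum2_sum3[of B "comul_coeff a" phi_coeff for a]
lemmas D_Psi = sum2_sum3[of B "comul_coeff a" psi_coeff for a]
lemmas Phi_Psi = sum3_sum3[of B phi_coeff psi_coeff]
lemmas order = D_Phi D_Psi Phi_Psi

text \<open>Quasi-coassociativity multiplied by \<phi>\<inverse> from both sides. Inserting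
  \<phi>\<inverse> \<phi> on the left gives the axiom something to act on, and the \<phi> that comes
  out on the right is cancelled by the \<phi>\<inverse> inside \<open>L\<close>.\<close>

lemma quasi_coassoc_inv:
  assumes F: "trilin F"
  shows "D a (\<lambda>x y. D x (\<lambda>u v. Psi (\<lambda>X Y Z. F (u \<cdot> X) (v \<cdot> Y) (y \<cdot> Z)))) =
         D a (\<lambda>x y. D y (\<lambda>u v. Psi (\<lambda>X Y Z. F (X \<cdot> x) (Y \<cdot> u) (Z \<cdot> v))))"
proof -
  define L where "L p q r = Psi (\<lambda>X Y Z. F (p \<cdot> X) (q \<cdot> Y) (r \<cdot> Z))" for p q r
  note l = mlin trilin_comp[OF F]
  have L: "trilin L" unfolding L_def by (intro l)
  note l = l trilin_comp[OF L]
  have L_phi: "Phi (\<lambda>X Y Z. L (p \<cdot> X) (q \<cdot> Y) (r \<cdot> Z)) = F p q r" for p q r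
  proof -
    have "trilin (\<lambda>a b c. F (p \<cdot> a) (q \<cdot> b) (r \<cdot> c))" by (intro l)
    from phi_psi[OF this] show ?thesis by (simp add: L_def)
  qed
  have t1: "trilin (\<lambda>p q r. D a (\<lambda>x y. D x (\<lambda>u v. L (p \<cdot> u) (q \<cdot> v) (r \<cdot> y))))" by (intro l)
  have t2: "trilin (\<lambda>p q r. L (x \<cdot> p) (y \<cdot> q) (z \<cdot> r))" for x y z by (intro l)
  have "D a (\<lambda>x y. D x (\<lambda>u v. L u v y)) =
    Psi (\<lambda>x y z. D a (\<lambda>x' y'. D x' (\<lambda>u v. Phi (\<lambda>X Y Z. L (x \<cdot> (X \<cdot> u)) (y \<cdot> (Y \<cdot> v)) (z \<cdot> (Z \<cdot> y'))))))"
    using psi_phi[OF t1] by (simp add: order)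
  also have "\<dots> = Psi (\<lambda>x y z. D a (\<lambda>x' y'. D y' (\<lambda>u v. Phi (\<lambda>X Y Z. L (x \<cdot> (x' \<cdot> X)) (y \<cdot> (u \<cdot> Y)) (z \<cdot> (v \<cdot> Z))))))"
    using quasi_coassoc[OF t2, of a] by simp
  also have "\<dots> = Psi (\<lambda>x y z. D a (\<lambda>x' y'. D y' (\<lambda>u v. F (x \<cdot> x') (y \<cdot> u) (z \<cdot> v))))"
    using L_phi[of "_ \<cdot> _" "_ \<cdot> _" "_ \<cdot> _"] by simp
  finally show ?thesis by (simp add: L_def order)
qed

text \<open>The axiom only treats the middle leg. Applying \<epsilon> to the second leg of the
  pentagon leaves \<phi> = (1 \<otimes> (\<epsilon> \<otimes> id \<otimes> id)(\<phi>)) \<phi>; the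
  \<phi>\<inverse> on the right inside \<open>L\<close> cancels \<phi>.\<close>

lemma counit_phi_left:
  assumes F: "bilin F"
  shows "Phi (\<lambda>X Y Z. eps X * F Y Z) = F one one"
proof -
  define L where "L p q r = Psi (\<lambda>X Y Z. eps (p \<cdot> X) * F (q \<cdot> Y) (r \<cdot> Z))" for p q r
  note l = mlin bilin_comp[OF F]
  have L: "trilin L" unfolding L_def by (intro l)
  note l = l trilin_comp[OF L]
  have L_phi: "Phi (\<lambda>X Y Z. L (p \<cdot> X) (q \<cdot> Y) (r \<cdot> Z)) = eps p * F q r" for p q r
  proof -
    have "trilin (\<lambda>a b c. eps (p \<cdot> a) * F (q \<cdot> b) (r \<cdot> c))" by (intro l)
    from phi_psi[OF this] show ?thesis by (simp add: L_def)
  qed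
  have K: "quadlin (\<lambda>a b c d. eps b * L a c d)" by (intro l)
  have "Phi (\<lambda>X Y Z. Phi (\<lambda>X' Y' Z'. D Z (\<lambda>u v. D X' (\<lambda>s t. eps (Y \<cdot> t) * L (X \<cdot> s) (u \<cdot> Y') (v \<cdot> Z'))))) = F one one"
  proof -
    have l1: "lin (\<lambda>s. L (X \<cdot> s) p q)" for X p q by (intro l)
    have 1: "D X' (\<lambda>s t. eps (Y \<cdot> t) * L (X \<cdot> s) p q) = eps Y * L (X \<cdot> X') p q" for X X' Y p q
      using counit_r[OF l1, of X' X p q] by (simp add: sum23_scalar mult.assoc)
    have l2: "bilin (\<lambda>X Z. Phi (\<lambda>X' Y' Z'. D Z (\<lambda>u v. L (X \<cdot> X') (u \<cdot> Y') (v \<cdot> Z'))))" by (intro l)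
    have l3: "bilin (\<lambda>u v. L X' (u \<cdot> Y') (v \<cdot> Z'))" for X' Y' Z' by (intro l)
    show ?thesis unfolding 1
      using counit_phi[OF l2] L_phi[of one one one] by (simp add: sum23_scalar comul_one[OF l3])
  qed
  moreover have "Phi (\<lambda>x y z. Phi (\<lambda>X Y Z. Phi (\<lambda>X' Y' Z'. D Y (\<lambda>u v.
        eps (x \<cdot> (u \<cdot> Y')) * L (X \<cdot> X') (y \<cdot> (v \<cdot> Z')) (z \<cdot> Z))))) = Phi (\<lambda>X Y Z. eps X * F Y Z)"
  proof -
    have l1: "lin (\<lambda>v. L p (y \<cdot> (v \<cdot> Z')) r)" for y p r Z' by (intro l)
    have 1: "D Y (\<lambda>u v. eps (x \<cdot> (u \<cdot> Y')) * L p (y \<cdot> (v \<cdot> Z')) r) = eps x * (eps Y' * L p (y \<cdot> (Y \<cdot> Z')) r)" for x y p r Y Z' Y'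
      using counit_l[OF l1, of Y p y Z' r] by (simp add: sum23_scalar mult.assoc mult.left_commute[of "eps _" "eps Y'"])
    have l2: "bilin (\<lambda>X' Z'. L (X \<cdot> X') (y \<cdot> (Y \<cdot> Z')) r)" for X y Y r by (intro l)
    have 2: "Phi (\<lambda>X' Y' Z'. eps x * (eps Y' * L (X \<cdot> X') (y \<cdot> (Y \<cdot> Z')) r)) = eps x * L X (y \<cdot> Y) r" for X y Y r x
      using counit_phi[OF l2, of X y Y r] by (simp add: sum23_scalar)
    show ?thesis unfolding 1 2 using L_phi[of one] by (simp add: sum23_scalar)
  qed
  ultimately show ?thesis using pentagon[OF K] by simp
qed

text \<open>Applying \<epsilon> to the third leg of the pentagon leaves \<phi> = \<phi> ((id
  \<otimes> id \<otimes> \<epsilon>)(\<phi>) \<otimes> 1), so here \<open>L\<close> carries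
  \<phi>\<inverse> on the left.\<close>

lemma counit_phi_right:
  assumes F: "bilin F"
  shows "Phi (\<lambda>X Y Z. eps Z * F X Y) = F one one"
proof -
  define L where "L p q r = Psi (\<lambda>X Y Z. eps (Z \<cdot> r) * F (X \<cdot> p) (Y \<cdot> q))" for p q r
  note l = mlin bilin_comp[OF F]
  have L: "trilin L" unfolding L_def by (intro l)
  note l = l trilin_comp[OF L]
  have L_phi: "Phi (\<lambda>X Y Z. L (X \<cdot> p) (Y \<cdot> q) (Z \<cdot> r)) = eps r * F p q" for p q r
  proof -
    have "trilin (\<lambda>a b c. eps (c \<cdot> r) * F (a \<cdot> p) (b \<cdot> q))" by (intro l)
    from psi_phi[OF this] show ?thesis by (simp add: L_def Phi_Psi)
  qed
  have K: "quadlin (\<lambda>a b c d. eps c * L a b d)" by (intro l)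
  have "Phi (\<lambda>X Y Z. Phi (\<lambda>X' Y' Z'. D Z (\<lambda>u v. D X' (\<lambda>s t. eps (u \<cdot> Y') * L (X \<cdot> s) (Y \<cdot> t) (v \<cdot> Z'))))) = F one one"
  proof -
    have l1: "lin (\<lambda>v. D X' (\<lambda>s t. L (X \<cdot> s) (Y \<cdot> t) (v \<cdot> Z')))" for X X' Y Z' by (intro l)
    have 1: "D Z (\<lambda>u v. D X' (\<lambda>s t. eps (u \<cdot> Y') * L (X \<cdot> s) (Y \<cdot> t) (v \<cdot> Z'))) =
      eps Y' * D X' (\<lambda>s t. L (X \<cdot> s) (Y \<cdot> t) (Z \<cdot> Z'))" for X X' Y Z Z' Y'
      using counit_l[OF l1, of Z X' X Y Z'] by (simp add: sum23_scalar mult.assoc mult.left_commute[of "eps _" "eps Y'"])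
    have l2: "bilin (\<lambda>X' Z'. D X' (\<lambda>s t. L (X \<cdot> s) (Y \<cdot> t) (Z \<cdot> Z')))" for X Y Z by (intro l)
    have l3: "bilin (\<lambda>s t. L (X \<cdot> s) (Y \<cdot> t) Z)" for X Y Z by (intro l)
    show ?thesis unfolding 1
      using counit_phi[OF l2] L_phi[of one one one] by (simp add: sum23_scalar comul_one[OF l3])
  qed
  moreover have "Phi (\<lambda>x y z. Phi (\<lambda>X Y Z. Phi (\<lambda>X' Y' Z'. D Y (\<lambda>u v.
        eps (y \<cdot> (v \<cdot> Z')) * L (X \<cdot> X') (x \<cdot> (u \<cdot> Y')) (z \<cdot> Z))))) = Phi (\<lambda>X Y Z. eps Z * F X Y)"
  proof -
    have l1: "lin (\<lambda>u. L p (x \<cdot> (u \<cdot> Y')) r)" for x p r Y' by (intro l)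
    have 1: "D Y (\<lambda>u v. eps (y \<cdot> (v \<cdot> Z')) * L p (x \<cdot> (u \<cdot> Y')) r) = eps y * (eps Z' * L p (x \<cdot> (Y \<cdot> Y')) r)" for x y p r Y Z' Y'
      using counit_r[OF l1, of Y p x Y' r] by (simp add: sum23_scalar mult.assoc mult.left_commute[of "eps _" "eps Z'"])
    have l2: "bilin (\<lambda>x z. Phi (\<lambda>X Y Z. Phi (\<lambda>X' Y' Z'. eps Z' * L (X \<cdot> X') (x \<cdot> (Y \<cdot> Y')) (z \<cdot> Z))))" by (intro l)
    have 2: "Phi (\<lambda>X Y Z. L (X \<cdot> X') (Y \<cdot> Y') Z) = F X' Y'" for X' Y'
      using L_phi[of X' Y' one] by simp
    show ?thesis unfolding 1
      using counit_phi[OF l2]  by (simp add: sum23_scalar sum3_sum3[of B phi_coeff phi_coeff] 2)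
  qed
  ultimately show ?thesis using pentagon[OF K] by simp
qed

lemma counit_psi:
  assumes F: "bilin F"
  shows "Psi (\<lambda>X Y Z. eps Y * F X Z) = F one one"
proof -
  note l = mlin bilin_comp[OF F]
  have 1: "trilin (\<lambda>a b c. eps b * F a c)" by (intro l)
  have 2: "bilin (\<lambda>X Z. F (X \<cdot> x) (Z \<cdot> z))" for x z by (intro l)
  have 3: "Phi (\<lambda>X Y Z. eps Y * (eps y * F (X \<cdot> x) (Z \<cdot> z))) = eps y * F x z" for x y z
    unfolding mult.left_commute[of _ "eps y"] sum3_cmult counit_phi[OF 2] by simp
  show ?thesis
    using phi_psi[OF 1] by (simp add: Phi_Psi mult.assoc 3)
qed

lemma counit_psi_left:
  assumes F: "bilin F"
  shows "Psi (\<lambda>X Y Z. eps X * F Y Z) = F one one"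
proof -
  note l = mlin bilin_comp[OF F]
  have 1: "trilin (\<lambda>a b c. eps a * F b c)" by (intro l)
  have 2: "bilin (\<lambda>X Z. F (X \<cdot> x) (Z \<cdot> z))" for x z by (intro l)
  have 3: "Phi (\<lambda>X Y Z. eps X * (eps x * F (Y \<cdot> y) (Z \<cdot> z))) = eps x * F y z" for x y z
    unfolding mult.left_commute[of _ "eps x"] sum3_cmult counit_phi_left[OF 2] by simp
  show ?thesis
    using phi_psi[OF 1] by (simp add: Phi_Psi mult.assoc 3)
qed

lemma counit_psi_right:
  assumes F: "bilin F"
  shows "Psi (\<lambda>X Y Z. eps Z * F X Y) = F one one"
proof -
  note l = mlin bilin_comp[OF F]
  have 1: "trilin (\<lambda>a b c. eps c * F a b)" by (intro l)
  have 2: "bilin (\<lambda>X Z. F (X \<cdot> x) (Z \<cdot> z))" for x z by (intro l)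
  have 3: "Phi (\<lambda>X Y Z. eps Z * (eps z * F (X \<cdot> x) (Y \<cdot> y))) = eps z * F x y" for x y z
    unfolding mult.left_commute[of _ "eps z"] sum3_cmult counit_phi_right[OF 2] by simp
  show ?thesis
    using phi_psi[OF 1] by (simp add: Phi_Psi mult.assoc 3)
qed

text \<open>Apply \<epsilon> to S(a1) \<alpha> a2 = \<epsilon>(a) \<alpha>; the normalisation
  \<epsilon>(\<alpha>) = 1 enters here.\<close>

lemma eps_S [simp]: "eps (S a) = eps a"
proof -
  have 1: "lin (\<lambda>x. eps (S x))" and 2: "lin eps" by (intro mlin eps_lin)+
  show ?thesis
    using antipode_al[OF 2, of a] counit_r[OF 1, of a] by (simp add: mult.commute)
qed

lemma eps_T [simp]: "eps (T a) = eps a"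
  by (metis eps_S S_T)

text \<open>\<open>mul_1D1 k F a b c d\<close> evaluates \<open>F\<close> at \<open>(a \<otimes> b \<otimes> c \<otimes> d) (id \<otimes> \<Delta> \<otimes> id)(t)\<close>, where \<open>t\<close>
  has the coefficients \<open>k\<close>; the other names are formed likewise. These operators compose like the
  elements of the algebra, so that all rearrangements of the pentagon are formal.\<close>

definition mul_1D1 where "mul_1D1 k F a b c d = sum3 B k (\<lambda>X Y Z. D Y (\<lambda>u v. F (a \<cdot> X) (b \<cdot> u) (c \<cdot> v) (d \<cdot> Z)))"
definition mul_D11 where "mul_D11 k F a b c d = sum3 B k (\<lambda>X Y Z. D X (\<lambda>u v. F (a \<cdot> u) (b \<cdot> v) (c \<cdot> Y) (d \<cdot> Z)))"
definition mul_11D where "mul_11D k F a b c d = sum3 B k (\<lambda>X Y Z. D Z (\<lambda>u v. F (a \<cdot> X) (b \<cdot> Y) (c \<cdot> u) (d \<cdot> v)))"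
definition mul_1_111 where "mul_1_111 k F a b c d = sum3 B k (\<lambda>X Y Z. F a (b \<cdot> X) (c \<cdot> Y) (d \<cdot> Z))"
definition mul_111_1 where "mul_111_1 k F a b c d = sum3 B k (\<lambda>X Y Z. F (a \<cdot> X) (b \<cdot> Y) (c \<cdot> Z) d)"

lemmas mul4_defs = mul_1D1_def mul_D11_def mul_11D_def mul_1_111_def mul_111_1_def

lemma quadlin_mul4:
  assumes F: "quadlin F"
  shows "quadlin (mul_1D1 k F)" "quadlin (mul_D11 k F)" "quadlin (mul_11D k F)"
    "quadlin (mul_1_111 k F)" "quadlin (mul_111_1 k F)"
  unfolding mul4_defs by (intro mlin quadlin_comp[OF F])+

text \<open>\<Delta> is a unital algebra morphism, so applying it to one leg of inverse tensors
  leaves them inverse. The coefficients are generic because \<phi> \<phi>\<inverse> and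
  \<phi>\<inverse> \<phi> both occur.\<close>

lemma mul4_inverse:
  assumes F: "quadlin F"
    and kl: "\<And>G. trilin G \<Longrightarrow> sum3 B k (\<lambda>X Y Z. sum3 B l (\<lambda>x y z. G (X \<cdot> x) (Y \<cdot> y) (Z \<cdot> z))) = G one one one"
  shows "mul_1D1 k (mul_1D1 l F) = F" "mul_D11 k (mul_D11 l F) = F" "mul_11D k (mul_11D l F) = F"
    "mul_1_111 k (mul_1_111 l F) = F" "mul_111_1 k (mul_111_1 l F) = F"
proof -
  note l = mlin quadlin_comp[OF F]
  note s = sum2_sum3[of B "comul_coeff _" l]
  have *: "trilin (\<lambda>X Y Z. D Y (\<lambda>u v. F (a \<cdot> X) (b \<cdot> u) (c \<cdot> v) (d \<cdot> Z)))"
     "trilin (\<lambda>X Y Z. D X (\<lambda>u v. F (a \<cdot> u) (b \<cdot> v) (c \<cdot> Y) (d \<cdot> Z)))"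
     "trilin (\<lambda>X Y Z. D Z (\<lambda>u v. F (a \<cdot> X) (b \<cdot> Y) (c \<cdot> u) (d \<cdot> v)))"
     "trilin (\<lambda>X Y Z. F a (b \<cdot> X) (c \<cdot> Y) (d \<cdot> Z))" "trilin (\<lambda>X Y Z. F (a \<cdot> X) (b \<cdot> Y) (c \<cdot> Z) d)"
     for a b c d by (intro l)+
  have b: "bilin (\<lambda>u v. F p (b \<cdot> u) (c \<cdot> v) q)" "bilin (\<lambda>u v. F (b \<cdot> u) (c \<cdot> v) p q)"
     "bilin (\<lambda>u v. F p q (b \<cdot> u) (c \<cdot> v))" for b c p q
    by (intro l)+
  show "mul_1D1 k (mul_1D1 l F) = F"
    by (intro ext) (use kl[OF *(1)] in \<open>simp add: mul4_defs s comul_mul[OF b(1)] comul_one[OF b(1)]\<close>)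
  show "mul_D11 k (mul_D11 l F) = F"
    by (intro ext) (use kl[OF *(2)] in \<open>simp add: mul4_defs s comul_mul[OF b(2)] comul_one[OF b(2)]\<close>)
  show "mul_11D k (mul_11D l F) = F"
    by (intro ext) (use kl[OF *(3)] in \<open>simp add: mul4_defs s comul_mul[OF b(3)] comul_one[OF b(3)]\<close>)
  show "mul_1_111 k (mul_1_111 l F) = F"
    by (intro ext) (use kl[OF *(4)] in \<open>simp add: mul4_defs\<close>)
  show "mul_111_1 k (mul_111_1 l F) = F"
    by (intro ext) (use kl[OF *(5)] in \<open>simp add: mul4_defs\<close>)
qed

lemmas mul4_phi_psi = mul4_inverse[OF _ phi_psi]
lemmas mul4_psi_phi = mul4_inverse[OF _ psi_phi]

lemma pentagon_mul4:
  assumes F: "quadlin F"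
  shows "mul_11D phi_coeff (mul_D11 phi_coeff F) =
    mul_1_111 phi_coeff (mul_1D1 phi_coeff (mul_111_1 phi_coeff F))"
proof (intro ext)
  fix a b c d
  have "quadlin (\<lambda>p q r s. F (a \<cdot> p) (b \<cdot> q) (c \<cdot> r) (d \<cdot> s))"
    by (intro mlin quadlin_comp[OF F])
  from pentagon[OF this]
  show "mul_11D phi_coeff (mul_D11 phi_coeff F) a b c d =
    mul_1_111 phi_coeff (mul_1D1 phi_coeff (mul_111_1 phi_coeff F)) a b c d"
    by (simp add: mul4_defs order)
qed

text \<open>The outermost operator is the leftmost factor, and each variant moves factors of the
  pentagon across the equality. The left side of \<open>pentagon1\<close> is the tensor T \<otimes>
  U \<otimes> V \<otimes> W that defines g; \<open>pentagon5\<close> is the pentagon of the opposite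
  algebra.\<close>

lemma
  assumes F: "quadlin F"
  shows pentagon1: "mul_1_111 psi_coeff (mul_11D phi_coeff F) =
      mul_1D1 phi_coeff (mul_111_1 phi_coeff (mul_D11 psi_coeff F))"
    and pentagon2: "mul_1D1 psi_coeff (mul_1_111 psi_coeff F) =
      mul_111_1 phi_coeff (mul_D11 psi_coeff (mul_11D psi_coeff F))"
    and pentagon3: "mul_11D psi_coeff (mul_1_111 phi_coeff (mul_1D1 phi_coeff F)) =
      mul_D11 phi_coeff (mul_111_1 psi_coeff F)"
    and pentagon4: "mul_111_1 psi_coeff (mul_1D1 psi_coeff F) =
      mul_D11 psi_coeff (mul_11D psi_coeff (mul_1_111 phi_coeff F))"
    and pentagon5: "mul_D11 psi_coeff (mul_11D psi_coeff F) =
      mul_111_1 psi_coeff (mul_1D1 psi_coeff (mul_1_111 psi_coeff F))"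
proof -
  note q = quadlin_mul4
  note p = mul4_phi_psi mul4_psi_phi
  have *: "mul_1D1 psi_coeff (mul_1_111 psi_coeff F) =
      mul_111_1 phi_coeff (mul_D11 psi_coeff (mul_11D psi_coeff F))" if F: "quadlin F" for F
  proof -
    have "F = mul_1_111 phi_coeff (mul_1D1 phi_coeff (mul_111_1 phi_coeff (mul_D11 psi_coeff (mul_11D psi_coeff F))))"
      using pentagon_mul4[of "mul_D11 psi_coeff (mul_11D psi_coeff F)"] by (simp add: q p F)
    then have "mul_1D1 psi_coeff (mul_1_111 psi_coeff F) =
      mul_1D1 psi_coeff (mul_1_111 psi_coeff (mul_1_111 phi_coeff (mul_1D1 phi_coeff (mul_111_1 phi_coeff (mul_D11 psi_coeff (mul_11D psi_coeff F))))))"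
      by simp
    then show ?thesis by (simp add: q p F)
  qed
  show "mul_1D1 psi_coeff (mul_1_111 psi_coeff F) =
      mul_111_1 phi_coeff (mul_D11 psi_coeff (mul_11D psi_coeff F))"
    by (rule *[OF F])
  show "mul_1_111 psi_coeff (mul_11D phi_coeff F) =
      mul_1D1 phi_coeff (mul_111_1 phi_coeff (mul_D11 psi_coeff F))"
    using arg_cong[OF pentagon_mul4[of "mul_D11 psi_coeff F"], of "mul_1_111 psi_coeff"] by (simp add: q p F)
  show "mul_11D psi_coeff (mul_1_111 phi_coeff (mul_1D1 phi_coeff F)) =
      mul_D11 phi_coeff (mul_111_1 psi_coeff F)"
    using arg_cong[OF pentagon_mul4[of "mul_111_1 psi_coeff F"], of "mul_11D psi_coeff"] by (simp add: q p F)
  show "mul_111_1 psi_coeff (mul_1D1 psi_coeff F) =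
      mul_D11 psi_coeff (mul_11D psi_coeff (mul_1_111 phi_coeff F))"
    using arg_cong[OF *[of "mul_1_111 phi_coeff F"], of "mul_111_1 psi_coeff"] by (simp add: q p F)
  show "mul_D11 psi_coeff (mul_11D psi_coeff F) =
      mul_111_1 psi_coeff (mul_1D1 psi_coeff (mul_1_111 psi_coeff F))"
    using arg_cong[OF *[of F], of "mul_111_1 psi_coeff"] by (simp add: q p F)
qed

text \<open>Applying S\<inverse> to a1 \<beta> S(a2) = \<epsilon>(a) \<beta> gives the
  \<alpha>-relation of the opposite algebra, and vice versa; hence the pair \<open>T be\<close>,
  \<open>T al\<close>. The normalisations by \<phi> and by \<phi>\<inverse> change places in the
  same way.\<close>

lemma opposite: "quasi_hopf_calculus scale B (\<lambda>x y. y \<cdot> x) one comul_coeff psi_coeff phi_coeff eps T S (T be) (T al)"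
proof unfold_locales
  show "endo (\<lambda>x. c \<cdot> x)" "endo (\<lambda>x. x \<cdot> c)" "endo T" for c
    by (intro endo_mul_left endo_mul_right T_endo)+
  show "eps (y \<cdot> x) = eps x * eps y" for x y by simp
  show "bilin F \<Longrightarrow> D (b \<cdot> a) F = D a (\<lambda>x y. D b (\<lambda>u v. F (u \<cdot> x) (v \<cdot> y)))" for F a b
    by (subst comul_mul) (auto intro: sum2_sum2)
  show "trilin G \<Longrightarrow> Psi (\<lambda>X Y Z. Phi (\<lambda>x y z. G (x \<cdot> X) (y \<cdot> Y) (z \<cdot> Z))) = G one one one" for G
    using phi_psi[of G] by (simp only: Phi_Psi)
  show "trilin G \<Longrightarrow> Phi (\<lambda>X Y Z. Psi (\<lambda>x y z. G (x \<cdot> X) (y \<cdot> Y) (z \<cdot> Z))) = G one one one" for G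
    using psi_phi[of G] by (simp only: Phi_Psi)
  show "trilin G \<Longrightarrow>
           D a (\<lambda>x y. D y (\<lambda>u v. Psi (\<lambda>X Y Z. G (X \<cdot> x) (Y \<cdot> u) (Z \<cdot> v)))) =
           D a (\<lambda>x y. D x (\<lambda>u v. Psi (\<lambda>X Y Z. G (u \<cdot> X) (v \<cdot> Y) (y \<cdot> Z))))" for G a
    using quasi_coassoc_inv[of G a] by simp
  show "Psi (\<lambda>X Y Z. Psi (\<lambda>X' Y' Z'. D Z (\<lambda>u v. D X' (\<lambda>s t. K (s \<cdot> X) (t \<cdot> Y) (Y' \<cdot> u) (Z' \<cdot> v))))) =
        Psi (\<lambda>x y z. Psi (\<lambda>X Y Z. Psi (\<lambda>X' Y' Z'. D Y (\<lambda>u v. K (X' \<cdot> X) (Y' \<cdot> u \<cdot> x) (Z' \<cdot> v \<cdot> y) (Z \<cdot> z)))))"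
    if K: "quadlin K" for K
  proof -
    have "Psi (\<lambda>X Y Z. Psi (\<lambda>X' Y' Z'. D Z (\<lambda>u v. D X' (\<lambda>s t. K (s \<cdot> X) (t \<cdot> Y) (Y' \<cdot> u) (Z' \<cdot> v)))))
      = Psi (\<lambda>X' Y' Z'. Psi (\<lambda>X Y Z. D X' (\<lambda>s t. D Z (\<lambda>u v. K (s \<cdot> X) (t \<cdot> Y) (Y' \<cdot> u) (Z' \<cdot> v)))))"
      by (subst sum3_sum3) (subst sum2_sum2, rule refl)
    also have "\<dots> = Psi (\<lambda>X' Y' Z'. Psi (\<lambda>X Y Z. Psi (\<lambda>x y z. D Y (\<lambda>u v. K (X' \<cdot> X) (Y' \<cdot> u \<cdot> x) (Z' \<cdot> v \<cdot> y) (Z \<cdot> z)))))"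
      using fun_cong[OF fun_cong[OF fun_cong[OF fun_cong[OF pentagon5[OF K], of one], of one], of one], of one]
      by (simp add: mul4_defs order)
    also have "\<dots> = Psi (\<lambda>X Y Z. Psi (\<lambda>X' Y' Z'. Psi (\<lambda>x y z. D Y (\<lambda>u v. K (X' \<cdot> X) (Y' \<cdot> u \<cdot> x) (Z' \<cdot> v \<cdot> y) (Z \<cdot> z)))))"
      by (rule sum3_sum3)
    also have "\<dots> = Psi (\<lambda>X Y Z. Psi (\<lambda>x y z. Psi (\<lambda>X' Y' Z'. D Y (\<lambda>u v. K (X' \<cdot> X) (Y' \<cdot> u \<cdot> x) (Z' \<cdot> v \<cdot> y) (Z \<cdot> z)))))"
      by (subst sum3_sum3) (rule refl)
    also have "\<dots> = Psi (\<lambda>x y z. Psi (\<lambda>X Y Z. Psi (\<lambda>X' Y' Z'. D Y (\<lambda>u v. K (X' \<cdot> X) (Y' \<cdot> u \<cdot> x) (Z' \<cdot> v \<cdot> y) (Z \<cdot> z)))))"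
      by (rule sum3_sum3)
    finally show ?thesis .
  qed
  show "lin f \<Longrightarrow> D a (\<lambda>x y. f (y \<cdot> T be \<cdot> T x)) = eps a * f (T be)" for f a
    using antipode_be[OF lin_comp[OF _ T_endo], of f a] by simp
  show "lin f \<Longrightarrow> D a (\<lambda>x y. f (T y \<cdot> T al \<cdot> x)) = eps a * f (T al)" for f a
    using antipode_al[OF lin_comp[OF _ T_endo], of f a] by simp
qed (use antipode_psi[OF lin_comp[OF _ T_endo]] antipode_phi[OF lin_comp[OF _ T_endo]] in
  \<open>simp_all add: comul_coeff_lin comul_one eps_lin counit_l counit_r counit_psi\<close>)

subsection \<open>The elements \<open>p\<^sub>R\<close>, \<open>q\<^sub>R\<close> and \<open>U\<close>\<close>

definition PR where "PR F = Psi (\<lambda>x y z. F x (y \<cdot> (be \<cdot> S z)))"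
definition QR where "QR F = Phi (\<lambda>X Y Z. F X (T (al \<cdot> Z) \<cdot> Y))"

lemma QR_opposite: "quasi_hopf_calculus.PR B (\<lambda>x y. y \<cdot> x) phi_coeff T (T al) = QR"
  by (intro ext) (simp add: QR_def quasi_hopf_calculus.PR_def[OF opposite])

lemma lin_PR: "(\<And>u v. lin (\<lambda>x. F x u v)) \<Longrightarrow> lin (\<lambda>x. PR (F x))"
  unfolding PR_def by (intro lin_sum3)

lemma lin_QR: "(\<And>u v. lin (\<lambda>x. F x u v)) \<Longrightarrow> lin (\<lambda>x. QR (F x))"
  unfolding QR_def by (intro lin_sum3)

lemma PR_sums:
  "PR (\<lambda>x y. sum2 B k (\<lambda>u v. F x y u v)) = sum2 B k (\<lambda>u v. PR (\<lambda>x y. F x y u v))"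
  "PR (\<lambda>x y. sum3 B l (\<lambda>u v w. G x y u v w)) = sum3 B l (\<lambda>u v w. PR (\<lambda>x y. G x y u v w))"
  unfolding PR_def by (rule sum3_sum3 sum2_sum3[symmetric])+

lemma QR_sums:
  "QR (\<lambda>x y. sum2 B k (\<lambda>u v. F x y u v)) = sum2 B k (\<lambda>u v. QR (\<lambda>x y. F x y u v))"
  "QR (\<lambda>x y. sum3 B l (\<lambda>u v w. G x y u v w)) = sum3 B l (\<lambda>u v w. QR (\<lambda>x y. G x y u v w))"
  unfolding QR_def by (rule sum3_sum3 sum2_sum3[symmetric])+

text \<open>Contract the last two legs of \<open>quasi_coassoc_inv\<close> by b \<otimes> e
  \<mapsto> b \<beta> S(e). On one side \<beta> swallows a coproduct, and what remains is
  \<open>\<Delta>(c1) p\<^sub>R (1 \<otimes> S(c2)) = p\<^sub>R (c \<otimes> 1)\<close>.\<close>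

lemma PR_cov:
  assumes F: "bilin F"
  shows "D c (\<lambda>c1 c2. D c1 (\<lambda>u v. PR (\<lambda>p1 p2. F (u \<cdot> p1) (v \<cdot> (p2 \<cdot> S c2))))) = PR (\<lambda>p1 p2. F (p1 \<cdot> c) p2)"
proof -
  note l = mlin bilin_comp[OF F]
  have t: "trilin (\<lambda>a b e. F a (b \<cdot> (be \<cdot> S e)))" by (intro l)
  have b: "D w (\<lambda>u v. F a (y \<cdot> (u \<cdot> (be \<cdot> (S v \<cdot> z))))) = eps w * F a (y \<cdot> (be \<cdot> z))" for w a y z
    using antipode_be[of "\<lambda>w. F a (y \<cdot> (w \<cdot> z))" w] by (simp add: l)
  have e: "D c (\<lambda>x y. eps y * F (a \<cdot> x) b) = F (a \<cdot> c) b" for a b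
    using counit_r[of "\<lambda>x. F (a \<cdot> x) b" c] by (simp add: l)
  show ?thesis
    using quasi_coassoc_inv[OF t, of c] by (simp add: PR_def order b e)
qed

lemma QR_cov:
  assumes F: "bilin F"
  shows "D c (\<lambda>c1 c2. D c1 (\<lambda>u v. QR (\<lambda>q1 q2. F (q1 \<cdot> u) (T c2 \<cdot> (q2 \<cdot> v))))) = QR (\<lambda>q1 q2. F (c \<cdot> q1) q2)"
  using quasi_hopf_calculus.PR_cov[OF opposite F] by (simp add: QR_opposite)

text \<open>Contract \<open>pentagon3\<close> to a \<otimes> b \<beta> S(c) \<alpha> d. The right
  side becomes \<open>\<Delta>(q1) p\<^sub>R (1 \<otimes> S(q2))\<close> because S(q2) = S(Y)
  \<alpha> Z; on the left all coproducts collapse and X \<beta> S(Y) \<alpha> Z = 1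
  finishes.\<close>

lemma QR_PR:
  assumes F: "bilin F"
  shows "QR (\<lambda>q1 q2. D q1 (\<lambda>u v. PR (\<lambda>p1 p2. F (u \<cdot> p1) (v \<cdot> (p2 \<cdot> S q2))))) = F one one"
proof -
  note l = mlin bilin_comp[OF F]
  have K: "quadlin (\<lambda>a b c d. F a (b \<cdot> (be \<cdot> (S c \<cdot> (al \<cdot> d)))))" by (intro l)
  have c1: "D w (\<lambda>s t. F a (Y \<cdot> (A \<cdot> (s \<cdot> (be \<cdot> (S t \<cdot> z)))))) = eps w * F a (Y \<cdot> (A \<cdot> (be \<cdot> z)))" for w a Y A z
    using antipode_be[of "\<lambda>w. F a (Y \<cdot> (A \<cdot> (w \<cdot> z)))" w] by (simp add: l)
  have c2: "Phi (\<lambda>X' Y' Z'. eps Y' * F (X \<cdot> X') (Y \<cdot> (A \<cdot> (be \<cdot> (S B \<cdot> (S u \<cdot> (al \<cdot> (v \<cdot> (C \<cdot> Z'))))))))) =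
     F X (Y \<cdot> (A \<cdot> (be \<cdot> (S B \<cdot> (S u \<cdot> (al \<cdot> (v \<cdot> C)))))))" for X Y A B u v C
    using counit_phi[of "\<lambda>X' Z'. F (X \<cdot> X') (Y \<cdot> (A \<cdot> (be \<cdot> (S B \<cdot> (S u \<cdot> (al \<cdot> (v \<cdot> (C \<cdot> Z'))))))))"] by (simp add: l)
  have c3: "D Z (\<lambda>u v. F X (Y \<cdot> (A \<cdot> (be \<cdot> (S B \<cdot> (S u \<cdot> (al \<cdot> (v \<cdot> C)))))))) = eps Z * F X (Y \<cdot> (A \<cdot> (be \<cdot> (S B \<cdot> (al \<cdot> C)))))" for X Y Z A B C
    using antipode_al[of "\<lambda>w. F X (Y \<cdot> (A \<cdot> (be \<cdot> (S B \<cdot> (w \<cdot> C)))))" Z] by (simp add: l)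
  have c4: "Phi (\<lambda>A B C. F X (Y \<cdot> (A \<cdot> (be \<cdot> (S B \<cdot> (al \<cdot> C)))))) = F X Y" for X Y
    using antipode_phi[of "\<lambda>w. F X (Y \<cdot> w)"] by (simp add: l)
  have "Psi (\<lambda>X Y Z. Phi (\<lambda>A B C. D Z (\<lambda>u v. F X (Y \<cdot> (A \<cdot> (be \<cdot> (S B \<cdot> (S u \<cdot> (al \<cdot> (v \<cdot> C))))))))))
    = F one one"
    using counit_psi_right[OF F] by (simp add: c3 c4 sum23_scalar)
  with fun_cong[OF fun_cong[OF fun_cong[OF fun_cong[OF pentagon3[OF K], of one], of one], of one], of one]
  show ?thesis by (simp add: mul4_defs PR_def QR_def order c1 c2)
qed

lemma comul_mul3:
  assumes G: "bilin G"
  shows "D (a \<cdot> (b \<cdot> c)) G = D a (\<lambda>s t. D b (\<lambda>u v. D c (\<lambda>e f. G (s \<cdot> (u \<cdot> e)) (t \<cdot> (v \<cdot> f)))))"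
proof -
  have "bilin (\<lambda>u v. G (s \<cdot> u) (t \<cdot> v))" for s t by (intro mlin bilin_comp[OF G])
  then show ?thesis by (simp add: comul_mul[OF G] comul_mul)
qed

text \<open>By \<open>PR_cov\<close> a factor to the right of \<open>p\<^sub>R\<close> moves into
  the argument of \<Delta> in front of it. In the applications w is S(x) \<alpha> y, so d1 lands
  where the relation for \<alpha> can reach it.\<close>

lemma PR_absorb:
  assumes F: "bilin F"
  shows "D c1 (\<lambda>s t. D w (\<lambda>u v. PR (\<lambda>p1 p2. F (s \<cdot> (u \<cdot> (p1 \<cdot> c2))) (t \<cdot> (v \<cdot> (p2 \<cdot> r)))))) =
    D c2 (\<lambda>d1 d2. D (c1 \<cdot> (w \<cdot> d1)) (\<lambda>u v. PR (\<lambda>p1 p2. F (u \<cdot> p1) (v \<cdot> (p2 \<cdot> (S d2 \<cdot> r))))))"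
proof -
  note l = mlin bilin_comp[OF F] lin_PR
  have "PR (\<lambda>p1 p2. F (s \<cdot> (u \<cdot> (p1 \<cdot> c2))) (t \<cdot> (v \<cdot> (p2 \<cdot> r)))) =
    D c2 (\<lambda>d1 d2. D d1 (\<lambda>e f. PR (\<lambda>p1 p2. F (s \<cdot> (u \<cdot> (e \<cdot> p1))) (t \<cdot> (v \<cdot> (f \<cdot> (p2 \<cdot> (S d2 \<cdot> r))))))))" for s u t v
    using PR_cov[of "\<lambda>a b. F (s \<cdot> (u \<cdot> a)) (t \<cdot> (v \<cdot> (b \<cdot> r)))" c2] by (simp add: l)
  moreover have "bilin (\<lambda>u v. PR (\<lambda>p1 p2. F (u \<cdot> p1) (v \<cdot> (p2 \<cdot> (S d2 \<cdot> r)))))" for d2 by (intro l)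
  ultimately show ?thesis
    by (simp add: comul_mul3 sum2_sum2[of B "comul_coeff w" "comul_coeff c2"] sum2_sum2[of B "comul_coeff c1" "comul_coeff c2"])
qed

text \<open>
  This is \<open>\<Delta>(S(x) \<alpha> y) p\<^sub>R (1 \<otimes> S(z))\<close> for \<open>\<phi>\<inverse> = x \<otimes> y \<otimes> z\<close>. That it agrees with the definition
  of \<open>U\<close> by means of \<open>f\<close> is proved in \<open>FR_UR\<close> and \<open>WR_FR\<close>.
\<close>

definition UR where
  "UR F = Psi (\<lambda>x y z. D (S x \<cdot> (al \<cdot> y)) (\<lambda>u v. PR (\<lambda>p1 p2. F (u \<cdot> p1) (v \<cdot> (p2 \<cdot> S z)))))"

lemma lin_UR: "(\<And>u v. lin (\<lambda>x. F x u v)) \<Longrightarrow> lin (\<lambda>x. UR (F x))"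
  unfolding UR_def by (intro mlin lin_PR)

text \<open>Apply \<open>quasi_coassoc_inv\<close> to
  \<open>\<Delta>(S(a) \<alpha> b) p\<^sub>R (1 \<otimes> S(e))\<close>, the contraction
  \<open>H\<close> of \<phi>\<inverse> that gives U. \<open>PR_absorb\<close> brings the left side
  into this form, and on the other side \<alpha> collapses the first two legs.\<close>

lemma UR_cov:
  assumes F: "bilin F"
  shows "D c (\<lambda>c1 c2. D (S c1) (\<lambda>s t. UR (\<lambda>x y. F (s \<cdot> (x \<cdot> c2)) (t \<cdot> y)))) = UR (\<lambda>x y. F x (y \<cdot> S c))"
proof -
  note l = mlin bilin_comp[OF F] lin_PR
  define H where "H a b e = D (S a \<cdot> (al \<cdot> b)) (\<lambda>u v. PR (\<lambda>p1 p2. F (u \<cdot> p1) (v \<cdot> (p2 \<cdot> S e))))" for a b e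
  have H: "trilin H" unfolding H_def by (intro l)
  note k2 = PR_absorb[OF F]
  have k3: "D c1 (\<lambda>u v. H (u \<cdot> X) (v \<cdot> Y) Z) = eps c1 * H X Y Z" for c1 X Y Z
  proof -
    have "lin (\<lambda>w. D (S X \<cdot> (w \<cdot> Y)) (\<lambda>u v. PR (\<lambda>p1 p2. F (u \<cdot> p1) (v \<cdot> (p2 \<cdot> S Z)))))" by (intro l)
    from antipode_al[OF this] show ?thesis by (simp add: H_def)
  qed
  have k4: "D c (\<lambda>c1 c2. eps c1 * H X Y (c2 \<cdot> Z)) = H X Y (c \<cdot> Z)" for X Y Z
    by (intro counit_l mlin trilin_comp[OF H])
  have "D c (\<lambda>c1 c2. D (S c1) (\<lambda>s t. UR (\<lambda>x y. F (s \<cdot> (x \<cdot> c2)) (t \<cdot> y)))) =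
     D c (\<lambda>c1 c2. D c2 (\<lambda>d1 d2. Psi (\<lambda>x y z. H (x \<cdot> c1) (y \<cdot> d1) (z \<cdot> d2))))"
    by (simp add: UR_def order k2 H_def)
  also have "\<dots> = Psi (\<lambda>X Y Z. D c (\<lambda>c1 c2. D c1 (\<lambda>u v. H (u \<cdot> X) (v \<cdot> Y) (c2 \<cdot> Z))))"
    using quasi_coassoc_inv[OF H, of c] by (simp add: order)
  also have "\<dots> = UR (\<lambda>x y. F x (y \<cdot> S c))"
    by (simp add: k3 k4 UR_def) (simp add: H_def)
  finally show ?thesis .
qed

text \<open>This expresses \<open>p\<^sub>R\<close> as \<Delta>(X \<beta> S(Y)) U (Z \<otimes> 1)
  and thereby reduces f times \<open>p\<^sub>R\<close>, which enters V, to f \<Delta>(S(a)) and f U.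
  It comes from \<open>pentagon1\<close>, whose factor \<phi> \<otimes> 1 closes with X \<beta> S(Y)
  \<alpha> Z = 1.\<close>

lemma PR_eq_UR:
  assumes F: "bilin F"
  shows "Phi (\<lambda>X Y Z. D (X \<cdot> (be \<cdot> S Y)) (\<lambda>u v. UR (\<lambda>x y. F (u \<cdot> (x \<cdot> Z)) (v \<cdot> y)))) = PR F"
proof -
  note l = mlin bilin_comp[OF F] lin_PR
  define K where "K a b c d = D (a \<cdot> (be \<cdot> (S b \<cdot> (al \<cdot> c)))) (\<lambda>u v. PR (\<lambda>p1 p2. F (u \<cdot> p1) (v \<cdot> (p2 \<cdot> S d))))" for a b c d
  have K: "quadlin K" unfolding K_def by (intro l)
  note k2 = PR_absorb[OF F]
  have k3: "D X (\<lambda>u v. K (e \<cdot> (a \<cdot> u)) (f \<cdot> (b \<cdot> v)) c d) = eps X * K (e \<cdot> a) (f \<cdot> b) c d" for X a b c d e f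
  proof -
    have "lin (\<lambda>w. D (e \<cdot> (a \<cdot> (w \<cdot> (S b \<cdot> (S f \<cdot> (al \<cdot> c)))))) (\<lambda>u v. PR (\<lambda>p1 p2. F (u \<cdot> p1) (v \<cdot> (p2 \<cdot> S d)))))" by (intro l)
    from antipode_be[OF this] show ?thesis by (simp add: K_def)
  qed
  have k4: "D Y (\<lambda>u v. K a (u \<cdot> b) (v \<cdot> c) d) = eps Y * K a b c d" for Y a b c d
  proof -
    have "lin (\<lambda>w. D (a \<cdot> (be \<cdot> (S b \<cdot> (w \<cdot> c)))) (\<lambda>u v. PR (\<lambda>p1 p2. F (u \<cdot> p1) (v \<cdot> (p2 \<cdot> S d)))))" by (intro l)
    from antipode_al[OF this] show ?thesis by (simp add: K_def)
  qed
  have k5: "Phi (\<lambda>X Y Z. K X Y Z one) = PR F"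
  proof -
    have "lin (\<lambda>w. D w (\<lambda>u v. PR (\<lambda>p1 p2. F (u \<cdot> p1) (v \<cdot> p2))))" by (intro l)
    moreover have "bilin (\<lambda>u v. PR (\<lambda>p1 p2. F (u \<cdot> p1) (v \<cdot> p2)))" by (intro l)
    ultimately show ?thesis using antipode_phi[of "\<lambda>w. D w (\<lambda>u v. PR (\<lambda>p1 p2. F (u \<cdot> p1) (v \<cdot> p2)))"]
      by (simp add: K_def comul_one)
  qed
  have k6: "Psi (\<lambda>x y z. eps x * Phi (\<lambda>X Y Z. eps Y * Phi (\<lambda>X' Y' Z'. K (X \<cdot> X') Y' (Z' \<cdot> y) (Z \<cdot> z)))) =
    Phi (\<lambda>X Y Z. eps Y * Phi (\<lambda>X' Y' Z'. K (X \<cdot> X') Y' Z' Z))"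
    using counit_psi_left[of "\<lambda>y z. Phi (\<lambda>X Y Z. eps Y * Phi (\<lambda>X' Y' Z'. K (X \<cdot> X') Y' (Z' \<cdot> y) (Z \<cdot> z)))"]
    by (simp add: l quadlin_comp[OF K])
  have k7: "Phi (\<lambda>X Y Z. eps Y * K (X \<cdot> a) b c (Z \<cdot> d)) = K a b c d" for a b c d
    using counit_phi[of "\<lambda>X Z. K (X \<cdot> a) b c (Z \<cdot> d)"] by (simp add: l quadlin_comp[OF K])
  have "Phi (\<lambda>X Y Z. D (X \<cdot> (be \<cdot> S Y)) (\<lambda>u v. UR (\<lambda>x y. F (u \<cdot> (x \<cdot> Z)) (v \<cdot> y)))) =
    mul_1_111 psi_coeff (mul_11D phi_coeff K) one one one one"
    by (simp add: UR_def order mul4_defs k2 K_def)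
  also have "\<dots> = Phi (\<lambda>X Y Z. eps Y * Phi (\<lambda>X' Y' Z'. K (X \<cdot> X') Y' Z' Z))"
    by (simp add: pentagon1[OF K]) (simp add: mul4_defs k3 k4 order sum23_scalar k6)
  also have "\<dots> = PR F"
    using k7[of _ _ _ one] by (simp add: sum23_scalar[symmetric] sum3_sum3[of B phi_coeff phi_coeff] k5)
  finally show ?thesis .
qed

text \<open>\<open>pentagon2\<close> with its last two legs contracted by \<beta>, which removes the
  factor (id \<otimes> id \<otimes> \<Delta>)(\<phi>\<inverse>). The right side is \<phi>
  (\<Delta>(p1) \<otimes> p2).\<close>

lemma UR_PR_step:
  assumes F: "trilin F"
  shows "Psi (\<lambda>x y z. D y (\<lambda>u v. PR (\<lambda>p1 p2. F x (u \<cdot> p1) (v \<cdot> (p2 \<cdot> S z))))) =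
    Phi (\<lambda>A B C. PR (\<lambda>p1 p2. D p1 (\<lambda>u v. F (A \<cdot> u) (B \<cdot> v) (C \<cdot> p2))))"
proof -
  note l = mlin trilin_comp[OF F]
  define K where "K a b c d = F a b (c \<cdot> (be \<cdot> S d))" for a b c d
  have K: "quadlin K" unfolding K_def by (intro l)
  have k1: "D z (\<lambda>g h. K a b (e \<cdot> (c \<cdot> g)) (d \<cdot> h)) = eps z * K a b (e \<cdot> c) d" for z a b c d e
    using antipode_be[of "\<lambda>w. F a b (e \<cdot> (c \<cdot> (w \<cdot> S d)))" z] by (simp add: l K_def)
  have k2: "Psi (\<lambda>x y z. eps z * K (A \<cdot> (u \<cdot> x)) (B \<cdot> (v \<cdot> y)) c d) = K (A \<cdot> u) (B \<cdot> v) c d" for A u B v c d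
    using counit_psi_right[of "\<lambda>x y. K (A \<cdot> (u \<cdot> x)) (B \<cdot> (v \<cdot> y)) c d"] by (simp add: l quadlin_comp[OF K])
  have "Psi (\<lambda>x y z. D y (\<lambda>u v. PR (\<lambda>p1 p2. F x (u \<cdot> p1) (v \<cdot> (p2 \<cdot> S z))))) =
    mul_1D1 psi_coeff (mul_1_111 psi_coeff K) one one one one"
    by (simp add: PR_def mul4_defs K_def)
  also have "\<dots> = Phi (\<lambda>A B C. Psi (\<lambda>x y z. D x (\<lambda>u v. K (A \<cdot> u) (B \<cdot> v) (C \<cdot> y) z)))"
    by (simp add: pentagon2[OF K]) (simp add: mul4_defs k1 k2)
  finally show ?thesis by (simp add: PR_def K_def)
qed

text \<open>With T \<otimes> U \<otimes> V \<otimes> W as in g this says \<open>\<Delta>(T)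
  p\<^sub>R (1 \<otimes> S(U) \<alpha> V) \<otimes> W = \<phi>\<inverse>\<close>. In the product
  supplied by \<open>pentagon1\<close>, \<alpha> removes (id \<otimes> \<Delta> \<otimes>
  id)(\<phi>), \<open>PR_cov\<close> undoes the coproduct on \<phi>\<inverse>, and
  \<open>QR_PR\<close> evaluates the \<phi> in between.\<close>

lemma PR_contraction:
  assumes M: "trilin M"
    and K_def: "\<And>a b c d. K a b c d = D a (\<lambda>s t. PR (\<lambda>p1 p2. M (s \<cdot> p1) (t \<cdot> (p2 \<cdot> (S b \<cdot> (al \<cdot> c)))) d))"
  shows "mul_1_111 psi_coeff (mul_11D phi_coeff K) one one one one = Psi M"
proof -
  note l = mlin trilin_comp[OF M] lin_PR
  have K: "quadlin K" unfolding K_def by (intro l)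
  define K' where "K' a b c d x = D a (\<lambda>s t. PR (\<lambda>p1 p2. M (s \<cdot> (p1 \<cdot> x)) (t \<cdot> (p2 \<cdot> (S b \<cdot> (al \<cdot> c)))) d))" for a b c d x
  have k1: "D x (\<lambda>u v. K (a \<cdot> u) (b \<cdot> v) c d) = K' a b c d x" for x a b c d
  proof -
    have b1: "bilin (\<lambda>s t. PR (\<lambda>p1 p2. M (s \<cdot> p1) (t \<cdot> (p2 \<cdot> (S v \<cdot> (S b \<cdot> (al \<cdot> c))))) d))" for v by (intro l)
    have b2: "bilin (\<lambda>w r. M (s \<cdot> w) (t \<cdot> (r \<cdot> (S b \<cdot> (al \<cdot> c)))) d)" for s t by (intro l)
    show ?thesis
      using PR_cov[OF b2, where c = x]
      by (simp add: K_def K'_def comul_mul[OF b1] sum2_sum2[of B "comul_coeff x" "comul_coeff a"])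
  qed
  have k2: "Phi (\<lambda>X Y Z. K' X Y (Z \<cdot> y) z x) = M x y z" for x y z
  proof -
    have "bilin (\<lambda>w r. M (w \<cdot> x) (r \<cdot> y) z)" by (intro l)
    from QR_PR[OF this] show ?thesis by (simp add: QR_def K'_def)
  qed
  have k3: "D Y (\<lambda>u v. K' a (u \<cdot> b) (v \<cdot> c) d x) = eps Y * K' a b c d x" for Y a b c d x
  proof -
    have "lin (\<lambda>w. D a (\<lambda>s t. PR (\<lambda>p1 p2. M (s \<cdot> (p1 \<cdot> x)) (t \<cdot> (p2 \<cdot> (S b \<cdot> (w \<cdot> c)))) d)))" by (intro l)
    from antipode_al[OF this] show ?thesis by (simp add: K'_def)
  qed
  have k4: "Phi (\<lambda>X Y Z. eps Y * K' (X \<cdot> a) b c (Z \<cdot> d) x) = K' a b c d x" for a b c d x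
  proof -
    have "bilin (\<lambda>X Z. K' (X \<cdot> a) b c (Z \<cdot> d) x)" unfolding K'_def by (intro l)
    from counit_phi[OF this] show ?thesis by simp
  qed
  have "mul_1_111 psi_coeff (mul_11D phi_coeff K) one one one one =
    Psi (\<lambda>x y z. Phi (\<lambda>X Y Z. Phi (\<lambda>X' Y' Z'. D Y (\<lambda>u v. D x (\<lambda>s t. K (X \<cdot> (X' \<cdot> s)) (u \<cdot> (Y' \<cdot> t)) (v \<cdot> (Z' \<cdot> y)) (Z \<cdot> z))))))"
    by (simp add: pentagon1[OF K]) (simp add: mul4_defs order)
  also have "\<dots> = Psi (\<lambda>x y z. Phi (\<lambda>X Y Z. Phi (\<lambda>X' Y' Z'. eps Y * K' (X \<cdot> X') Y' (Z' \<cdot> y) (Z \<cdot> z) x)))"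
    using k1[of _ "_ \<cdot> _" "_ \<cdot> _"] by (simp add: k3)
  also have "\<dots> = Psi (\<lambda>x y z. Phi (\<lambda>X' Y' Z'. K' X' Y' (Z' \<cdot> y) z x))"
    unfolding sum3_sum3[of B phi_coeff phi_coeff] k4 ..
  finally show ?thesis by (simp add: k2)
qed

text \<open>Unfolding U and absorbing Z into it produces T \<otimes> U \<otimes> V \<otimes> W, so
  \<open>PR_contraction\<close> applies to the map \<open>M\<close>, that is \<open>m \<otimes> n
  \<otimes> d \<mapsto> m \<otimes> \<Delta>(n) p\<^sub>R (1 \<otimes> S(d))\<close>.\<close>

lemma UR_PR:
  assumes F: "trilin F"
  shows "Phi (\<lambda>X Y Z. D X (\<lambda>s t. PR (\<lambda>p1 p2. D (t \<cdot> (p2 \<cdot> S Y)) (\<lambda>e f. UR (\<lambda>u v. F (s \<cdot> p1) (e \<cdot> (u \<cdot> Z)) (f \<cdot> v)))))) =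
    Phi (\<lambda>A B C. PR (\<lambda>p1 p2. D p1 (\<lambda>u v. F (A \<cdot> u) (B \<cdot> v) (C \<cdot> p2))))"
proof -
  note l = mlin trilin_comp[OF F] lin_PR
  define M where "M m n d = D n (\<lambda>u v. PR (\<lambda>p1 p2. F m (u \<cdot> p1) (v \<cdot> (p2 \<cdot> S d))))" for m n d
  have M: "trilin M" unfolding M_def by (intro l)
  define K where "K a b c d = D a (\<lambda>s t. PR (\<lambda>p1 p2. M (s \<cdot> p1) (t \<cdot> (p2 \<cdot> (S b \<cdot> (al \<cdot> c)))) d))" for a b c d
  have "bilin (F a)" for a by (intro l)
  note k2 = PR_absorb[OF this]
  have "Phi (\<lambda>X Y Z. D X (\<lambda>s t. PR (\<lambda>p1 p2. D (t \<cdot> (p2 \<cdot> S Y)) (\<lambda>e f. UR (\<lambda>u v. F (s \<cdot> p1) (e \<cdot> (u \<cdot> Z)) (f \<cdot> v)))))) =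
    mul_1_111 psi_coeff (mul_11D phi_coeff K) one one one one"
  proof -
    have "D X (\<lambda>s t. PR (\<lambda>p1 p2. D (t \<cdot> (p2 \<cdot> S Y)) (\<lambda>e f. UR (\<lambda>u v. F (s \<cdot> p1) (e \<cdot> (u \<cdot> Z)) (f \<cdot> v))))) =
      Psi (\<lambda>x y z. D Z (\<lambda>d1 d2. K X (x \<cdot> Y) (y \<cdot> d1) (z \<cdot> d2)))" for X Y Z
      by (simp add: UR_def K_def M_def order k2 PR_sums sum2_sum2[of B "comul_coeff X" "comul_coeff Z"])
    then show ?thesis by (simp add: mul4_defs order)
  qed
  also have "\<dots> = Psi (\<lambda>x y z. D y (\<lambda>u v. PR (\<lambda>p1 p2. F x (u \<cdot> p1) (v \<cdot> (p2 \<cdot> S z)))))"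
    using PR_contraction[OF M K_def] by (simp add: M_def[abs_def])
  finally show ?thesis
    using UR_PR_step[OF F] by simp
qed

text \<open>The twisting law (id \<otimes> \<Delta>)(U) (1 \<otimes> U) = \<phi> (\<Delta> \<otimes>
  id)(\<Delta>(S(X)) U) (Y \<otimes> Z \<otimes> 1). It is \<open>pentagon3\<close> for
  \<open>K\<close>: the two coproducts on the left are absorbed by \<open>PR_cov\<close> and
  \<open>UR_cov\<close>, the one on the right by \<alpha>.\<close>

lemma UR_UR:
  assumes F: "trilin F"
  shows "UR (\<lambda>x y. D y (\<lambda>e f. UR (\<lambda>u v. F x (e \<cdot> u) (f \<cdot> v)))) =
    Phi (\<lambda>A B C. Phi (\<lambda>X Y Z. D (S X) (\<lambda>s t. UR (\<lambda>x y. D (s \<cdot> x) (\<lambda>e f. F (A \<cdot> (e \<cdot> Y)) (B \<cdot> (f \<cdot> Z)) (C \<cdot> (t \<cdot> y)))))))"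
proof -
  note l = mlin trilin_comp[OF F] lin_PR lin_UR
  define K where "K a b c d = D (S a \<cdot> (al \<cdot> b)) (\<lambda>s t. PR (\<lambda>p1 p2. D (t \<cdot> (p2 \<cdot> S c))
    (\<lambda>e f. UR (\<lambda>u v. F (s \<cdot> p1) (e \<cdot> (u \<cdot> d)) (f \<cdot> v)))))" for a b c d
  define N where "N s t c d Y = PR (\<lambda>p1 p2. D (t \<cdot> (p2 \<cdot> S c))
    (\<lambda>e f. UR (\<lambda>u v. F (s \<cdot> (p1 \<cdot> Y)) (e \<cdot> (u \<cdot> d)) (f \<cdot> v))))" for s t c d Y
  define N2 where "N2 s t c d Y z = PR (\<lambda>p1 p2. D (t \<cdot> (p2 \<cdot> S c))
    (\<lambda>e f. UR (\<lambda>u v. F (s \<cdot> (p1 \<cdot> Y)) (e \<cdot> (u \<cdot> d)) (f \<cdot> (v \<cdot> S z)))))" for s t c d Y z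
  have K: "quadlin K" unfolding K_def by (intro l)
  have s1: "D Y (\<lambda>y1 y2. K a (b \<cdot> (b' \<cdot> y1)) (c \<cdot> (c' \<cdot> y2)) d) = D (S a \<cdot> (al \<cdot> (b \<cdot> b'))) (\<lambda>s t. N s t (c \<cdot> c') d Y)" for Y a b c d b' c'
  proof -
    have b1: "bilin (\<lambda>s t. PR (\<lambda>p1 p2. D (t \<cdot> (p2 \<cdot> (S y2 \<cdot> (S c' \<cdot> S c))))
       (\<lambda>e f. UR (\<lambda>u v. F (s \<cdot> p1) (e \<cdot> (u \<cdot> d)) (f \<cdot> v)))))" for y2 by (intro l)
    have b2: "bilin (\<lambda>m n. D (t \<cdot> (n \<cdot> (S c' \<cdot> S c))) (\<lambda>e f. UR (\<lambda>u v. F (s \<cdot> m) (e \<cdot> (u \<cdot> d)) (f \<cdot> v))))" for s t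
      by (intro l)
    have b3: "bilin (\<lambda>s t. D y1 (\<lambda>g h. PR (\<lambda>p1 p2. D (t \<cdot> (h \<cdot> (p2 \<cdot> (S y2 \<cdot> (S c' \<cdot> S c)))))
       (\<lambda>e f. UR (\<lambda>u v. F (s \<cdot> (g \<cdot> p1)) (e \<cdot> (u \<cdot> d)) (f \<cdot> v))))))" for y1 y2 by (intro l)
    have "D Y (\<lambda>y1 y2. K a (b \<cdot> (b' \<cdot> y1)) (c \<cdot> (c' \<cdot> y2)) d) =
       D (S a \<cdot> (al \<cdot> (b \<cdot> b'))) (\<lambda>s t. D Y (\<lambda>y1 y2. D y1 (\<lambda>g h. PR (\<lambda>p1 p2. D (t \<cdot> (h \<cdot> (p2 \<cdot> (S y2 \<cdot> (S c' \<cdot> S c)))))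
       (\<lambda>e f. UR (\<lambda>u v. F (s \<cdot> (g \<cdot> p1)) (e \<cdot> (u \<cdot> d)) (f \<cdot> v)))))))"
      using comul_mul[OF b1, of "S a \<cdot> (al \<cdot> (b \<cdot> b'))"]
      by (simp add: K_def sum2_sum2[of B "comul_coeff (S a \<cdot> (al \<cdot> (b \<cdot> b')))" "comul_coeff Y"])
    then show ?thesis
      using PR_cov[OF b2, where c = Y] by (simp add: N_def)
  qed
  have s2: "D z (\<lambda>z1 z2. N s t (z1 \<cdot> c) (z2 \<cdot> d) Y) = N2 s t c d Y z" for s t c d Y z
  proof -
    have b1: "bilin (\<lambda>e f. UR (\<lambda>u v. F a (e \<cdot> (u \<cdot> (z2 \<cdot> d))) (f \<cdot> v)))" for a z2 by (intro l)
    have b2: "bilin (\<lambda>m n. F a (e \<cdot> (m \<cdot> d)) (f \<cdot> n))" for a e f by (intro l)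
    have "N s t (z1 \<cdot> c) (z2 \<cdot> d) Y =
      PR (\<lambda>p1 p2. D (t \<cdot> (p2 \<cdot> S c)) (\<lambda>e f. D (S z1) (\<lambda>g h. UR (\<lambda>u v. F (s \<cdot> (p1 \<cdot> Y)) (e \<cdot> (g \<cdot> (u \<cdot> (z2 \<cdot> d)))) (f \<cdot> (h \<cdot> v))))))" for z1 z2
      using comul_mul[OF b1, of "t \<cdot> (_ \<cdot> S c)" "S z1"] by (simp add: N_def)
    then have "D z (\<lambda>z1 z2. N s t (z1 \<cdot> c) (z2 \<cdot> d) Y) =
      PR (\<lambda>p1 p2. D (t \<cdot> (p2 \<cdot> S c)) (\<lambda>e f. D z (\<lambda>z1 z2. D (S z1) (\<lambda>g h. UR (\<lambda>u v. F (s \<cdot> (p1 \<cdot> Y)) (e \<cdot> (g \<cdot> (u \<cdot> (z2 \<cdot> d)))) (f \<cdot> (h \<cdot> v)))))))"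
      by (simp add: PR_sums(1)[where k = "comul_coeff z", symmetric] sum2_sum2[of B "comul_coeff z"])
    then show ?thesis using UR_cov[OF b2, where c = z] by (simp add: N2_def)
  qed
  have s3: "D (w \<cdot> X') (\<lambda>s t. N2 s t c d Y z) = D w (\<lambda>s t. D t (\<lambda>g h. D X' (\<lambda>s' t'. PR (\<lambda>p1 p2. D (t' \<cdot> (p2 \<cdot> S c))
    (\<lambda>e f. UR (\<lambda>u v. F (s \<cdot> (s' \<cdot> (p1 \<cdot> Y))) (g \<cdot> (e \<cdot> (u \<cdot> d))) (h \<cdot> (f \<cdot> (v \<cdot> S z)))))))))" for w X' c d Y z
  proof -
    have b1: "bilin (\<lambda>s t. N2 s t c d Y z)" unfolding N2_def by (intro l)
    have b2: "bilin (\<lambda>e f. UR (\<lambda>u v. F a (e \<cdot> (u \<cdot> d)) (f \<cdot> (v \<cdot> S z))))" for a by (intro l)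
    have "N2 (s \<cdot> s') (t \<cdot> t') c d Y z = D t (\<lambda>g h. PR (\<lambda>p1 p2. D (t' \<cdot> (p2 \<cdot> S c))
    (\<lambda>e f. UR (\<lambda>u v. F (s \<cdot> (s' \<cdot> (p1 \<cdot> Y))) (g \<cdot> (e \<cdot> (u \<cdot> d))) (h \<cdot> (f \<cdot> (v \<cdot> S z)))))))" for s t s' t'
      using comul_mul[OF b2, of t "t' \<cdot> (_ \<cdot> S c)"] by (simp add: N2_def PR_sums(1))
    then show ?thesis
      by (simp add: comul_mul[OF b1]) (simp add: sum2_sum2[of B "comul_coeff X'"])
  qed
  have s4: "Phi (\<lambda>A B C. PR (\<lambda>p1 p2. D p1 (\<lambda>e f. F (s \<cdot> (A \<cdot> (e \<cdot> Y))) (g \<cdot> (B \<cdot> (f \<cdot> Z))) (h \<cdot> (C \<cdot> (p2 \<cdot> S z)))))) =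
     Phi (\<lambda>X' Y' Z'. D X' (\<lambda>s' t'. PR (\<lambda>p1 p2. D (t' \<cdot> (p2 \<cdot> S Y'))
    (\<lambda>e f. UR (\<lambda>u v. F (s \<cdot> (s' \<cdot> (p1 \<cdot> Y))) (g \<cdot> (e \<cdot> (u \<cdot> (Z' \<cdot> Z)))) (h \<cdot> (f \<cdot> (v \<cdot> S z))))))))" for s Y g Z h z
  proof -
    have "trilin (\<lambda>a b c. F (s \<cdot> (a \<cdot> Y)) (g \<cdot> (b \<cdot> Z)) (h \<cdot> (c \<cdot> S z)))" by (intro l)
    from UR_PR[OF this] show ?thesis by simp
  qed
  \<comment> \<open>Quasi-coassociativity carries the leading \<phi> past the coproducts of w, where
    \<open>UR_PR\<close> can act on it.\<close>
  have s5: "Phi (\<lambda>A B C. D w (\<lambda>s t. PR (\<lambda>p1 p2. D (s \<cdot> p1) (\<lambda>e f. F (A \<cdot> (e \<cdot> Y)) (B \<cdot> (f \<cdot> Z)) (C \<cdot> (t \<cdot> (p2 \<cdot> S z))))))) =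
     D w (\<lambda>s t. D t (\<lambda>g h. Phi (\<lambda>A B C. PR (\<lambda>p1 p2. D p1 (\<lambda>e f. F (s \<cdot> (A \<cdot> (e \<cdot> Y))) (g \<cdot> (B \<cdot> (f \<cdot> Z))) (h \<cdot> (C \<cdot> (p2 \<cdot> S z))))))))"
    for w Y Z z
  proof -
    have t: "trilin (\<lambda>a b c. PR (\<lambda>p1 p2. D p1 (\<lambda>e f. F (a \<cdot> (e \<cdot> Y)) (b \<cdot> (f \<cdot> Z)) (c \<cdot> (p2 \<cdot> S z)))))" by (intro l)
    have b: "bilin (\<lambda>e f. F (A \<cdot> (e \<cdot> Y)) (B' \<cdot> (f \<cdot> Z)) c)" for A B' c by (intro l)
    show ?thesis
      using quasi_coassoc[OF t, of w] by (simp add: order comul_mul[OF b] PR_sums)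
  qed
  have s345: "Phi (\<lambda>A B C. D w (\<lambda>s t. PR (\<lambda>p1 p2. D (s \<cdot> p1) (\<lambda>e f. F (A \<cdot> (e \<cdot> Y)) (B \<cdot> (f \<cdot> Z)) (C \<cdot> (t \<cdot> (p2 \<cdot> S z))))))) =
     Phi (\<lambda>X' Y' Z'. D (w \<cdot> X') (\<lambda>s t. N2 s t Y' (Z' \<cdot> Z) Y z))" for w Y Z z
    unfolding s5 s4 s3 by (simp only: order)
  have r1: "D (S X) (\<lambda>s t. UR (\<lambda>x y. D (s \<cdot> x) (\<lambda>e f. F (A \<cdot> (e \<cdot> Y)) (B' \<cdot> (f \<cdot> Z)) (C \<cdot> (t \<cdot> y))))) =
    Psi (\<lambda>x y z. D (S X \<cdot> (S x \<cdot> (al \<cdot> y))) (\<lambda>s t. PR (\<lambda>p1 p2. D (s \<cdot> p1) (\<lambda>e f. F (A \<cdot> (e \<cdot> Y)) (B' \<cdot> (f \<cdot> Z)) (C \<cdot> (t \<cdot> (p2 \<cdot> S z)))))))"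
    for X A Y B' Z C
  proof -
    have b: "bilin (\<lambda>s t. PR (\<lambda>p1 p2. D (s \<cdot> p1) (\<lambda>e f. F (A \<cdot> (e \<cdot> Y)) (B' \<cdot> (f \<cdot> Z)) (C \<cdot> (t \<cdot> (p2 \<cdot> S z))))))" for z by (intro l)
    show ?thesis by (simp add: UR_def order comul_mul[OF b])
  qed
  have "Phi (\<lambda>A B C. Phi (\<lambda>X Y Z. D (S X) (\<lambda>s t. UR (\<lambda>x y. D (s \<cdot> x) (\<lambda>e f. F (A \<cdot> (e \<cdot> Y)) (B \<cdot> (f \<cdot> Z)) (C \<cdot> (t \<cdot> y))))))) =
    Phi (\<lambda>X Y Z. Phi (\<lambda>A B C. D (S X) (\<lambda>s t. UR (\<lambda>x y. D (s \<cdot> x) (\<lambda>e f. F (A \<cdot> (e \<cdot> Y)) (B \<cdot> (f \<cdot> Z)) (C \<cdot> (t \<cdot> y)))))))"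
    by (rule sum3_sum3)
  also have "\<dots> = Phi (\<lambda>X Y Z. Psi (\<lambda>x y z. Phi (\<lambda>X' Y' Z'. D (S X \<cdot> (S x \<cdot> (al \<cdot> (y \<cdot> X')))) (\<lambda>s t. N2 s t Y' (Z' \<cdot> Z) Y z))))"
    using s345[of "S _ \<cdot> (S _ \<cdot> (al \<cdot> _))"] by (simp add: r1 Phi_Psi)
  also have "\<dots> = mul_11D psi_coeff (mul_1_111 phi_coeff (mul_1D1 phi_coeff K)) one one one one"
  proof -
    have s12: "D z (\<lambda>z1 z2. D Y (\<lambda>y1 y2. K (x \<cdot> X) (y \<cdot> (X' \<cdot> y1)) (z1 \<cdot> (Y' \<cdot> y2)) (z2 \<cdot> d))) =
      D (S X \<cdot> (S x \<cdot> (al \<cdot> (y \<cdot> X')))) (\<lambda>s t. N2 s t Y' d Y z)" for x y z X Y X' Y' d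
      by (simp add: s1 sum2_sum2[of B "comul_coeff z"] s2)
    show ?thesis
      by (simp add: mul4_defs order s12) (intro arg_cong[where f=Psi] ext, rule sum3_sum3)
  qed
  also have "\<dots> = Phi (\<lambda>X Y Z. D X (\<lambda>u v. Psi (\<lambda>x y z. K (u \<cdot> x) (v \<cdot> y) (Y \<cdot> z) Z)))"
    by (simp add: pentagon3[OF K]) (simp add: mul4_defs)
  also have "\<dots> = Psi (\<lambda>x y z. Phi (\<lambda>X Y Z. eps X * K x y (Y \<cdot> z) Z))"
  proof -
    have "D X (\<lambda>u v. K (u \<cdot> x) (v \<cdot> y) c d) = eps X * K x y c d" for X x y c d
    proof -
      have "lin (\<lambda>w. D (S x \<cdot> (w \<cdot> y)) (\<lambda>s t. PR (\<lambda>p1 p2. D (t \<cdot> (p2 \<cdot> S c))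
         (\<lambda>e f. UR (\<lambda>u v. F (s \<cdot> p1) (e \<cdot> (u \<cdot> d)) (f \<cdot> v))))))" by (intro l)
      from antipode_al[OF this] show ?thesis by (simp add: K_def)
    qed
    then show ?thesis by (simp add: order)
  qed
  also have "\<dots> = Psi (\<lambda>x y z. K x y z one)"
    using counit_phi_left[of "\<lambda>Y Z. K _ _ (Y \<cdot> _) Z"] by (simp add: mlin quadlin_comp[OF K])
  also have "\<dots> = UR (\<lambda>x y. D y (\<lambda>e f. UR (\<lambda>u v. F x (e \<cdot> u) (f \<cdot> v))))"
    by (subst UR_def) (simp add: K_def)
  finally show ?thesis ..
qed

lemma UR_sums:
  "UR (\<lambda>x y. sum2 B k (\<lambda>u v. F x y u v)) = sum2 B k (\<lambda>u v. UR (\<lambda>x y. F x y u v))"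
  "UR (\<lambda>x y. sum3 B l (\<lambda>u v w. G x y u v w)) = sum3 B l (\<lambda>u v w. UR (\<lambda>x y. G x y u v w))"
proof -
  have "UR (\<lambda>x y. sum2 B k (\<lambda>u v. F x y u v)) =
    Psi (\<lambda>x y z. sum2 B k (\<lambda>s t. D (S x \<cdot> (al \<cdot> y)) (\<lambda>u v. PR (\<lambda>p1 p2. F (u \<cdot> p1) (v \<cdot> (p2 \<cdot> S z)) s t))))"
    by (simp add: UR_def PR_sums QR_sums sum2_sum2[of B _ k])
  also have "\<dots> = sum2 B k (\<lambda>u v. UR (\<lambda>x y. F x y u v))"
    unfolding UR_def by (rule sum2_sum3[symmetric])
  finally show "UR (\<lambda>x y. sum2 B k (\<lambda>u v. F x y u v)) = sum2 B k (\<lambda>u v. UR (\<lambda>x y. F x y u v))" .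
  have "UR (\<lambda>x y. sum3 B l (\<lambda>u v w. G x y u v w)) =
    Psi (\<lambda>x y z. sum3 B l (\<lambda>s t w. D (S x \<cdot> (al \<cdot> y)) (\<lambda>u v. PR (\<lambda>p1 p2. G (u \<cdot> p1) (v \<cdot> (p2 \<cdot> S z)) s t w))))"
    by (simp add: UR_def PR_sums QR_sums sum2_sum3[of B _ l])
  also have "\<dots> = sum3 B l (\<lambda>u v w. UR (\<lambda>x y. G x y u v w))"
    unfolding UR_def by (rule sum3_sum3)
  finally show "UR (\<lambda>x y. sum3 B l (\<lambda>u v w. G x y u v w)) = sum3 B l (\<lambda>u v w. UR (\<lambda>x y. G x y u v w))" .
qed

text \<open>Under \<epsilon> in the first leg, \<open>p\<^sub>R\<close> and the outer \<Delta> drop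
  out, and S(x) \<alpha> y \<beta> S(z) = 1 remains.\<close>

lemma UR_eps:
  assumes f: "lin f"
  shows "UR (\<lambda>x y. eps x * f y) = f one"
proof -
  note l = mlin lin_comp[OF f]
  have 1: "Psi (\<lambda>x' y' z'. eps u * (eps x' * f (v \<cdot> (y' \<cdot> (be \<cdot> (S z' \<cdot> S z)))))) = eps u * f (v \<cdot> (be \<cdot> S z))" for u v z
    using counit_psi_left[of "\<lambda>y' z'. f (v \<cdot> (y' \<cdot> (be \<cdot> (S z' \<cdot> S z))))"] by (simp add: l sum23_scalar)
  have 2: "D (S x \<cdot> (al \<cdot> y)) (\<lambda>u v. eps u * f (v \<cdot> (be \<cdot> S z))) = f (S x \<cdot> (al \<cdot> (y \<cdot> (be \<cdot> S z))))" for x y z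
    using counit_l[of "\<lambda>v. f (v \<cdot> (be \<cdot> S z))"] by (simp add: l)
  show ?thesis
    unfolding UR_def PR_def using antipode_psi[OF f] by (simp add: mult.assoc 1 2)
qed

subsection \<open>The twisted comultiplication\<close>

text \<open>This is \<open>UR\<close> of the opposite algebra, the element \<open>(1 \<otimes>
  S\<inverse>(Z)) q\<^sub>R \<Delta>(Y S\<inverse>(X \<beta>))\<close>. Its agreement with the V
  defined through h rests on \<open>FR_PR\<close>.\<close>

definition VR where
  "VR F = Phi (\<lambda>X Y Z. D (Y \<cdot> T (X \<cdot> be)) (\<lambda>u v. QR (\<lambda>q1 q2. F (q1 \<cdot> u) (T Z \<cdot> (q2 \<cdot> v)))))"

lemma VR_opposite: "quasi_hopf_calculus.UR B (\<lambda>x y. y \<cdot> x) comul_coeff phi_coeff T (T be) (T al) = VR"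
  by (intro ext) (simp add: VR_def quasi_hopf_calculus.UR_def[OF opposite] QR_opposite)

lemma lin_VR: "(\<And>u v. lin (\<lambda>x. F x u v)) \<Longrightarrow> lin (\<lambda>x. VR (F x))"
  unfolding VR_def by (intro mlin lin_QR)

lemma VR_cov:
  assumes F: "bilin F"
  shows "D c (\<lambda>c1 c2. D (T c1) (\<lambda>s t. VR (\<lambda>x y. F (c2 \<cdot> (x \<cdot> s)) (y \<cdot> t)))) = VR (\<lambda>x y. F x (T c \<cdot> y))"
  using quasi_hopf_calculus.UR_cov[OF opposite F, of c] by (simp add: VR_opposite)

lemma VR_VR:
  assumes F: "trilin F"
  shows "VR (\<lambda>x y. D y (\<lambda>e f. VR (\<lambda>u v. F x (u \<cdot> e) (v \<cdot> f)))) =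
    Psi (\<lambda>A B C. Psi (\<lambda>X Y Z. D (T X) (\<lambda>s t. VR (\<lambda>x y. D (x \<cdot> s) (\<lambda>e f. F (Y \<cdot> (e \<cdot> A)) (Z \<cdot> (f \<cdot> B)) (y \<cdot> (t \<cdot> C)))))))"
  using quasi_hopf_calculus.UR_UR[OF opposite F] by (simp add: VR_opposite)

lemma VR_eps: "lin f \<Longrightarrow> VR (\<lambda>x y. eps x * f y) = f one"
  using quasi_hopf_calculus.UR_eps[OF opposite] by (simp add: VR_opposite)

lemma VR_sums:
  "VR (\<lambda>x y. sum2 B k (\<lambda>u v. F x y u v)) = sum2 B k (\<lambda>u v. VR (\<lambda>x y. F x y u v))"
  "VR (\<lambda>x y. sum3 B l (\<lambda>u v w. G x y u v w)) = sum3 B l (\<lambda>u v w. VR (\<lambda>x y. G x y u v w))"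
  using quasi_hopf_calculus.UR_sums[OF opposite] by (simp_all add: VR_opposite)

lemma UR_QR_commute: "UR (\<lambda>x y. QR (\<lambda>u v. F x y u v)) = QR (\<lambda>u v. UR (\<lambda>x y. F x y u v))"
  unfolding QR_def UR_sums ..

lemma UR_VR_commute: "UR (\<lambda>x y. VR (\<lambda>u v. F x y u v)) = VR (\<lambda>u v. UR (\<lambda>x y. F x y u v))"
  unfolding VR_def UR_sums UR_QR_commute ..

definition Db where
  "Db y F = VR (\<lambda>v1 v2. D y (\<lambda>y1 y2. UR (\<lambda>u1 u2. F (v1 \<cdot> (y1 \<cdot> u1)) (v2 \<cdot> (y2 \<cdot> u2)))))"

lemma lin_Db: "(\<And>u v. lin (\<lambda>x. F x u v)) \<Longrightarrow> lin (\<lambda>x. Db y (F x))"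
  unfolding Db_def by (intro mlin lin_UR lin_VR)

lemma lin_Db_arg: "endo g \<Longrightarrow> lin (\<lambda>x. Db (g x) F)"
  unfolding Db_def by (intro mlin lin_UR lin_VR)

text \<open>Only U is involved: \<open>UR_cov\<close> exchanges S(c) in the second leg for c2 in the
  first leg and a \<Delta>(S(c1)) that joins \<Delta>(y).\<close>

lemma Db_right:
  assumes F: "bilin F"
  shows "Db y (\<lambda>x z. F x (z \<cdot> S c)) = D c (\<lambda>c1 c2. Db (y \<cdot> S c1) (\<lambda>x z. F (x \<cdot> c2) z))"
proof -
  note l = mlin bilin_comp[OF F] lin_UR lin_VR
  have b1: "bilin (\<lambda>y1 y2. UR (\<lambda>u1 u2. F (v1 \<cdot> (y1 \<cdot> (u1 \<cdot> c2))) (v2 \<cdot> (y2 \<cdot> u2))))" for v1 v2 c2 by (intro l)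
  have b2: "bilin (\<lambda>a b. F (v1 \<cdot> (y1 \<cdot> a)) (v2 \<cdot> (y2 \<cdot> b)))" for v1 y1 v2 y2 by (intro l)
  show ?thesis
    using UR_cov[OF b2, of c, symmetric]
    by (simp add: Db_def comul_mul[OF b1] VR_sums(1)[symmetric] sum2_sum2[of B "comul_coeff c" "comul_coeff y"])
qed

lemma Db_left:
  assumes F: "bilin F"
  shows "Db y (\<lambda>x z. F x (T c \<cdot> z)) = D c (\<lambda>c1 c2. Db (T c1 \<cdot> y) (\<lambda>x z. F (c2 \<cdot> x) z))"
proof -
  note l = mlin bilin_comp[OF F] lin_UR lin_VR
  have b1: "bilin (\<lambda>y1 y2. UR (\<lambda>u1 u2. F (c2 \<cdot> (v1 \<cdot> (y1 \<cdot> u1))) (v2 \<cdot> (y2 \<cdot> u2))))" for v1 v2 c2 by (intro l)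
  have b2: "bilin (\<lambda>a b. D y (\<lambda>y1 y2. UR (\<lambda>u1 u2. F (a \<cdot> (y1 \<cdot> u1)) (b \<cdot> (y2 \<cdot> u2)))))" by (intro l)
  have "D c (\<lambda>c1 c2. Db (T c1 \<cdot> y) (\<lambda>x z. F (c2 \<cdot> x) z)) =
    D c (\<lambda>c1 c2. D (T c1) (\<lambda>s t. VR (\<lambda>v1 v2. D y (\<lambda>y1 y2. UR (\<lambda>u1 u2. F (c2 \<cdot> (v1 \<cdot> (s \<cdot> (y1 \<cdot> u1)))) (v2 \<cdot> (t \<cdot> (y2 \<cdot> u2))))))))"
    by (simp add: Db_def comul_mul[OF b1] VR_sums)
  also have "\<dots> = Db y (\<lambda>x z. F x (T c \<cdot> z))"
    using VR_cov[OF b2, of c] by (simp add: Db_def)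
  finally show ?thesis ..
qed

lemma Db_eps:
  assumes f: "lin f"
  shows "Db y (\<lambda>x z. eps x * f z) = f y"
proof -
  note l = mlin lin_comp[OF f]
  have 1: "UR (\<lambda>u1 u2. eps a * (eps b * (eps u1 * f (c \<cdot> (d \<cdot> u2))))) = eps a * (eps b * f (c \<cdot> d))" for a b c d
    using UR_eps[of "\<lambda>u2. eps a * (eps b * f (c \<cdot> (d \<cdot> u2)))"] by (simp add: l mult.left_commute)
  have 2: "D y (\<lambda>y1 y2. eps a * (eps y1 * f (c \<cdot> y2))) = eps a * f (c \<cdot> y)" for a c
    using counit_l[of "\<lambda>y2. f (c \<cdot> y2)" y] by (simp add: l sum23_scalar)
  show ?thesis
    using VR_eps[of "\<lambda>v. f (v \<cdot> y)"] by (simp add: Db_def mult.assoc 1 2 l)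
qed

lemma coassoc_conjugate:
  assumes F: "trilin F"
  shows "Psi (\<lambda>A B C. D y (\<lambda>u v. D v (\<lambda>g h. Phi (\<lambda>X Y Z. F (A \<cdot> (u \<cdot> X)) (B \<cdot> (g \<cdot> Y)) (C \<cdot> (h \<cdot> Z)))))) =
    D y (\<lambda>u v. D u (\<lambda>g h. F g h v))"
proof -
  note l = mlin trilin_comp[OF F]
  have t1: "trilin (\<lambda>a b c. F (A \<cdot> a) (B' \<cdot> b) (C \<cdot> c))" for A B' C by (intro l)
  have t2: "trilin (\<lambda>a b c. D y (\<lambda>u v. D u (\<lambda>g h. F (a \<cdot> g) (b \<cdot> h) (c \<cdot> v))))" by (intro l)
  show ?thesis
    using quasi_coassoc[OF t1, of y] psi_phi[OF t2] by (simp add: order)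
qed

text \<open>\<open>VR_VR\<close> supplies two factors \<phi>\<inverse> and \<open>UR_UR\<close> two
  factors \<phi>. One of each conjugates (id \<otimes> \<Delta>)(\<Delta>(y)) into (\<Delta>
  \<otimes> id)(\<Delta>(y)); the other two stay visible in the result.\<close>

lemma Db_Db:
  assumes F: "trilin F"
  shows "Db y (\<lambda>x z. Db z (\<lambda>u v. F x u v)) =
    Psi (\<lambda>x y' z. Phi (\<lambda>X Y Z. Db (T x \<cdot> (y \<cdot> S X)) (\<lambda>s t. D s (\<lambda>e f. F (y' \<cdot> (e \<cdot> Y)) (z \<cdot> (f \<cdot> Z)) t))))"
proof -
  note l = mlin trilin_comp[OF F] lin_UR lin_VR
  note VR_out = VR_sums[symmetric] UR_VR_commute
  have b1: "bilin (\<lambda>a b. UR (\<lambda>u1 u2. F c (w1 \<cdot> (a \<cdot> u1)) (w2 \<cdot> (b \<cdot> u2))))" for c w1 w2 by (intro l)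
  have reorder: "D y (\<lambda>y1 y2. UR (\<lambda>u1 u2. VR (\<lambda>w1 w2. D v2 (\<lambda>e f. D y2 (\<lambda>g h. D u2 (\<lambda>i j. UR (\<lambda>k1 k2.
       F (v1 \<cdot> (y1 \<cdot> u1)) (w1 \<cdot> (e \<cdot> (g \<cdot> (i \<cdot> k1)))) (w2 \<cdot> (f \<cdot> (h \<cdot> (j \<cdot> k2))))))))))) =
      D v2 (\<lambda>e f. VR (\<lambda>w1 w2. D y (\<lambda>y1 y2. D y2 (\<lambda>g h. UR (\<lambda>u1 u2. D u2 (\<lambda>i j. UR (\<lambda>k1 k2.
       F (v1 \<cdot> (y1 \<cdot> u1)) (w1 \<cdot> (e \<cdot> (g \<cdot> (i \<cdot> k1)))) (w2 \<cdot> (f \<cdot> (h \<cdot> (j \<cdot> k2)))))))))))" for v1 v2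
    by (simp add: VR_out UR_sums(1) sum2_sum2[of B "comul_coeff y" "comul_coeff v2"])
  define G where "G a b c = UR (\<lambda>u1 u2. D u2 (\<lambda>i j. UR (\<lambda>k1 k2. F (a \<cdot> u1) (b \<cdot> (i \<cdot> k1)) (c \<cdot> (j \<cdot> k2)))))" for a b c
  \<comment> \<open>The right side of \<open>UR_UR\<close> without its leading \<phi>, which is kept
    apart for the conjugation.\<close>
  define N where "N a b c = Phi (\<lambda>X Y Z. D (S X) (\<lambda>s t. UR (\<lambda>x y. D (s \<cdot> x) (\<lambda>e f. F (a \<cdot> (e \<cdot> Y)) (b \<cdot> (f \<cdot> Z)) (c \<cdot> (t \<cdot> y))))))" for a b c
  have G: "trilin G" and N: "trilin N" unfolding G_def N_def by (intro l)+
  have G_N: "G a b c = Phi (\<lambda>X Y Z. N (a \<cdot> X) (b \<cdot> Y) (c \<cdot> Z))" for a b c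
  proof -
    have "trilin (\<lambda>x y z. F (a \<cdot> x) (b \<cdot> y) (c \<cdot> z))" by (intro l)
    from UR_UR[OF this] show ?thesis by (simp add: G_def N_def)
  qed
  have t: "trilin (\<lambda>a b c. D y (\<lambda>y1 y2. D y2 (\<lambda>g h. G (a \<cdot> y1) (b \<cdot> g) (c \<cdot> h))))"
    by (intro mlin trilin_comp[OF G])
  have "Db y (\<lambda>x z. Db z (\<lambda>u v. F x u v)) =
    VR (\<lambda>v1 v2. D v2 (\<lambda>e f. VR (\<lambda>w1 w2. D y (\<lambda>y1 y2. D y2 (\<lambda>g h. G (v1 \<cdot> y1) (w1 \<cdot> (e \<cdot> g)) (w2 \<cdot> (f \<cdot> h)))))))"
    using reorder by (simp add: Db_def comul_mul3[OF b1] G_def)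
  also have "\<dots> = Psi (\<lambda>X Y Z. D (T X) (\<lambda>s t. VR (\<lambda>x w. D (x \<cdot> s) (\<lambda>e f.
      Psi (\<lambda>A B C. D y (\<lambda>y1 y2. D y2 (\<lambda>g h. Phi (\<lambda>X' Y' Z'.
        N (Y \<cdot> (e \<cdot> (A \<cdot> (y1 \<cdot> X')))) (Z \<cdot> (f \<cdot> (B \<cdot> (g \<cdot> Y')))) (w \<cdot> (t \<cdot> (C \<cdot> (h \<cdot> Z'))))))))))))"
    using VR_VR[OF t] by (simp add: G_N D_Psi VR_sums(2)) (rule sum3_sum3)
  also have "\<dots> = Psi (\<lambda>X Y Z. D (T X) (\<lambda>s t. VR (\<lambda>x w. D (x \<cdot> s) (\<lambda>e f. D y (\<lambda>y1 y2. D y1 (\<lambda>g h.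
        N (Y \<cdot> (e \<cdot> g)) (Z \<cdot> (f \<cdot> h)) (w \<cdot> (t \<cdot> y2))))))))"
  proof -
    have "trilin (\<lambda>a b c. N (Y \<cdot> (e \<cdot> a)) (Z \<cdot> (f \<cdot> b)) (w \<cdot> (t \<cdot> c)))" for Y e Z f w t
      by (intro mlin trilin_comp[OF N])
    from coassoc_conjugate[OF this, of y] show ?thesis by simp
  qed
  also have "\<dots> = Psi (\<lambda>x y' z. Phi (\<lambda>X Y Z. Db (T x \<cdot> (y \<cdot> S X)) (\<lambda>s t. D s (\<lambda>e f. F (y' \<cdot> (e \<cdot> Y)) (z \<cdot> (f \<cdot> Z)) t))))"
  proof -
    have b1: "bilin (\<lambda>a b. UR (\<lambda>u1 u2. D (v1 \<cdot> (a \<cdot> u1)) (\<lambda>e f. F (y' \<cdot> (e \<cdot> Y)) (z \<cdot> (f \<cdot> Z)) (v2 \<cdot> (b \<cdot> u2)))))" for v1 y' Y z Z v2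
      by (intro l)
    have b2: "bilin (\<lambda>e f. F (y' \<cdot> (e \<cdot> Y)) (z \<cdot> (f \<cdot> Z)) c)" for y' Y z Z c by (intro l)
    have split: "D (v1 \<cdot> (s \<cdot> (y1 \<cdot> (s' \<cdot> u1)))) (\<lambda>e f. F (y' \<cdot> (e \<cdot> Y)) (z \<cdot> (f \<cdot> Z)) c) =
      D (v1 \<cdot> s) (\<lambda>e f. D y1 (\<lambda>g h. D (s' \<cdot> u1) (\<lambda>i j. F (y' \<cdot> (e \<cdot> (g \<cdot> (i \<cdot> Y)))) (z \<cdot> (f \<cdot> (h \<cdot> (j \<cdot> Z)))) c)))" for v1 s y1 s' u1 y' Y z Z c
      using comul_mul3[OF b2, of "v1 \<cdot> s" y1 "s' \<cdot> u1"] by simp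
    have "Db (T x \<cdot> (y \<cdot> S X)) (\<lambda>s t. D s (\<lambda>e f. F (y' \<cdot> (e \<cdot> Y)) (z \<cdot> (f \<cdot> Z)) t)) =
      D (T x) (\<lambda>s t. VR (\<lambda>v w. D (v \<cdot> s) (\<lambda>e f. D y (\<lambda>y1 y2. D y1 (\<lambda>g h.
        D (S X) (\<lambda>s' t'. UR (\<lambda>u1 u2. D (s' \<cdot> u1) (\<lambda>i j. F (y' \<cdot> (e \<cdot> (g \<cdot> (i \<cdot> Y)))) (z \<cdot> (f \<cdot> (h \<cdot> (j \<cdot> Z)))) (w \<cdot> (t \<cdot> (y2 \<cdot> (t' \<cdot> u2))))))))))))"
      for x X y' Y z Z
    proof -
      have "D y (\<lambda>y1 y2. D (S X) (\<lambda>s' t'. UR (\<lambda>u1 u2. D (v1 \<cdot> s) (\<lambda>e f. D y1 (\<lambda>g h. D (s' \<cdot> u1) (\<lambda>i j.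
          F (y' \<cdot> (e \<cdot> (g \<cdot> (i \<cdot> Y)))) (z \<cdot> (f \<cdot> (h \<cdot> (j \<cdot> Z)))) (v2 \<cdot> (t \<cdot> (y2 \<cdot> (t' \<cdot> u2)))))))))) =
        D (v1 \<cdot> s) (\<lambda>e f. D y (\<lambda>y1 y2. D y1 (\<lambda>g h. D (S X) (\<lambda>s' t'. UR (\<lambda>u1 u2. D (s' \<cdot> u1) (\<lambda>i j.
          F (y' \<cdot> (e \<cdot> (g \<cdot> (i \<cdot> Y)))) (z \<cdot> (f \<cdot> (h \<cdot> (j \<cdot> Z)))) (v2 \<cdot> (t \<cdot> (y2 \<cdot> (t' \<cdot> u2))))))))))" for v1 s t v2
        by (simp add: UR_sums(1) sum2_sum2[of B "comul_coeff y" "comul_coeff (v1 \<cdot> s)"] sum2_sum2[of B "comul_coeff (S X)" "comul_coeff (v1 \<cdot> s)"]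
          sum2_sum2[of B "comul_coeff (S X)" "comul_coeff _"])
      then show ?thesis
        by (simp add: Db_def comul_mul3[OF b1] split VR_sums(1))
    qed
    then show ?thesis by (simp add: N_def order VR_sums)
  qed
  finally show ?thesis .
qed

subsection \<open>Drinfeld's element\<close>

definition GR where
  "GR F = Phi (\<lambda>X Y Z. D Z (\<lambda>u v. Psi (\<lambda>x y z. F (S (x \<cdot> Y) \<cdot> (al \<cdot> (y \<cdot> u))) (S X \<cdot> (al \<cdot> (z \<cdot> v))))))"

definition FR where
  "FR F = Psi (\<lambda>X Y Z. D X (\<lambda>x1 x2. GR (\<lambda>g1 g2. D (Y \<cdot> (be \<cdot> S Z)) (\<lambda>u v. F (S x2 \<cdot> (g1 \<cdot> u)) (S x1 \<cdot> (g2 \<cdot> v))))))"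

lemma lin_GR: "(\<And>u v. lin (\<lambda>x. F x u v)) \<Longrightarrow> lin (\<lambda>x. GR (F x))"
  unfolding GR_def by (intro mlin)

lemma lin_FR: "(\<And>u v. lin (\<lambda>x. F x u v)) \<Longrightarrow> lin (\<lambda>x. FR (F x))"
  unfolding FR_def by (intro mlin lin_GR)

lemma GR_sums:
  "GR (\<lambda>x y. sum2 B k (\<lambda>u v. F x y u v)) = sum2 B k (\<lambda>u v. GR (\<lambda>x y. F x y u v))"
  "GR (\<lambda>x y. sum3 B l (\<lambda>u v w. G x y u v w)) = sum3 B l (\<lambda>u v w. GR (\<lambda>x y. G x y u v w))"
proof -
  have "GR (\<lambda>x y. sum2 B k (\<lambda>u v. F x y u v)) = Phi (\<lambda>X Y Z. sum2 B k (\<lambda>s t. D Z (\<lambda>u v. Psi (\<lambda>x y z.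
     F (S (x \<cdot> Y) \<cdot> (al \<cdot> (y \<cdot> u))) (S X \<cdot> (al \<cdot> (z \<cdot> v))) s t))))"
    by (simp add: GR_def sum2_sum2[of B _ k] sum2_sum3[of B k psi_coeff, symmetric])
  also have "\<dots> = sum2 B k (\<lambda>u v. GR (\<lambda>x y. F x y u v))"
    unfolding GR_def by (rule sum2_sum3[symmetric])
  finally show "GR (\<lambda>x y. sum2 B k (\<lambda>u v. F x y u v)) = sum2 B k (\<lambda>u v. GR (\<lambda>x y. F x y u v))" .
  have "GR (\<lambda>x y. sum3 B l (\<lambda>u v w. G x y u v w)) = Phi (\<lambda>X Y Z. sum3 B l (\<lambda>r s t. D Z (\<lambda>u v. Psi (\<lambda>x y z.
     G (S (x \<cdot> Y) \<cdot> (al \<cdot> (y \<cdot> u))) (S X \<cdot> (al \<cdot> (z \<cdot> v))) r s t))))"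
    by (simp add: GR_def sum3_sum3[of B psi_coeff l] sum2_sum3[of B "comul_coeff _" l])
  also have "\<dots> = sum3 B l (\<lambda>u v w. GR (\<lambda>x y. G x y u v w))"
    unfolding GR_def by (rule sum3_sum3)
  finally show "GR (\<lambda>x y. sum3 B l (\<lambda>u v w. G x y u v w)) = sum3 B l (\<lambda>u v w. GR (\<lambda>x y. G x y u v w))" .
qed

text \<open>The analogue for g of S(a1) \<alpha> a2 = \<epsilon>(a) \<alpha>. Quasi-coassociativity,
  once for \<phi> and once for \<phi>\<inverse>, brings the inner pair of factors of a to the first
  \<alpha>; the outer pair then meets the second \<alpha>.\<close>

lemma GR_cov:
  assumes F: "bilin F"
  shows "D a (\<lambda>a1 a2. D a1 (\<lambda>s t. GR (\<lambda>g1 g2. D a2 (\<lambda>u v. F (S t \<cdot> (g1 \<cdot> u)) (S s \<cdot> (g2 \<cdot> v)))))) = eps a * GR F"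
proof -
  note l = mlin bilin_comp[OF F]
  define K where "K a b c d = F (S b \<cdot> (al \<cdot> c)) (S a \<cdot> (al \<cdot> d))" for a b c d
  have K: "quadlin K" unfolding K_def by (intro l)
  note l = l quadlin_comp[OF K]
  define M where "M t u e = D e (\<lambda>c1 c2. Psi (\<lambda>a b c. K t (a \<cdot> u) (b \<cdot> c1) (c \<cdot> c2)))" for t u e
  have M: "trilin M" unfolding M_def by (intro l)
  have GR_M: "GR F = Phi M" by (simp add: GR_def M_def[abs_def] K_def)
  have k1: "D u (\<lambda>u1 u2. K t (u1 \<cdot> a) (u2 \<cdot> b) d) = eps u * K t a b d" for u t a b d
    using antipode_al[of "\<lambda>w. F (S a \<cdot> (w \<cdot> b)) (S t \<cdot> (al \<cdot> d))" u] by (simp add: l K_def)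
  have k2: "D a (\<lambda>a1 a2. K (a1 \<cdot> t) u c (a2 \<cdot> d)) = eps a * K t u c d" for a t u c d
    using antipode_al[of "\<lambda>w. F (S u \<cdot> (al \<cdot> c)) (S t \<cdot> (w \<cdot> d))" a] by (simp add: l K_def)
  have M_right: "M (A \<cdot> s) (B' \<cdot> t) (C \<cdot> a2) = D C (\<lambda>c1 c2. Psi (\<lambda>x y z. D a2 (\<lambda>u v. F (S t \<cdot> (S B' \<cdot> (S x \<cdot> (al \<cdot> (y \<cdot> (c1 \<cdot> u)))))) (S s \<cdot> (S A \<cdot> (al \<cdot> (z \<cdot> (c2 \<cdot> v))))))))"
    for A s B' t C a2
  proof -
    have b: "bilin (\<lambda>c1 c2. F (S t \<cdot> (S B' \<cdot> (S x \<cdot> (al \<cdot> (y \<cdot> c1))))) (S s \<cdot> (S A \<cdot> (al \<cdot> (z \<cdot> c2)))))" for x y z by (intro l)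
    show ?thesis by (simp add: M_def K_def comul_mul[OF b] order)
  qed
  have M_left: "D a2 (\<lambda>u v. M t (u \<cdot> p) (v \<cdot> r)) = D r (\<lambda>c1 c2. Psi (\<lambda>x y z. K t (x \<cdot> p) (y \<cdot> c1) (a2 \<cdot> (z \<cdot> c2))))" for a2 t p r
  proof -
    have b: "bilin (\<lambda>c1 c2. Psi (\<lambda>x y z. K t (x \<cdot> (u \<cdot> p)) (y \<cdot> c1) (z \<cdot> c2)))" for u by (intro l)
    have t: "trilin (\<lambda>x y z. K t (x \<cdot> p) (y \<cdot> c1) (z \<cdot> c2))" for c1 c2 by (intro l)
    have "D a2 (\<lambda>u v. M t (u \<cdot> p) (v \<cdot> r)) =
      D r (\<lambda>c1 c2. D a2 (\<lambda>u v. D v (\<lambda>v1 v2. Psi (\<lambda>x y z. K t (x \<cdot> (u \<cdot> p)) (y \<cdot> (v1 \<cdot> c1)) (z \<cdot> (v2 \<cdot> c2))))))"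
      by (simp add: M_def comul_mul[OF b] sum2_sum2[of B "comul_coeff _" "comul_coeff r"])
    also have "\<dots> = D r (\<lambda>c1 c2. D a2 (\<lambda>u v. D u (\<lambda>u1 u2. Psi (\<lambda>x y z. K t (u1 \<cdot> (x \<cdot> p)) (u2 \<cdot> (y \<cdot> c1)) (v \<cdot> (z \<cdot> c2))))))"
      using quasi_coassoc_inv[OF t, of a2] by simp
    also have "\<dots> = D r (\<lambda>c1 c2. Psi (\<lambda>x y z. K t (x \<cdot> p) (y \<cdot> c1) (a2 \<cdot> (z \<cdot> c2))))"
    proof -
      have "D a2 (\<lambda>u v. eps u * K t x y (v \<cdot> z)) = K t x y (a2 \<cdot> z)" for x y z
        by (intro counit_l l)
      then show ?thesis by (simp add: order k1)
    qed
    finally show ?thesis .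
  qed
  have "D a (\<lambda>a1 a2. D a1 (\<lambda>s t. GR (\<lambda>g1 g2. D a2 (\<lambda>u v. F (S t \<cdot> (g1 \<cdot> u)) (S s \<cdot> (g2 \<cdot> v)))))) =
    D a (\<lambda>a1 a2. D a1 (\<lambda>s t. Phi (\<lambda>X Y Z. M (X \<cdot> s) (Y \<cdot> t) (Z \<cdot> a2))))"
    by (simp add: GR_def M_right)
  also have "\<dots> = D a (\<lambda>a1 a2. D a2 (\<lambda>u v. Phi (\<lambda>X Y Z. M (a1 \<cdot> X) (u \<cdot> Y) (v \<cdot> Z))))"
    by (rule quasi_coassoc[OF M, symmetric])
  also have "\<dots> = eps a * GR F"
    by (simp add: order M_left sum2_sum2[of B "comul_coeff a"] k2 sum23_scalar GR_M) (simp add: M_def[abs_def] order)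
  finally show ?thesis .
qed

text \<open>f is a contraction \<open>H\<close> of \<phi>\<inverse>, to which
  \<open>quasi_coassoc_inv\<close> applies: on one side the first two legs collapse by
  \<open>GR_cov\<close>, on the other the last two by \<beta>. This is the intertwining of \<Delta>
  with the antipode.\<close>

lemma FR_S:
  assumes F: "bilin F"
  shows "FR (\<lambda>x y. D (S a) (\<lambda>u v. F (x \<cdot> u) (y \<cdot> v))) = D a (\<lambda>a1 a2. FR (\<lambda>x y. F (S a2 \<cdot> x) (S a1 \<cdot> y)))"
proof -
  note l = mlin bilin_comp[OF F] lin_GR
  define H where "H x y z = D x (\<lambda>x1 x2. GR (\<lambda>g1 g2. D (y \<cdot> (be \<cdot> S z)) (\<lambda>u v. F (S x2 \<cdot> (g1 \<cdot> u)) (S x1 \<cdot> (g2 \<cdot> v)))))" for x y z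
  have H: "trilin H" unfolding H_def by (intro l)
  have "FR (\<lambda>x y. D (S a) (\<lambda>u v. F (x \<cdot> u) (y \<cdot> v))) = Psi (\<lambda>X Y Z. H X Y (a \<cdot> Z))"
  proof -
    have b: "bilin (\<lambda>u v. F (S x2 \<cdot> (g1 \<cdot> u)) (S x1 \<cdot> (g2 \<cdot> v)))" for x1 x2 g1 g2 by (intro l)
    show ?thesis
      using comul_mul[OF b, of "_ \<cdot> (be \<cdot> S _)" "S a"] by (simp add: FR_def H_def)
  qed
  also have "\<dots> = D a (\<lambda>a1 a2. D a1 (\<lambda>s t. Psi (\<lambda>X Y Z. H (s \<cdot> X) (t \<cdot> Y) (a2 \<cdot> Z))))"
  proof -
    have b: "bilin (\<lambda>x1 x2. GR (\<lambda>g1 g2. D (y \<cdot> (be \<cdot> S z)) (\<lambda>u v. F (S x2 \<cdot> (g1 \<cdot> u)) (S x1 \<cdot> (g2 \<cdot> v)))))" for y z by (intro l)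
    have "D a (\<lambda>s t. H (s \<cdot> X) (t \<cdot> Y) Z) = eps a * H X Y Z" for a X Y Z
    proof -
      have b1: "bilin (\<lambda>u v. D (Y \<cdot> (be \<cdot> S Z)) (\<lambda>e f. F (S x2 \<cdot> (u \<cdot> e)) (S x1 \<cdot> (v \<cdot> f))))" for x1 x2 by (intro l)
      have b2: "bilin (\<lambda>u v. F (S x2 \<cdot> (S s2 \<cdot> (g1 \<cdot> u))) (S x1 \<cdot> (S s1 \<cdot> (g2 \<cdot> v))))" for x1 x2 s1 s2 g1 g2 by (intro l)
      have b3: "bilin (\<lambda>x1 x2. GR (\<lambda>g1 g2. D t (\<lambda>u v. D (Y \<cdot> (be \<cdot> S Z)) (\<lambda>e f. F (S x2 \<cdot> (g1 \<cdot> (u \<cdot> e))) (S x1 \<cdot> (g2 \<cdot> (v \<cdot> f)))))))" for t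
        by (intro l)
      have b4: "bilin (\<lambda>u v. F (S x2 \<cdot> (g1 \<cdot> u)) (S x1 \<cdot> (g2 \<cdot> v)))" for x1 x2 g1 g2 by (intro l)
      have "D a (\<lambda>s t. H (s \<cdot> X) (t \<cdot> Y) Z) =
        D X (\<lambda>x1 x2. D a (\<lambda>s t. D s (\<lambda>s1 s2. GR (\<lambda>g1 g2. D t (\<lambda>u v. D (Y \<cdot> (be \<cdot> S Z)) (\<lambda>e f.
          F (S x2 \<cdot> (S s2 \<cdot> (g1 \<cdot> (u \<cdot> e)))) (S x1 \<cdot> (S s1 \<cdot> (g2 \<cdot> (v \<cdot> f))))))))))"
        using comul_mul[OF b4, of _ "Y \<cdot> (be \<cdot> S Z)"]
        by (simp add: H_def comul_mul[OF b3] sum2_sum2[of B "comul_coeff _" "comul_coeff X"])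
      then show ?thesis
        using GR_cov[OF b1, of a] by (simp add: sum23_scalar H_def)
    qed
    then show ?thesis
      using counit_l[of "\<lambda>a2. H _ _ (a2 \<cdot> _)" a] by (simp add: order mlin trilin_comp[OF H])
  qed
  also have "\<dots> = D a (\<lambda>a1 a2. D a2 (\<lambda>s t. Psi (\<lambda>X Y Z. H (X \<cdot> a1) (Y \<cdot> s) (Z \<cdot> t))))"
    by (rule quasi_coassoc_inv[OF H])
  also have "\<dots> = Psi (\<lambda>X Y Z. H (X \<cdot> a) Y Z)"
  proof -
    have "D a2 (\<lambda>s t. H x (Y \<cdot> s) (Z \<cdot> t)) = eps a2 * H x Y Z" for a2 x Y Z
    proof -
      have "lin (\<lambda>w. D x (\<lambda>x1 x2. GR (\<lambda>g1 g2. D (Y \<cdot> (w \<cdot> S Z)) (\<lambda>u v. F (S x2 \<cdot> (g1 \<cdot> u)) (S x1 \<cdot> (g2 \<cdot> v))))))" by (intro l)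
      from antipode_be[OF this] show ?thesis by (simp add: H_def)
    qed
    then show ?thesis
      using counit_r[of "\<lambda>a1. H (_ \<cdot> a1) _ _" a] by (simp add: order mlin trilin_comp[OF H])
  qed
  also have "\<dots> = D a (\<lambda>a1 a2. FR (\<lambda>x y. F (S a2 \<cdot> x) (S a1 \<cdot> y)))"
  proof -
    have b: "bilin (\<lambda>x1 x2. GR (\<lambda>g1 g2. D (Y \<cdot> (be \<cdot> S Z)) (\<lambda>u v. F (S x2 \<cdot> (g1 \<cdot> u)) (S x1 \<cdot> (g2 \<cdot> v)))))" for Y Z by (intro l)
    show ?thesis by (simp add: FR_def H_def comul_mul[OF b] order sum2_sum2[of B "comul_coeff a"])
  qed
  finally show ?thesis .
qed

text \<open>Here f \<Delta>(\<alpha>) = g results from \<open>pentagon4\<close> for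
  \<open>K\<close>, in which \<beta>, \<alpha> and \<open>GR_cov\<close> each remove one coproduct;
  the surviving \<phi> closes with X \<beta> S(Y) \<alpha> Z = 1.\<close>

lemma FR_al:
  assumes F: "bilin F"
  shows "FR (\<lambda>x y. D al (\<lambda>u v. F (x \<cdot> u) (y \<cdot> v))) = GR F"
proof -
  note l = mlin bilin_comp[OF F] lin_GR
  define K where "K a b c d = D a (\<lambda>x1 x2. GR (\<lambda>g1 g2. D (b \<cdot> (be \<cdot> (S c \<cdot> (al \<cdot> d)))) (\<lambda>u v. F (S x2 \<cdot> (g1 \<cdot> u)) (S x1 \<cdot> (g2 \<cdot> v)))))" for a b c d
  have K: "quadlin K" unfolding K_def by (intro l)
  have k1: "D y (\<lambda>y1 y2. K a (b \<cdot> y1) (c \<cdot> y2) d) = eps y * K a b c d" for y a b c d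
  proof -
    have "lin (\<lambda>w. D a (\<lambda>x1 x2. GR (\<lambda>g1 g2. D (b \<cdot> (w \<cdot> (S c \<cdot> (al \<cdot> d)))) (\<lambda>u v. F (S x2 \<cdot> (g1 \<cdot> u)) (S x1 \<cdot> (g2 \<cdot> v))))))" by (intro l)
    from antipode_be[OF this] show ?thesis by (simp add: K_def)
  qed
  have k2: "D z (\<lambda>y1 y2. K a b (y1 \<cdot> c) (y2 \<cdot> d)) = eps z * K a b c d" for z a b c d
  proof -
    have "lin (\<lambda>w. D a (\<lambda>x1 x2. GR (\<lambda>g1 g2. D (b \<cdot> (be \<cdot> (S c \<cdot> (w \<cdot> d)))) (\<lambda>u v. F (S x2 \<cdot> (g1 \<cdot> u)) (S x1 \<cdot> (g2 \<cdot> v))))))" by (intro l)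
    from antipode_al[OF this] show ?thesis by (simp add: K_def)
  qed
  have k3: "D X (\<lambda>s t. K (s \<cdot> a) (t \<cdot> b) c d) = eps X * K a b c d" for X a b c d
  proof -
    have b1: "bilin (\<lambda>u v. D (b \<cdot> (be \<cdot> (S c \<cdot> (al \<cdot> d)))) (\<lambda>e f. F (S x2 \<cdot> (u \<cdot> e)) (S x1 \<cdot> (v \<cdot> f))))" for x1 x2 by (intro l)
    have b3: "bilin (\<lambda>x1 x2. GR (\<lambda>g1 g2. D t (\<lambda>u v. D (b \<cdot> (be \<cdot> (S c \<cdot> (al \<cdot> d)))) (\<lambda>e f. F (S x2 \<cdot> (g1 \<cdot> (u \<cdot> e))) (S x1 \<cdot> (g2 \<cdot> (v \<cdot> f)))))))" for t
      by (intro l)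
    have b4: "bilin (\<lambda>u v. F (S x2 \<cdot> (g1 \<cdot> u)) (S x1 \<cdot> (g2 \<cdot> v)))" for x1 x2 g1 g2 by (intro l)
    have "D X (\<lambda>s t. K (s \<cdot> a) (t \<cdot> b) c d) =
        D a (\<lambda>x1 x2. D X (\<lambda>s t. D s (\<lambda>s1 s2. GR (\<lambda>g1 g2. D t (\<lambda>u v. D (b \<cdot> (be \<cdot> (S c \<cdot> (al \<cdot> d)))) (\<lambda>e f.
          F (S x2 \<cdot> (S s2 \<cdot> (g1 \<cdot> (u \<cdot> e)))) (S x1 \<cdot> (S s1 \<cdot> (g2 \<cdot> (v \<cdot> f))))))))))"
      using comul_mul[OF b4, of _ "b \<cdot> (be \<cdot> (S c \<cdot> (al \<cdot> d)))"]
      by (simp add: K_def comul_mul[OF b3] sum2_sum2[of B "comul_coeff _" "comul_coeff a"])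
    then show ?thesis
      using GR_cov[OF b1, of X] by (simp add: sum23_scalar K_def)
  qed
  note lK = mlin quadlin_comp[OF K]
  have "FR (\<lambda>x y. D al (\<lambda>u v. F (x \<cdot> u) (y \<cdot> v))) = Psi (\<lambda>X Y Z. K X Y Z one)"
  proof -
    have b: "bilin (\<lambda>u v. F (S x2 \<cdot> (g1 \<cdot> u)) (S x1 \<cdot> (g2 \<cdot> v)))" for x1 x2 g1 g2 by (intro l)
    show ?thesis
      using comul_mul[OF b, of "_ \<cdot> (be \<cdot> S _)" al] by (simp add: FR_def K_def)
  qed
  also have "\<dots> = mul_111_1 psi_coeff (mul_1D1 psi_coeff K) one one one one"
    using counit_psi[of "\<lambda>x z. K (_ \<cdot> x) _ _ z"] by (simp add: mul4_defs k1 lK)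
  also have "\<dots> = Psi (\<lambda>X Y Z. D X (\<lambda>s t. Psi (\<lambda>x y z. D z (\<lambda>u v. Phi (\<lambda>X' Y' Z'. K (s \<cdot> x) (t \<cdot> (y \<cdot> X')) (Y \<cdot> (u \<cdot> Y')) (Z \<cdot> (v \<cdot> Z')))))))"
    by (simp add: pentagon4[OF K]) (simp add: mul4_defs)
  also have "\<dots> = Psi (\<lambda>x y z. Phi (\<lambda>X' Y' Z'. eps z * K x (y \<cdot> X') Y' Z'))"
  proof -
    have "Psi (\<lambda>X Y Z. eps X * K a b (Y \<cdot> c) (Z \<cdot> d)) = K a b c d" for a b c d
      using counit_psi_left[of "\<lambda>Y Z. K a b (Y \<cdot> c) (Z \<cdot> d)"] by (simp add: lK)
    moreover have "Psi (\<lambda>X Y Z. Psi (\<lambda>x y z. Phi (\<lambda>X' Y' Z'. D z (\<lambda>u v. eps X * K x (y \<cdot> X') (Y \<cdot> (u \<cdot> Y')) (Z \<cdot> (v \<cdot> Z')))))) =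
      Psi (\<lambda>x y z. Phi (\<lambda>X' Y' Z'. D z (\<lambda>u v. Psi (\<lambda>X Y Z. eps X * K x (y \<cdot> X') (Y \<cdot> (u \<cdot> Y')) (Z \<cdot> (v \<cdot> Z'))))))"
      by (subst sum3_sum3) (simp add: order)
    moreover have "D X (\<lambda>s t. D z (\<lambda>u v. K (s \<cdot> a) (t \<cdot> b) (c \<cdot> (u \<cdot> c')) (d \<cdot> (v \<cdot> d')))) =
      D z (\<lambda>u v. D X (\<lambda>s t. K (s \<cdot> a) (t \<cdot> b) (c \<cdot> (u \<cdot> c')) (d \<cdot> (v \<cdot> d'))))" for X z a b c c' d d'
      by (rule sum2_sum2)
    ultimately show ?thesis by (simp add: order k3 k2)
  qed
  also have "\<dots> = Phi (\<lambda>X Y Z. K one X Y Z)"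
    using counit_psi_right[of "\<lambda>x y. Phi (\<lambda>X Y Z. K x (y \<cdot> X) Y Z)"] by (simp add: sum23_scalar lK)
  also have "\<dots> = GR F"
  proof -
    have b: "bilin (\<lambda>x1 x2. GR (\<lambda>g1 g2. D c (\<lambda>u v. F (S x2 \<cdot> (g1 \<cdot> u)) (S x1 \<cdot> (g2 \<cdot> v)))))" for c by (intro l)
    have b': "bilin (\<lambda>u v. F (g1 \<cdot> u) (g2 \<cdot> v))" for g1 g2 by (intro l)
    have "lin (\<lambda>w. GR (\<lambda>g1 g2. D w (\<lambda>u v. F (g1 \<cdot> u) (g2 \<cdot> v))))" by (intro l)
    from antipode_phi[OF this] show ?thesis by (simp add: K_def comul_one[OF b] comul_one[OF b'])
  qed
  finally show ?thesis .
qed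

lemma FR_S_al:
  assumes F: "bilin F"
  shows "FR (\<lambda>x y. D (S a \<cdot> (al \<cdot> b)) (\<lambda>u v. F (x \<cdot> u) (y \<cdot> v))) =
    D a (\<lambda>a1 a2. GR (\<lambda>g1 g2. D b (\<lambda>u v. F (S a2 \<cdot> (g1 \<cdot> u)) (S a1 \<cdot> (g2 \<cdot> v)))))"
proof -
  note l = mlin bilin_comp[OF F]
  have b1: "bilin (\<lambda>u v. F (x \<cdot> u) (y \<cdot> v))" for x y by (intro l)
  have b2: "bilin (\<lambda>s t. D al (\<lambda>u v. D b (\<lambda>e f. F (s \<cdot> (u \<cdot> e)) (t \<cdot> (v \<cdot> f)))))" by (intro l)
  have b3: "bilin (\<lambda>s t. D b (\<lambda>e f. F (S a2 \<cdot> (s \<cdot> e)) (S a1 \<cdot> (t \<cdot> f))))" for a1 a2 by (intro l)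
  show ?thesis
    using FR_S[OF b2, of a] FR_al[OF b3] by (simp add: comul_mul3[OF b1])
qed

lemma QR_S_S: "QR (\<lambda>q1 q2. F (S q2) (S q1)) = Phi (\<lambda>X Y Z. F (S Y \<cdot> (al \<cdot> Z)) (S X))"
  by (simp add: QR_def)

text \<open>\<open>FR_S_al\<close> eliminates f in favour of g. The remaining legs are collected by
  \<open>C5\<close> as S(b) \<alpha> c \<otimes> S(a) \<alpha> d \<beta> S(e), and two uses of the
  pentagon reduce everything to S(x) \<alpha> y \<beta> S(z) = 1.\<close>

lemma FR_UR:
  assumes F: "bilin F"
  shows "FR (\<lambda>x y. UR (\<lambda>u v. F (x \<cdot> u) (y \<cdot> v))) = QR (\<lambda>q1 q2. F (S q2) (S q1))"
proof -
  note l = mlin bilin_comp[OF F] lin_PR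
  define C5 where "C5 a b c d e = F (S b \<cdot> (al \<cdot> c)) (S a \<cdot> (al \<cdot> (d \<cdot> (be \<cdot> S e))))" for a b c d e
  have C5: "lin (\<lambda>x. C5 (g x) b c d e)" "lin (\<lambda>x. C5 a (g x) c d e)" "lin (\<lambda>x. C5 a b (g x) d e)"
    "lin (\<lambda>x. C5 a b c (g x) e)" "lin (\<lambda>x. C5 a b c d (g x))" if g: "endo g" for a b c d e g
    unfolding C5_def by (intro l g)+
  note l5 = mlin C5
  define K where "K a b c d = Psi (\<lambda>a' b' c'. D c (\<lambda>c1 c2. Psi (\<lambda>p q r.
     C5 a (a' \<cdot> b) (b' \<cdot> (c1 \<cdot> p)) (c' \<cdot> (c2 \<cdot> q)) (d \<cdot> r))))" for a b c d
  have K: "quadlin K" unfolding K_def by (intro l5)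
  have kal: "D w (\<lambda>s t. C5 a (s \<cdot> b) (t \<cdot> c) d e) = eps w * C5 a b c d e" for w a b c d e
    using antipode_al[of "\<lambda>w. F (S b \<cdot> (w \<cdot> c)) (S a \<cdot> (al \<cdot> (d \<cdot> (be \<cdot> S e))))" w] by (simp add: l C5_def)
  have kbe: "D w (\<lambda>s t. C5 a b c (d \<cdot> (d' \<cdot> s)) (e \<cdot> (e' \<cdot> t))) = eps w * C5 a b c (d \<cdot> d') (e \<cdot> e')" for w a b c d d' e e'
    using antipode_be[of "\<lambda>w. F (S b \<cdot> (al \<cdot> c)) (S a \<cdot> (al \<cdot> (d \<cdot> (d' \<cdot> (w \<cdot> (S e' \<cdot> S e))))))" w] by (simp add: l C5_def)
  have "FR (\<lambda>x y. UR (\<lambda>u v. F (x \<cdot> u) (y \<cdot> v))) =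
    Psi (\<lambda>x y z. D x (\<lambda>x1 x2. GR (\<lambda>g1 g2. D y (\<lambda>u v. PR (\<lambda>p1 p2. F (S x2 \<cdot> (g1 \<cdot> (u \<cdot> p1))) (S x1 \<cdot> (g2 \<cdot> (v \<cdot> (p2 \<cdot> S z)))))))))"
  proof -
    have b: "bilin (\<lambda>u v. PR (\<lambda>p1 p2. F (u \<cdot> p1) (v \<cdot> (p2 \<cdot> S z))))" for z by (intro l)
    have "FR (\<lambda>a b. Psi (\<lambda>x y z. D (S x \<cdot> (al \<cdot> y)) (\<lambda>u v. PR (\<lambda>p1 p2. F (a \<cdot> (u \<cdot> p1)) (b \<cdot> (v \<cdot> (p2 \<cdot> S z))))))) =
      Psi (\<lambda>x y z. FR (\<lambda>a b. D (S x \<cdot> (al \<cdot> y)) (\<lambda>u v. PR (\<lambda>p1 p2. F (a \<cdot> (u \<cdot> p1)) (b \<cdot> (v \<cdot> (p2 \<cdot> S z)))))))"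
      unfolding FR_def by (simp add: order GR_sums) (rule sum3_sum3)
    then show ?thesis
      using FR_S_al[OF b] by (simp add: UR_def)
  qed
  also have "\<dots> = Phi (\<lambda>A B C. Psi (\<lambda>x y z. D x (\<lambda>x1 x2. K (A \<cdot> x1) (B \<cdot> x2) (C \<cdot> y) z)))"
  proof -
    have b: "bilin (\<lambda>c1 c2. Psi (\<lambda>p q r. C5 a (a' \<cdot> b) (b' \<cdot> (c1 \<cdot> p)) (c' \<cdot> (c2 \<cdot> q)) (d \<cdot> r)))" for a b d a' b' c' by (intro l5)
    have b2: "bilin (\<lambda>c1 c2. C5 a b (b' \<cdot> (c1 \<cdot> p)) (c' \<cdot> (c2 \<cdot> q)) d)" for a b d b' c' p q by (intro l5)
    have "GR (\<lambda>g1 g2. D y (\<lambda>u v. PR (\<lambda>p1 p2. F (S x2 \<cdot> (g1 \<cdot> (u \<cdot> p1))) (S x1 \<cdot> (g2 \<cdot> (v \<cdot> (p2 \<cdot> S z))))))) =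
      Phi (\<lambda>A B C. K (A \<cdot> x1) (B \<cdot> x2) (C \<cdot> y) z)" for x1 x2 y z
      by (simp add: GR_def K_def PR_def order comul_mul[OF b2]) (simp add: C5_def)
    then show ?thesis by (simp add: order)
  qed
  \<comment> \<open>\<open>pentagon2\<close> read backwards; applying it to
    \<open>mul_11D phi_coeff K\<close> makes its last factor cancel.\<close>
  also have "\<dots> = mul_1D1 psi_coeff (mul_1_111 psi_coeff (mul_11D phi_coeff K)) one one one one"
    using fun_cong[OF fun_cong[OF fun_cong[OF fun_cong[OF pentagon2[OF quadlin_mul4(3)[OF K, of phi_coeff]], of one], of one], of one], of one]
    by (simp add: mul4_psi_phi[OF K]) (simp add: mul4_defs)
  also have "\<dots> = Psi (\<lambda>X Y Z. Psi (\<lambda>x y z. Phi (\<lambda>A B C. D Y (\<lambda>s t. D C (\<lambda>u v. K (X \<cdot> A) (s \<cdot> (x \<cdot> B)) (t \<cdot> (y \<cdot> u)) (Z \<cdot> (z \<cdot> v)))))))"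
    by (simp add: mul4_defs order)
  also have "\<dots> = Psi (\<lambda>X Y Z. Psi (\<lambda>x y z. Phi (\<lambda>A B C. D C (\<lambda>u v. Psi (\<lambda>a b c. D y (\<lambda>y1 y2. D u (\<lambda>u1 u2. Psi (\<lambda>p q r.
      C5 (X \<cdot> A) (a \<cdot> (x \<cdot> B)) (b \<cdot> (y1 \<cdot> (u1 \<cdot> p))) (Y \<cdot> (c \<cdot> (y2 \<cdot> (u2 \<cdot> q)))) (Z \<cdot> (z \<cdot> (v \<cdot> r)))))))))))"
  proof -
    have "D Y (\<lambda>s t. K a (s \<cdot> b) (t \<cdot> (y \<cdot> u)) d) =
      Psi (\<lambda>a' b' c'. D y (\<lambda>y1 y2. D u (\<lambda>u1 u2. Psi (\<lambda>p q r.
        C5 a (a' \<cdot> b) (b' \<cdot> (y1 \<cdot> (u1 \<cdot> p))) (Y \<cdot> (c' \<cdot> (y2 \<cdot> (u2 \<cdot> q)))) (d \<cdot> r)))))" for Y a b y u d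
    proof -
      \<comment> \<open>\<open>R\<close> lays open the \<phi>\<inverse> hidden in \<open>K\<close>.
        Quasi-coassociativity carries the coproducts of Y through it; \<alpha> absorbs two of the
        three parts, and Y itself arrives in the last argument.\<close>
      define R where "R w b' c' = D y (\<lambda>y1 y2. D u (\<lambda>u1 u2. Psi (\<lambda>p q r.
        C5 a (w \<cdot> b) (b' \<cdot> (y1 \<cdot> (u1 \<cdot> p))) (c' \<cdot> (y2 \<cdot> (u2 \<cdot> q))) (d \<cdot> r))))" for w b' c'
      have R: "trilin R" unfolding R_def by (intro l5)
      have b3: "bilin (\<lambda>c1 c2. Psi (\<lambda>p q r. C5 a (a' \<cdot> (s \<cdot> b)) (b' \<cdot> (c1 \<cdot> p)) (c' \<cdot> (c2 \<cdot> q)) (d \<cdot> r)))" for s a' b' c' by (intro l5)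
      have "D Y (\<lambda>s t. K a (s \<cdot> b) (t \<cdot> (y \<cdot> u)) d) =
        D Y (\<lambda>s t. D t (\<lambda>t1 t2. Psi (\<lambda>a' b' c'. R (a' \<cdot> s) (b' \<cdot> t1) (c' \<cdot> t2))))"
        using comul_mul3[OF b3] by (simp add: K_def R_def order)
      also have "\<dots> = Psi (\<lambda>a' b' c'. D Y (\<lambda>s t. D s (\<lambda>s1 s2. R (s1 \<cdot> a') (s2 \<cdot> b') (t \<cdot> c'))))"
        using quasi_coassoc_inv[OF R, of Y] by (simp add: order)
      also have "\<dots> = Psi (\<lambda>a' b' c'. R a' b' (Y \<cdot> c'))"
      proof -
        have "D s (\<lambda>s1 s2. R (s1 \<cdot> a') (s2 \<cdot> b') e) = eps s * R a' b' e" for s a' b' e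
          by (simp add: R_def sum2_sum2[of B "comul_coeff s" "comul_coeff y"] sum2_sum2[of B "comul_coeff s" "comul_coeff u"] order kal sum23_scalar)
        then show ?thesis
          using counit_l[of "\<lambda>t. R _ _ (t \<cdot> _)" Y] by (simp add: mlin trilin_comp[OF R])
      qed
      finally show ?thesis by (simp add: R_def)
    qed
    then have "D Y (\<lambda>s t. D C (\<lambda>u v. K a (s \<cdot> b) (t \<cdot> (y \<cdot> u)) (Z \<cdot> (z \<cdot> v)))) =
      D C (\<lambda>u v. Psi (\<lambda>a' b' c'. D y (\<lambda>y1 y2. D u (\<lambda>u1 u2. Psi (\<lambda>p q r.
        C5 a (a' \<cdot> b) (b' \<cdot> (y1 \<cdot> (u1 \<cdot> p))) (Y \<cdot> (c' \<cdot> (y2 \<cdot> (u2 \<cdot> q)))) (Z \<cdot> (z \<cdot> (v \<cdot> r))))))))" for Y C a b y Z z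
      by (subst sum2_sum2) simp
    then show ?thesis by simp
  qed
  also have "\<dots> = Psi (\<lambda>X Y Z. Psi (\<lambda>a b c. Psi (\<lambda>x y z. D y (\<lambda>y1 y2. Psi (\<lambda>p q r. Phi (\<lambda>A B C. D C (\<lambda>u v. D v (\<lambda>v1 v2.
      C5 (X \<cdot> A) (a \<cdot> (x \<cdot> B)) (b \<cdot> (y1 \<cdot> (p \<cdot> u))) (Y \<cdot> (c \<cdot> (y2 \<cdot> (q \<cdot> v1)))) (Z \<cdot> (z \<cdot> (r \<cdot> v2)))))))))))"
  proof -
    have t: "trilin (\<lambda>c' d' e'. C5 a' b' (b \<cdot> (y1 \<cdot> c')) (Y \<cdot> (c \<cdot> (y2 \<cdot> d'))) (Z \<cdot> (z \<cdot> e')))" for a' b' b y1 Y c y2 Z z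
      by (intro l5)
    have "Psi (\<lambda>x y z. Phi (\<lambda>A B C. D C (\<lambda>u v. Psi (\<lambda>a b c. D y (\<lambda>y1 y2. D u (\<lambda>u1 u2. Psi (\<lambda>p q r.
      C5 (X \<cdot> A) (a \<cdot> (x \<cdot> B)) (b \<cdot> (y1 \<cdot> (u1 \<cdot> p))) (Y \<cdot> (c \<cdot> (y2 \<cdot> (u2 \<cdot> q)))) (Z \<cdot> (z \<cdot> (v \<cdot> r)))))))))) =
      Psi (\<lambda>x y z. Psi (\<lambda>a b c. Phi (\<lambda>A B C. D y (\<lambda>y1 y2. D C (\<lambda>u v. D u (\<lambda>u1 u2. Psi (\<lambda>p q r.
      C5 (X \<cdot> A) (a \<cdot> (x \<cdot> B)) (b \<cdot> (y1 \<cdot> (u1 \<cdot> p))) (Y \<cdot> (c \<cdot> (y2 \<cdot> (u2 \<cdot> q)))) (Z \<cdot> (z \<cdot> (v \<cdot> r))))))))))" for X Y Z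
    proof -
      have "D C (\<lambda>u v. Psi (\<lambda>a b c. D y (\<lambda>y1 y2. D u (\<lambda>u1 u2. Psi (\<lambda>p q r.
        C5 (X \<cdot> A) (a \<cdot> (x \<cdot> B)) (b \<cdot> (y1 \<cdot> (u1 \<cdot> p))) (Y \<cdot> (c \<cdot> (y2 \<cdot> (u2 \<cdot> q)))) (Z \<cdot> (z \<cdot> (v \<cdot> r)))))))) =
        Psi (\<lambda>a b c. D y (\<lambda>y1 y2. D C (\<lambda>u v. D u (\<lambda>u1 u2. Psi (\<lambda>p q r.
        C5 (X \<cdot> A) (a \<cdot> (x \<cdot> B)) (b \<cdot> (y1 \<cdot> (u1 \<cdot> p))) (Y \<cdot> (c \<cdot> (y2 \<cdot> (u2 \<cdot> q)))) (Z \<cdot> (z \<cdot> (v \<cdot> r))))))))" for y A x B C z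
        by (subst sum2_sum3) (subst sum2_sum2, rule refl)
      then show ?thesis by (simp only: Phi_Psi)
    qed
    also have "\<dots> X Y Z = Psi (\<lambda>a b c. Psi (\<lambda>x y z. D y (\<lambda>y1 y2. Psi (\<lambda>p q r. Phi (\<lambda>A B C. D C (\<lambda>u v. D v (\<lambda>v1 v2.
      C5 (X \<cdot> A) (a \<cdot> (x \<cdot> B)) (b \<cdot> (y1 \<cdot> (p \<cdot> u))) (Y \<cdot> (c \<cdot> (y2 \<cdot> (q \<cdot> v1)))) (Z \<cdot> (z \<cdot> (r \<cdot> v2))))))))))" for X Y Z
      unfolding quasi_coassoc_inv[OF t] by (subst sum3_sum3) (simp add: order)
    finally show ?thesis by simp
  qed
  also have "\<dots> = Psi (\<lambda>X Y Z. Phi (\<lambda>A B C. C5 (X \<cdot> A) B C Y Z))"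
  proof -
    have "Psi (\<lambda>a b c. Psi (\<lambda>x y z. D y (\<lambda>y1 y2. Psi (\<lambda>p q r. Phi (\<lambda>A B C. D C (\<lambda>u v. D v (\<lambda>v1 v2.
      C5 (X \<cdot> A) (a \<cdot> (x \<cdot> B)) (b \<cdot> (y1 \<cdot> (p \<cdot> u))) (Y \<cdot> (c \<cdot> (y2 \<cdot> (q \<cdot> v1)))) (Z \<cdot> (z \<cdot> (r \<cdot> v2)))))))))) =
      Phi (\<lambda>A B C. C5 (X \<cdot> A) B C Y Z)" for X Y Z
    proof -
      \<comment> \<open>\<open>pentagon5\<close> replaces the three factors \<phi>\<inverse> in
        front of \<open>N\<close> by two, whose coproducts are removed by \<alpha> and by
        \<beta>.\<close>
      define N where "N a b c d = Phi (\<lambda>A B C. D C (\<lambda>u v. D v (\<lambda>v1 v2.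
        C5 (X \<cdot> A) (a \<cdot> B) (b \<cdot> u) (Y \<cdot> (c \<cdot> v1)) (Z \<cdot> (d \<cdot> v2)))))" for a b c d
      have N: "quadlin N" unfolding N_def by (intro l5)
      note lN = mlin quadlin_comp[OF N]
      have N_eq: "N a b c d = Phi (\<lambda>A B C. C5 (X \<cdot> A) (a \<cdot> B) (b \<cdot> C) (Y \<cdot> c) (Z \<cdot> d))" for a b c d
      proof -
        have "D C (\<lambda>u v. eps v * C5 a' b' (b \<cdot> u) c' d') = C5 a' b' (b \<cdot> C) c' d'" for C a' b' c' d'
          by (intro counit_r l5)
        then show ?thesis by (simp add: N_def kbe)
      qed
      have n1: "D a (\<lambda>s t. N (s \<cdot> p) (t \<cdot> q) c d) = eps a * N p q c d" for a p q c d
        by (simp add: N_eq order kal sum23_scalar)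
      have n2: "D r (\<lambda>s t. N p q (b \<cdot> s) (c \<cdot> t)) = eps r * N p q b c" for r p q b c
        by (simp add: N_eq order kbe sum23_scalar)
      have "mul_D11 psi_coeff (mul_11D psi_coeff N) one one one one = N one one one one"
      proof -
        have "Psi (\<lambda>p q r. eps r * N p q b c) = N one one b c" for b c
          using counit_psi_right[of "\<lambda>p q. N p q b c"] by (simp add: lN)
        moreover have "Psi (\<lambda>a b c. eps a * N one one b c) = N one one one one"
          using counit_psi_left[of "\<lambda>b c. N one one b c"] by (simp add: lN)
        moreover have "D a (\<lambda>s t. D r (\<lambda>u v. N (s \<cdot> p) (t \<cdot> q) (b \<cdot> u) (c \<cdot> v))) = eps a * (eps r * N p q b c)" for a r p q b c
          by (simp add: n2 n1 sum23_scalar mult.left_commute)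
        ultimately show ?thesis by (simp add: mul4_defs order sum23_scalar)
      qed
      then have "mul_111_1 psi_coeff (mul_1D1 psi_coeff (mul_1_111 psi_coeff N)) one one one one = N one one one one"
        by (simp add: pentagon5[OF N])
      moreover have "N one one one one = Phi (\<lambda>A B C. C5 (X \<cdot> A) B C Y Z)"
        by (simp add: N_eq)
      ultimately show ?thesis by (simp add: mul4_defs N_def)
    qed
    then show ?thesis by simp
  qed
  also have "\<dots> = QR (\<lambda>q1 q2. F (S q2) (S q1))"
  proof -
    have "Psi (\<lambda>X Y Z. C5 (X \<cdot> A) B' C Y Z) = F (S B' \<cdot> (al \<cdot> C)) (S A)" for A B' C
      using antipode_psi[of "\<lambda>w. F (S B' \<cdot> (al \<cdot> C)) (S A \<cdot> w)"] by (simp add: l C5_def)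
    then show ?thesis unfolding QR_S_S by (simp add: Phi_Psi[symmetric])
  qed
  finally show ?thesis .
qed

text \<open>The candidate \<Delta>(S(p1)) U (p2 \<otimes> 1) for f\<inverse>. Multiplying it by f
  and using \<open>FR_S\<close> and \<open>FR_UR\<close> gives S \<otimes> S of the flipped
  \<open>(1 \<otimes> S\<inverse>(p2)) q\<^sub>R \<Delta>(p1)\<close>, which is trivial by
  \<open>PR_QR\<close>.\<close>

definition WR where
  "WR F = PR (\<lambda>p1 p2. D (S p1) (\<lambda>s t. UR (\<lambda>u v. F (s \<cdot> (u \<cdot> p2)) (t \<cdot> v))))"

lemma lin_WR: "(\<And>u v. lin (\<lambda>x. F x u v)) \<Longrightarrow> lin (\<lambda>x. WR (F x))"
  unfolding WR_def by (intro mlin lin_PR lin_UR)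

lemma WR_sums:
  "WR (\<lambda>x y. sum2 B k (\<lambda>u v. F x y u v)) = sum2 B k (\<lambda>u v. WR (\<lambda>x y. F x y u v))"
  "WR (\<lambda>x y. sum3 B l (\<lambda>u v w. G x y u v w)) = sum3 B l (\<lambda>u v w. WR (\<lambda>x y. G x y u v w))"
  by (simp_all add: WR_def UR_sums PR_sums QR_sums sum2_sum2[of B _ k] sum2_sum3[of B _ l])

lemma FR_sums:
  "FR (\<lambda>x y. sum2 B k (\<lambda>u v. F x y u v)) = sum2 B k (\<lambda>u v. FR (\<lambda>x y. F x y u v))"
  "FR (\<lambda>x y. sum3 B l (\<lambda>u v w. G x y u v w)) = sum3 B l (\<lambda>u v w. FR (\<lambda>x y. G x y u v w))"
proof -
  have "FR (\<lambda>x y. sum2 B k (\<lambda>u v. F x y u v)) = Psi (\<lambda>X Y Z. sum2 B k (\<lambda>s t. D X (\<lambda>x1 x2. GR (\<lambda>g1 g2. D (Y \<cdot> (be \<cdot> S Z)) (\<lambda>u v.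
      F (S x2 \<cdot> (g1 \<cdot> u)) (S x1 \<cdot> (g2 \<cdot> v)) s t)))))"
    by (simp add: FR_def GR_sums sum2_sum2[of B _ k])
  also have "\<dots> = sum2 B k (\<lambda>u v. FR (\<lambda>x y. F x y u v))"
    unfolding FR_def by (rule sum2_sum3[symmetric])
  finally show "FR (\<lambda>x y. sum2 B k (\<lambda>u v. F x y u v)) = sum2 B k (\<lambda>u v. FR (\<lambda>x y. F x y u v))" .
  have "FR (\<lambda>x y. sum3 B l (\<lambda>u v w. G x y u v w)) = Psi (\<lambda>X Y Z. sum3 B l (\<lambda>r s t. D X (\<lambda>x1 x2. GR (\<lambda>g1 g2. D (Y \<cdot> (be \<cdot> S Z)) (\<lambda>u v.
      G (S x2 \<cdot> (g1 \<cdot> u)) (S x1 \<cdot> (g2 \<cdot> v)) r s t)))))"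
    by (simp add: FR_def GR_sums sum2_sum3[of B "comul_coeff _" l])
  also have "\<dots> = sum3 B l (\<lambda>u v w. FR (\<lambda>x y. G x y u v w))"
    unfolding FR_def by (rule sum3_sum3)
  finally show "FR (\<lambda>x y. sum3 B l (\<lambda>u v w. G x y u v w)) = sum3 B l (\<lambda>u v w. FR (\<lambda>x y. G x y u v w))" .
qed

lemma FR_PR_commute: "FR (\<lambda>x y. PR (\<lambda>u v. F x y u v)) = PR (\<lambda>u v. FR (\<lambda>x y. F x y u v))"
  unfolding PR_def FR_sums ..

lemma PR_QR:
  assumes F: "bilin F"
  shows "PR (\<lambda>p1 p2. D p1 (\<lambda>u v. QR (\<lambda>q1 q2. F (q1 \<cdot> u) (T p2 \<cdot> (q2 \<cdot> v))))) = F one one"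
proof -
  have "quasi_hopf_calculus.QR B (\<lambda>x y. y \<cdot> x) psi_coeff S (T be) = PR"
    by (intro ext) (simp add: PR_def quasi_hopf_calculus.QR_def[OF opposite])
  then show ?thesis
    using quasi_hopf_calculus.QR_PR[OF opposite F] by (simp add: QR_opposite)
qed

lemma FR_WR:
  assumes F: "bilin F"
  shows "FR (\<lambda>x y. WR (\<lambda>u v. F (x \<cdot> u) (y \<cdot> v))) = F one one"
proof -
  note l = mlin bilin_comp[OF F] lin_UR
  have b1: "bilin (\<lambda>s t. UR (\<lambda>u v. F (s \<cdot> (u \<cdot> p2)) (t \<cdot> v)))" for p2 by (intro l)
  have b2: "bilin (\<lambda>u v. F (S a2 \<cdot> (u \<cdot> p2)) (S a1 \<cdot> v))" for a1 a2 p2 by (intro l)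
  have b3: "bilin (\<lambda>a b. F (S b) (S a))" by (intro l)
  have "FR (\<lambda>x y. WR (\<lambda>u v. F (x \<cdot> u) (y \<cdot> v))) =
    PR (\<lambda>p1 p2. D p1 (\<lambda>a1 a2. QR (\<lambda>q1 q2. F (S a2 \<cdot> (S q2 \<cdot> p2)) (S a1 \<cdot> S q1))))"
    using FR_S[OF b1] FR_UR[OF b2] by (simp add: WR_def FR_PR_commute)
  also have "\<dots> = F one one"
    using PR_QR[OF b3] by simp
  finally show ?thesis .
qed

text \<open>After \<open>PR_eq_UR\<close> only f \<Delta>(S(a)) and f U occur, with a = Y
  S\<inverse>(X \<beta>), since S(a) = X \<beta> S(Y). Applying S\<inverse> to both legs and
  flipping yields the definition of V.\<close>

lemma FR_PR:
  assumes F: "bilin F"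
  shows "FR (\<lambda>x y. PR (\<lambda>p1 p2. F (x \<cdot> p1) (y \<cdot> p2))) = VR (\<lambda>a b. F (S b) (S a))"
proof -
  note l = mlin bilin_comp[OF F] lin_UR
  have b: "bilin (\<lambda>u v. F (x \<cdot> u) (y \<cdot> v))" for x y by (intro l)
  have b1: "bilin (\<lambda>s t. UR (\<lambda>u v. F (s \<cdot> (u \<cdot> Z)) (t \<cdot> v)))" for Z by (intro l)
  have b2: "bilin (\<lambda>u v. F (S a2 \<cdot> (u \<cdot> Z)) (S a1 \<cdot> v))" for a1 a2 Z by (intro l)
  have "FR (\<lambda>x y. PR (\<lambda>p1 p2. F (x \<cdot> p1) (y \<cdot> p2))) =
    Phi (\<lambda>X Y Z. FR (\<lambda>x y. D (S (Y \<cdot> T (X \<cdot> be))) (\<lambda>s t. UR (\<lambda>u v. F (x \<cdot> (s \<cdot> (u \<cdot> Z))) (y \<cdot> (t \<cdot> v))))))"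
    unfolding PR_eq_UR[OF b, symmetric] FR_sums by simp
  also have "\<dots> = VR (\<lambda>a b. F (S b) (S a))"
    using FR_S[OF b1, of "_ \<cdot> T (_ \<cdot> be)"] FR_UR[OF b2] by (simp add: VR_def)
  finally show ?thesis .
qed

text \<open>The intertwining property expected of f\<inverse>, derived from \<open>UR_cov\<close>
  and \<open>PR_cov\<close> alone, because that \<open>WR\<close> inverts f from the left is still
  to be shown.\<close>

lemma WR_S:
  assumes F: "bilin F"
  shows "D a (\<lambda>a1 a2. WR (\<lambda>x y. F (x \<cdot> S a2) (y \<cdot> S a1))) = D (S a) (\<lambda>s t. WR (\<lambda>x y. F (s \<cdot> x) (t \<cdot> y)))"
proof -
  note l = mlin bilin_comp[OF F] lin_UR lin_PR
  define G where "G m n = D (S m) (\<lambda>s t. UR (\<lambda>u v. F (s \<cdot> (u \<cdot> n)) (t \<cdot> v)))" for m n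
  have G: "bilin G" unfolding G_def by (intro l)
  have 1: "UR (\<lambda>u v. F (s \<cdot> (u \<cdot> r)) (t \<cdot> (v \<cdot> S c))) =
    D c (\<lambda>c1 c2. D (S c1) (\<lambda>s' t'. UR (\<lambda>u v. F (s \<cdot> (s' \<cdot> (u \<cdot> (c2 \<cdot> r)))) (t \<cdot> (t' \<cdot> v)))))" for s r t c
    using UR_cov[of "\<lambda>m n. F (s \<cdot> (m \<cdot> r)) (t \<cdot> n)" c] by (simp add: l)
  have b: "bilin (\<lambda>s t. UR (\<lambda>u v. F (s \<cdot> (u \<cdot> r)) (t \<cdot> v)))" for r by (intro l)
  have 2: "D (S m) (\<lambda>s t. UR (\<lambda>u v. F (s \<cdot> (u \<cdot> r)) (t \<cdot> (v \<cdot> S c)))) = D c (\<lambda>c1 c2. G (c1 \<cdot> m) (c2 \<cdot> r))" for m r c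
    by (simp add: 1 G_def comul_mul[OF b] sum2_sum2[of B "comul_coeff (S m)" "comul_coeff c"])
  have "D a (\<lambda>a1 a2. WR (\<lambda>x y. F (x \<cdot> S a2) (y \<cdot> S a1))) =
    D a (\<lambda>a1 a2. D a1 (\<lambda>c1 c2. PR (\<lambda>p1 p2. G (c1 \<cdot> p1) (c2 \<cdot> (p2 \<cdot> S a2)))))"
    by (simp add: WR_def 2 PR_sums)
  also have "\<dots> = PR (\<lambda>p1 p2. G (p1 \<cdot> a) p2)"
    by (rule PR_cov[OF G])
  also have "\<dots> = D (S a) (\<lambda>s t. WR (\<lambda>x y. F (s \<cdot> x) (t \<cdot> y)))"
    by (simp add: G_def comul_mul[OF b] WR_def PR_sums)
  finally show ?thesis .
qed

text \<open>Counterpart of \<open>FR_al\<close> for f\<inverse>. \<open>K_eq\<close> moves S(a)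
  through U so that \<open>PR_contraction\<close> applies; the resulting sum over \<phi>\<inverse>
  is evaluated by \<open>pentagon4\<close> and \<open>QR_PR\<close>.\<close>

lemma WR_GR:
  assumes F: "bilin F"
  shows "WR (\<lambda>x y. GR (\<lambda>u v. F (x \<cdot> u) (y \<cdot> v))) = D al F"
proof -
  note l = mlin bilin_comp[OF F] lin_UR lin_PR
  define M where "M m n d = D (S m) (\<lambda>s t. UR (\<lambda>u v. F (s \<cdot> (u \<cdot> n)) (t \<cdot> (v \<cdot> (al \<cdot> d)))))" for m n d
  have M: "trilin M" unfolding M_def by (intro l)
  define K where "K a b c d = D a (\<lambda>s t. PR (\<lambda>p1 p2. M (s \<cdot> p1) (t \<cdot> (p2 \<cdot> (S b \<cdot> (al \<cdot> c)))) d))" for a b c d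
  define N where "N a b c d = D (S a \<cdot> (al \<cdot> b)) (\<lambda>u v. PR (\<lambda>p1 p2. F (u \<cdot> p1) (v \<cdot> (p2 \<cdot> (S c \<cdot> (al \<cdot> d))))))" for a b c d
  have N: "quadlin N" unfolding N_def by (intro l)
  note lN = mlin quadlin_comp[OF N]
  have K_eq: "WR (\<lambda>x y. F (x \<cdot> (S b \<cdot> (al \<cdot> c))) (y \<cdot> (S a \<cdot> (al \<cdot> d)))) = K a b c d" for a b c d
  proof -
    have 1: "UR (\<lambda>u v. F (s \<cdot> (u \<cdot> r)) (t \<cdot> (v \<cdot> (S a \<cdot> (al \<cdot> d))))) =
      D a (\<lambda>c1 c2. D (S c1) (\<lambda>s' t'. UR (\<lambda>u v. F (s \<cdot> (s' \<cdot> (u \<cdot> (c2 \<cdot> r)))) (t \<cdot> (t' \<cdot> (v \<cdot> (al \<cdot> d)))))))" for s r t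
      using UR_cov[of "\<lambda>m n. F (s \<cdot> (m \<cdot> r)) (t \<cdot> (n \<cdot> (al \<cdot> d)))" a] by (simp add: l)
    have b: "bilin (\<lambda>s t. UR (\<lambda>u v. F (s \<cdot> (u \<cdot> r)) (t \<cdot> (v \<cdot> (al \<cdot> d)))))" for r by (intro l)
    have 2: "D (S m) (\<lambda>s t. UR (\<lambda>u v. F (s \<cdot> (u \<cdot> r)) (t \<cdot> (v \<cdot> (S a \<cdot> (al \<cdot> d)))))) =
      D a (\<lambda>c1 c2. M (c1 \<cdot> m) (c2 \<cdot> r) d)" for m r
      by (simp add: 1 M_def comul_mul[OF b] sum2_sum2[of B "comul_coeff (S m)" "comul_coeff a"])
    show ?thesis by (simp add: WR_def 2 K_def PR_sums)
  qed
  note k2 = PR_absorb[OF F]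
  have "WR (\<lambda>x y. GR (\<lambda>u v. F (x \<cdot> u) (y \<cdot> v))) = mul_1_111 psi_coeff (mul_11D phi_coeff K) one one one one"
    using K_eq[of "_ \<cdot> _"] by (simp add: GR_def WR_sums mul4_defs order)
  also have "\<dots> = Psi M"
    by (rule PR_contraction[OF M K_def])
  also have "\<dots> = mul_111_1 psi_coeff (mul_1D1 psi_coeff N) one one one one"
    by (simp add: M_def[abs_def] UR_def order k2 mul4_defs N_def) (rule sum3_sum3)
  also have "\<dots> = Psi (\<lambda>X Y Z. D X (\<lambda>s t. Psi (\<lambda>x y z. D z (\<lambda>u v. Phi (\<lambda>X' Y' Z'. N (s \<cdot> x) (t \<cdot> (y \<cdot> X')) (Y \<cdot> (u \<cdot> Y')) (Z \<cdot> (v \<cdot> Z')))))))"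
    by (simp add: pentagon4[OF N]) (simp add: mul4_defs)
  also have "\<dots> = Psi (\<lambda>X Y Z. eps X * Psi (\<lambda>x y z. D z (\<lambda>u v. Phi (\<lambda>X' Y' Z'. N x (y \<cdot> X') (Y \<cdot> (u \<cdot> Y')) (Z \<cdot> (v \<cdot> Z'))))))"
  proof -
    have "D X (\<lambda>s t. N (s \<cdot> a) (t \<cdot> b) c d) = eps X * N a b c d" for X a b c d
    proof -
      have "lin (\<lambda>w. D (S a \<cdot> (w \<cdot> b)) (\<lambda>u v. PR (\<lambda>p1 p2. F (u \<cdot> p1) (v \<cdot> (p2 \<cdot> (S c \<cdot> (al \<cdot> d)))))))" by (intro l)
      from antipode_al[OF this] show ?thesis by (simp add: N_def)
    qed
    moreover have "D X (\<lambda>s t. D z (\<lambda>u v. N (s \<cdot> a) (t \<cdot> b) (c \<cdot> (u \<cdot> c')) (d \<cdot> (v \<cdot> d')))) =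
      D z (\<lambda>u v. D X (\<lambda>s t. N (s \<cdot> a) (t \<cdot> b) (c \<cdot> (u \<cdot> c')) (d \<cdot> (v \<cdot> d'))))" for X z a b c c' d d'
      by (rule sum2_sum2)
    ultimately show ?thesis by (simp add: order sum23_scalar)
  qed
  also have "\<dots> = Psi (\<lambda>x y z. D z (\<lambda>u v. Phi (\<lambda>X' Y' Z'. N x (y \<cdot> X') (u \<cdot> Y') (v \<cdot> Z'))))"
    using counit_psi_left[of "\<lambda>Y Z. Psi (\<lambda>x y z. D z (\<lambda>u v. Phi (\<lambda>X' Y' Z'. N x (y \<cdot> X') (Y \<cdot> (u \<cdot> Y')) (Z \<cdot> (v \<cdot> Z')))))"]
    by (simp add: lN)
  also have "\<dots> = Psi (\<lambda>x y z. eps z * Phi (\<lambda>X' Y' Z'. N x (y \<cdot> X') Y' Z'))"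
  proof -
    have "D z (\<lambda>u v. N a b (u \<cdot> c) (v \<cdot> d)) = eps z * N a b c d" for z a b c d
    proof -
      have "lin (\<lambda>w. D (S a \<cdot> (al \<cdot> b)) (\<lambda>u v. PR (\<lambda>p1 p2. F (u \<cdot> p1) (v \<cdot> (p2 \<cdot> (S c \<cdot> (w \<cdot> d)))))))" by (intro l)
      from antipode_al[OF this] show ?thesis by (simp add: N_def)
    qed
    then show ?thesis by (simp add: order sum23_scalar)
  qed
  also have "\<dots> = Phi (\<lambda>X Y Z. N one X Y Z)"
    using counit_psi_right[of "\<lambda>x y. Phi (\<lambda>X' Y' Z'. N x (y \<cdot> X') Y' Z')"] by (simp add: lN)
  also have "\<dots> = D al F"
  proof -
    have b: "bilin (\<lambda>u v. PR (\<lambda>p1 p2. F (u \<cdot> p1) (v \<cdot> (p2 \<cdot> r))))" for r by (intro l)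
    have b2: "bilin (\<lambda>a b. F (s \<cdot> a) (t \<cdot> b))" for s t by (intro l)
    show ?thesis
      using QR_PR[OF b2] by (simp add: N_def comul_mul[OF b] order QR_def) (simp add: order[symmetric])
  qed
  finally show ?thesis .
qed

text \<open>\<open>WR_S\<close> and \<open>WR_GR\<close> turn f\<inverse> f into \<Delta>(S(X)
  \<alpha> Y \<beta> S(Z)) summed over \<phi>\<inverse>, which is \<Delta>(1).\<close>

lemma WR_FR:
  assumes F: "bilin F"
  shows "WR (\<lambda>x y. FR (\<lambda>u v. F (x \<cdot> u) (y \<cdot> v))) = F one one"
proof -
  note l = mlin bilin_comp[OF F] lin_GR
  have b1: "bilin (\<lambda>m n. GR (\<lambda>g1 g2. D c (\<lambda>u v. F (m \<cdot> (g1 \<cdot> u)) (n \<cdot> (g2 \<cdot> v)))))" for c by (intro l)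
  have b2: "bilin (\<lambda>g1 g2. D c (\<lambda>u v. F (s \<cdot> (g1 \<cdot> u)) (t \<cdot> (g2 \<cdot> v))))" for s t c by (intro l)
  have "WR (\<lambda>x y. FR (\<lambda>u v. F (x \<cdot> u) (y \<cdot> v))) =
    Psi (\<lambda>X Y Z. D (S X) (\<lambda>s t. D al (\<lambda>g1 g2. D (Y \<cdot> (be \<cdot> S Z)) (\<lambda>u v. F (s \<cdot> (g1 \<cdot> u)) (t \<cdot> (g2 \<cdot> v))))))"
    using WR_S[OF b1] WR_GR[OF b2] by (simp add: FR_def WR_sums)
  also have "\<dots> = F one one"
  proof -
    have "lin (\<lambda>w. D w F)" by (intro l)
    from antipode_psi[OF this] show ?thesis by (simp add: comul_mul3[OF F] comul_one[OF F])
  qed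
  finally show ?thesis .
qed

subsection \<open>Left cointegrals\<close>

text \<open>Cyclicity of the trace, for \<open>N\<close> linear in a vector and in a form; the
  latter is expressed on combinations of the dual basis.\<close>

lemma trace_swap:
  assumes N: "\<And>b'. lin (\<lambda>b. N b (dual b'))"
    and N_sum: "\<And>b c. N b (\<lambda>x. \<Sum>b'\<in>B. c b' * dual b' x) = (\<Sum>b'\<in>B. c b' * N b (dual b'))"
    and g: "endo g"
  shows "(\<Sum>b\<in>B. N b (\<lambda>x. dual b (g x))) = (\<Sum>b\<in>B. N (g b) (dual b))"
proof -
  have "dual b (g x) = (\<Sum>b'\<in>B. dual b (g b') * dual b' x)" for b x
    by (subst lin_expand[OF lin_dual[OF g]]) (simp add: mult.commute)
  then have "(\<lambda>x. dual b (g x)) = (\<lambda>x. \<Sum>b'\<in>B. dual b (g b') * dual b' x)" for b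
    by (rule ext)
  then have "N b (\<lambda>x. dual b (g x)) = (\<Sum>b'\<in>B. dual b (g b') * N b (dual b'))" for b
    by (rule trans[OF arg_cong[where f="N b"] N_sum])
  then have "(\<Sum>b\<in>B. N b (\<lambda>x. dual b (g x))) = (\<Sum>b\<in>B. \<Sum>b'\<in>B. dual b (g b') * N b (dual b'))"
    by (rule sum.cong[OF refl])
  also have "\<dots> = (\<Sum>b'\<in>B. \<Sum>b\<in>B. dual b (g b') * N b (dual b'))"
    by (rule sum.swap)
  also have "\<dots> = (\<Sum>b'\<in>B. N (g b') (dual b'))"
    by (rule sum.cong[OF refl], rule lin_expand[symmetric], rule N)
  finally show ?thesis .
qed

lemma functional_lincomb:
  "PR (\<lambda>x y. \<Sum>i\<in>I. G i x y) = (\<Sum>i\<in>I. PR (G i))"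
  "QR (\<lambda>x y. \<Sum>i\<in>I. G i x y) = (\<Sum>i\<in>I. QR (G i))"
  "UR (\<lambda>x y. \<Sum>i\<in>I. G i x y) = (\<Sum>i\<in>I. UR (G i))"
  "VR (\<lambda>x y. \<Sum>i\<in>I. G i x y) = (\<Sum>i\<in>I. VR (G i))"
  "Db y (\<lambda>x y. \<Sum>i\<in>I. G i x y) = (\<Sum>i\<in>I. Db y (G i))"
  by (simp_all add: PR_def QR_def UR_def VR_def Db_def sum2_sum sum3_sum)

lemma functional_cmult:
  "PR (\<lambda>x y. c * F x y) = c * PR F" "QR (\<lambda>x y. c * F x y) = c * QR F"
  "UR (\<lambda>x y. c * F x y) = c * UR F" "VR (\<lambda>x y. c * F x y) = c * VR F"
  "Db y (\<lambda>x y. c * F x y) = c * Db y F"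
  by (simp_all add: PR_def QR_def UR_def VR_def Db_def sum23_scalar)

lemma Db_sums:
  "Db y (\<lambda>x z. sum2 B k (\<lambda>u v. F x z u v)) = sum2 B k (\<lambda>u v. Db y (\<lambda>x z. F x z u v))"
  "Db y (\<lambda>x z. sum3 B l (\<lambda>u v w. G x z u v w)) = sum3 B l (\<lambda>u v w. Db y (\<lambda>x z. G x z u v w))"
  by (simp_all add: Db_def UR_sums VR_sums sum2_sum2[of B _ k] sum2_sum3[of B _ l])

lemma Db_QR: "Db y (\<lambda>x z. QR (\<lambda>u v. F x z u v)) = QR (\<lambda>u v. Db y (\<lambda>x z. F x z u v))"
  unfolding QR_def Db_sums by (rule refl)

lemma Db_dual_lincomb:
  "Db y (\<lambda>x z. (\<Sum>b'\<in>B. c b' * dual b' x) * \<psi> z) = (\<Sum>b'\<in>B. c b' * Db y (\<lambda>x z. dual b' x * \<psi> z))"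
  by (simp add: sum_distrib_right mult.assoc functional_lincomb functional_cmult)

text \<open>S(\<beta> S(q2 b)) is the factor S(S(q2 b)) S(\<beta>) of the original projection,
  written so that \<beta> stands next to an antipode.\<close>

definition E where
  "E \<psi> a = (\<Sum>b\<in>B. QR (\<lambda>q1 q2. Db (T q1 \<cdot> (a \<cdot> S (be \<cdot> S (q2 \<cdot> b)))) (\<lambda>x z. dual b x * \<psi> z)))"

lemma lin_E: "endo g \<Longrightarrow> lin (\<lambda>a. E \<psi> (g a))"
  unfolding E_def by (intro lin_sum lin_QR lin_Db_arg mlin)

lemma lin_E_form: "(\<And>z. lin (\<lambda>x. \<psi> x z)) \<Longrightarrow> lin (\<lambda>x. E (\<psi> x) a)"
  unfolding E_def by (intro lin_sum lin_QR lin_Db mlin)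

lemma E_sum2: "E (\<lambda>z. sum2 B k (\<lambda>u v. F z u v)) a = sum2 B k (\<lambda>u v. E (\<lambda>z. F z u v) a)"
  unfolding E_def sum2_sum[symmetric] sum2_cmult[symmetric] Db_sums PR_sums QR_sums by (rule refl)

lemma E_lincomb: "E (\<lambda>z. \<Sum>i\<in>I. c i * \<psi> i z) a = (\<Sum>i\<in>I. c i * E (\<psi> i) a)"
  unfolding E_def sum_distrib_left mult.left_commute[of "dual _ _"] functional_lincomb functional_cmult
  by (rule sum.swap)

lemma E_cmult: "E (\<lambda>z. c * \<psi> z) a = c * E \<psi> a"
  unfolding E_def sum_distrib_left mult.left_commute[of "dual _ _"] functional_cmult by (rule refl)

text \<open>\<open>Db_right\<close> places c1 before \<beta> and c2 in the first leg; cyclicity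
  moves c2 behind b, where it becomes S(c2) behind \<beta>, and c1 \<beta> S(c2) collapses.\<close>

lemma E_right:
  assumes \<psi>: "lin \<psi>"
  shows "E (\<lambda>z. \<psi> (z \<cdot> S c)) a = eps c * E \<psi> a"
proof -
  note l = mlin lin_comp[OF \<psi>] lin_dual lin_Db_arg lin_QR
  have b: "bilin (\<lambda>x z. dual b x * \<psi> z)" for b by (intro l)
  have "E (\<lambda>z. \<psi> (z \<cdot> S c)) a = (\<Sum>b\<in>B. QR (\<lambda>q1 q2. D c (\<lambda>c1 c2.
     Db (T q1 \<cdot> (a \<cdot> S (c1 \<cdot> (be \<cdot> S (q2 \<cdot> b))))) (\<lambda>x z. dual b (x \<cdot> c2) * \<psi> z))))"
    using Db_right[OF b] by (simp add: E_def)
  also have "\<dots> = D c (\<lambda>c1 c2. \<Sum>b\<in>B. QR (\<lambda>q1 q2.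
     Db (T q1 \<cdot> (a \<cdot> S (c1 \<cdot> (be \<cdot> S (q2 \<cdot> b))))) (\<lambda>x z. dual b (x \<cdot> c2) * \<psi> z)))"
    by (simp only: PR_sums QR_sums sum2_sum)
  also have "\<dots> = D c (\<lambda>c1 c2. \<Sum>b\<in>B. QR (\<lambda>q1 q2.
     Db (T q1 \<cdot> (a \<cdot> S (c1 \<cdot> (be \<cdot> S (q2 \<cdot> (b \<cdot> c2)))))) (\<lambda>x z. dual b x * \<psi> z)))"
  proof -
    have "(\<Sum>b\<in>B. QR (\<lambda>q1 q2. Db (T q1 \<cdot> (a \<cdot> S (c1 \<cdot> (be \<cdot> S (q2 \<cdot> b))))) (\<lambda>x z. dual b (x \<cdot> c2) * \<psi> z))) =
      (\<Sum>b\<in>B. QR (\<lambda>q1 q2. Db (T q1 \<cdot> (a \<cdot> S (c1 \<cdot> (be \<cdot> S (q2 \<cdot> (b \<cdot> c2)))))) (\<lambda>x z. dual b x * \<psi> z)))" for c1 c2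
      by (rule trace_swap[where N="\<lambda>b \<xi>. QR (\<lambda>q1 q2. Db (T q1 \<cdot> (a \<cdot> S (c1 \<cdot> (be \<cdot> S (q2 \<cdot> b))))) (\<lambda>x z. \<xi> x * \<psi> z))"])
        (intro l, simp add: Db_dual_lincomb functional_lincomb functional_cmult, intro l)
    then show ?thesis by simp
  qed
  also have "\<dots> = (\<Sum>b\<in>B. QR (\<lambda>q1 q2. D c (\<lambda>c1 c2.
     Db (T q1 \<cdot> (a \<cdot> S (c1 \<cdot> (be \<cdot> (S c2 \<cdot> S (q2 \<cdot> b)))))) (\<lambda>x z. dual b x * \<psi> z))))"
    by (simp add: PR_sums QR_sums sum2_sum)
  also have "\<dots> = eps c * E \<psi> a"
  proof -
    have "D c (\<lambda>c1 c2. Db (T q1 \<cdot> (a \<cdot> S (c1 \<cdot> (be \<cdot> (S c2 \<cdot> S (q2 \<cdot> b)))))) (\<lambda>x z. dual b x * \<psi> z)) =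
      eps c * Db (T q1 \<cdot> (a \<cdot> S (be \<cdot> S (q2 \<cdot> b)))) (\<lambda>x z. dual b x * \<psi> z)" for q1 q2 b
      using antipode_be[of "\<lambda>w. Db (T q1 \<cdot> (a \<cdot> S (w \<cdot> S (q2 \<cdot> b)))) (\<lambda>x z. dual b x * \<psi> z)" c] by (simp add: l)
    then show ?thesis
      by (simp only: E_def functional_cmult sum_distrib_left)
  qed
  finally show ?thesis .
qed

text \<open>\<open>Db_left\<close> and cyclicity distribute the coproducts of a around
  \<open>q\<^sub>R\<close> exactly as in \<open>QR_cov\<close>, which reassembles them into
  a.\<close>

lemma E_left:
  assumes \<psi>: "lin \<psi>"
  shows "D a (\<lambda>a1 a2. E (\<lambda>z. \<psi> (T a1 \<cdot> z)) (y \<cdot> S a2)) = E \<psi> (T a \<cdot> y)"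
proof -
  note l = mlin lin_comp[OF \<psi>] lin_dual lin_Db_arg lin_QR
  have b: "bilin (\<lambda>x z. dual b x * \<psi> z)" for b by (intro l)
  have "E (\<lambda>z. \<psi> (T a1 \<cdot> z)) (y \<cdot> S a2) = D a1 (\<lambda>u v. (\<Sum>b\<in>B. QR (\<lambda>q1 q2.
     Db (T (q1 \<cdot> u) \<cdot> (y \<cdot> S (be \<cdot> S (T a2 \<cdot> (q2 \<cdot> (v \<cdot> b)))))) (\<lambda>x z. dual b x * \<psi> z))))" for a1 a2
  proof -
    have "E (\<lambda>z. \<psi> (T a1 \<cdot> z)) (y \<cdot> S a2) = D a1 (\<lambda>u v. (\<Sum>b\<in>B. QR (\<lambda>q1 q2.
     Db (T (q1 \<cdot> u) \<cdot> (y \<cdot> S (be \<cdot> S (T a2 \<cdot> (q2 \<cdot> b))))) (\<lambda>x z. dual b (v \<cdot> x) * \<psi> z))))"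
      using Db_left[OF b] by (simp add: E_def PR_sums QR_sums sum2_sum)
    moreover have "(\<Sum>b\<in>B. QR (\<lambda>q1 q2. Db (T (q1 \<cdot> u) \<cdot> (y \<cdot> S (be \<cdot> S (T a2 \<cdot> (q2 \<cdot> b))))) (\<lambda>x z. dual b (v \<cdot> x) * \<psi> z))) =
       (\<Sum>b\<in>B. QR (\<lambda>q1 q2. Db (T (q1 \<cdot> u) \<cdot> (y \<cdot> S (be \<cdot> S (T a2 \<cdot> (q2 \<cdot> (v \<cdot> b)))))) (\<lambda>x z. dual b x * \<psi> z)))" for u v
      by (rule trace_swap[where N="\<lambda>b \<xi>. QR (\<lambda>q1 q2. Db (T (q1 \<cdot> u) \<cdot> (y \<cdot> S (be \<cdot> S (T a2 \<cdot> (q2 \<cdot> b))))) (\<lambda>x z. \<xi> x * \<psi> z))"])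
        (intro l, simp add: Db_dual_lincomb functional_lincomb functional_cmult, intro l)
    ultimately show ?thesis by simp
  qed
  then have "D a (\<lambda>a1 a2. E (\<lambda>z. \<psi> (T a1 \<cdot> z)) (y \<cdot> S a2)) = (\<Sum>b\<in>B. D a (\<lambda>a1 a2. D a1 (\<lambda>u v. QR (\<lambda>q1 q2.
     Db (T (q1 \<cdot> u) \<cdot> (y \<cdot> S (be \<cdot> S (T a2 \<cdot> (q2 \<cdot> (v \<cdot> b)))))) (\<lambda>x z. dual b x * \<psi> z)))))"
    by (simp only: sum2_sum)
  also have "\<dots> = E \<psi> (T a \<cdot> y)"
  proof -
    have "bilin (\<lambda>m n. Db (T m \<cdot> (y \<cdot> S (be \<cdot> S (n \<cdot> b)))) (\<lambda>x z. dual b x * \<psi> z))" for b by (intro l)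
    from QR_cov[OF this, of a] show ?thesis by (simp add: E_def)
  qed
  finally show ?thesis .
qed

text \<open>The coinvariance of \<open>E \<psi>\<close>, evaluated at elements \<open>r\<close> with \<open>r S(c) = \<epsilon>(c) r\<close>.\<close>

lemma Db_E:
  assumes \<psi>: "lin \<psi>" and \<xi>: "lin \<xi>" and r: "\<And>c. r \<cdot> S c = scale (eps c) r"
  shows "Db r (\<lambda>x z. \<xi> x * E \<psi> z) = \<psi> r * \<xi> one"
proof -
  note l = mlin lin_comp[OF \<psi>] lin_comp[OF \<xi>] lin_dual lin_Db_arg lin_Db lin_QR lin_PR
  have r_scale: "f (r \<cdot> S c) = eps c * f r" if "lin f" for f c
    using that by (simp add: r lin_def)
  have b1: "bilin (\<lambda>x z. \<xi> x * Db z (\<lambda>x' z'. dual b x' * \<psi> z'))" for b by (intro l)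
  \<comment> \<open>Both outer factors of the argument are carried to the first leg. On the right
    only c remains of \<Delta>(c), because r S(c1) = \<epsilon>(c1) r.\<close>
  have cov: "Db r (\<lambda>x z. \<xi> x * Db (T a \<cdot> (z \<cdot> S c)) (\<lambda>x' z'. dual b x' * \<psi> z')) =
    D a (\<lambda>a1 a2. Db (T a1 \<cdot> r) (\<lambda>x z. \<xi> (a2 \<cdot> (x \<cdot> c)) * Db z (\<lambda>x' z'. dual b x' * \<psi> z')))" for a b c
  proof -
    have b2: "bilin (\<lambda>x z. \<xi> x * Db (z \<cdot> S c) (\<lambda>x' z'. dual b x' * \<psi> z'))" by (intro l)
    have b3: "bilin (\<lambda>x z. \<xi> (a2 \<cdot> x) * Db z (\<lambda>x' z'. dual b x' * \<psi> z'))" for a2 by (intro l)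
    have l4: "lin (\<lambda>w. Db (T a1 \<cdot> w) (\<lambda>x z. \<xi> (a2 \<cdot> (x \<cdot> c2)) * Db z (\<lambda>x' z'. dual b x' * \<psi> z')))" for a1 a2 c2 by (intro l)
    have "D c (\<lambda>c1 c2. eps c1 * Db (T a1 \<cdot> r) (\<lambda>x z. \<xi> (a2 \<cdot> (x \<cdot> c2)) * Db z (\<lambda>x' z'. dual b x' * \<psi> z'))) =
      Db (T a1 \<cdot> r) (\<lambda>x z. \<xi> (a2 \<cdot> (x \<cdot> c)) * Db z (\<lambda>x' z'. dual b x' * \<psi> z'))" for a1 a2
      by (intro counit_l l)
    then show ?thesis
      using Db_left[OF b2, of r a] Db_right[OF b3, where y = "T a1 \<cdot> r" and c = c for a1] r_scale[OF l4] by simp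
  qed
  have "Db r (\<lambda>x z. \<xi> x * E \<psi> z) = (\<Sum>b\<in>B. QR (\<lambda>q1 q2. D q1 (\<lambda>u v.
     Db (T u \<cdot> r) (\<lambda>x z. \<xi> (v \<cdot> (x \<cdot> (be \<cdot> S (q2 \<cdot> b)))) * Db z (\<lambda>x' z'. dual b x' * \<psi> z')))))"
    by (simp only: E_def sum_distrib_left functional_lincomb functional_cmult(2)[symmetric] Db_QR cov)
  also have "\<dots> = QR (\<lambda>q1 q2. D q1 (\<lambda>u v. Db (T u \<cdot> r) (\<lambda>x z. Db z (\<lambda>x' z'. \<xi> (v \<cdot> (x \<cdot> (be \<cdot> S (q2 \<cdot> x')))) * \<psi> z'))))"
  proof -
    \<comment> \<open>Summation over the dual basis substitutes x' for b.\<close>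
    have 1: "(\<Sum>b\<in>B. \<xi> (v \<cdot> (x \<cdot> (be \<cdot> S (q2 \<cdot> b)))) * (dual b x' * p)) = \<xi> (v \<cdot> (x \<cdot> (be \<cdot> S (q2 \<cdot> x')))) * p" for v x q2 x' p
      using lin_expand[of "\<lambda>x'. \<xi> (v \<cdot> (x \<cdot> (be \<cdot> S (q2 \<cdot> x'))))" x']
      by (simp add: l sum_distrib_right mult.assoc mult.left_commute)
    show ?thesis
      unfolding functional_cmult[symmetric] functional_lincomb[symmetric] sum2_sum[symmetric] 1 by (rule refl)
  qed
  also have "\<dots> = QR (\<lambda>q1 q2. D q1 (\<lambda>u v. PR (\<lambda>p1 p2. \<xi> (v \<cdot> (p2 \<cdot> S q2)) * \<psi> (T (u \<cdot> p1) \<cdot> r))))"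
  proof -
    \<comment> \<open>In \<open>Db_Db\<close> the relation r S(X) = \<epsilon>(X) r lets
      \<open>counit_phi_left\<close> delete \<phi>; \<beta> collapses the coproduct of the first
      leg, and the surviving \<phi>\<inverse> takes the shape of \<open>p\<^sub>R\<close>.\<close>
    have "Db (T u \<cdot> r) (\<lambda>x z. Db z (\<lambda>x' z'. \<xi> (v \<cdot> (x \<cdot> (be \<cdot> S (q2 \<cdot> x')))) * \<psi> z')) =
      PR (\<lambda>p1 p2. \<xi> (v \<cdot> (p2 \<cdot> S q2)) * \<psi> (T (u \<cdot> p1) \<cdot> r))" for u v q2
    proof -
      have t: "trilin (\<lambda>x x' z'. \<xi> (v \<cdot> (x \<cdot> (be \<cdot> (S x' \<cdot> S q2)))) * \<psi> z')" by (intro l)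
      have d: "D s (\<lambda>e f. \<xi> (v \<cdot> (y \<cdot> (e \<cdot> (be \<cdot> (S f \<cdot> w))))) * p) = eps s * \<xi> (v \<cdot> (y \<cdot> (be \<cdot> w))) * p" for s y w p
        using antipode_be[of "\<lambda>m. \<xi> (v \<cdot> (y \<cdot> (m \<cdot> w)))" s] by (simp add: l sum23_scalar)
      have l4: "lin (\<lambda>w. Db (T x \<cdot> (T u \<cdot> w)) (\<lambda>s t. D s (\<lambda>e f. \<xi> (v \<cdot> (y \<cdot> (e \<cdot> (Y \<cdot> (be \<cdot> (S Z \<cdot> (S f \<cdot> (S z \<cdot> S q2)))))))) * \<psi> t)))"
        for x y z Y Z by (intro l)
      have l5: "bilin (\<lambda>Y Z. Db (T x \<cdot> (T u \<cdot> r)) (\<lambda>s t. D s (\<lambda>e f. \<xi> (v \<cdot> (y \<cdot> (e \<cdot> (Y \<cdot> (be \<cdot> (S Z \<cdot> (S f \<cdot> (S z \<cdot> S q2)))))))) * \<psi> t)))"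
        for x y z by (intro l)
      have l6: "lin (\<lambda>t. \<xi> a * \<psi> t)" for a by (intro l)
      have e: "Db w (\<lambda>s t. eps s * \<xi> a * \<psi> t) = \<xi> a * \<psi> w" for w a
        using Db_eps[OF l6, of w a] by (simp add: mult.assoc)
      show ?thesis
        using counit_phi_left[OF l5] by (simp add: Db_Db[OF t] r_scale[OF l4] d e PR_def)
    qed
    then show ?thesis by simp
  qed
  also have "\<dots> = \<psi> r * \<xi> one"
  proof -
    have "bilin (\<lambda>m n. \<xi> n * \<psi> (T m \<cdot> r))" by (intro l)
    from QR_PR[OF this] show ?thesis by (simp add: mult.commute)
  qed
  finally show ?thesis .
qed

text \<open>S(q2) = S(Y) \<alpha> Z, so this is \<phi> \<phi>\<inverse> = 1 with its last two legs
  contracted by b \<otimes> c \<mapsto> S(b) \<alpha> c.\<close>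

lemma QR_Psi:
  assumes G: "bilin G"
  shows "QR (\<lambda>q1 q2. Psi (\<lambda>x y z. G (q1 \<cdot> x) (S (q2 \<cdot> y) \<cdot> z))) = G one al"
proof -
  have "trilin (\<lambda>a b c. G a (S b \<cdot> (al \<cdot> c)))" by (intro mlin bilin_comp[OF G])
  from phi_psi[OF this] show ?thesis by (simp add: QR_def)
qed

text \<open>The pairing of \<open>dual b\<close> and \<open>dual c\<close> with \<Delta>(s) is
  linear in s and is expanded in the dual basis with coefficients \<open>w\<close>. Summing over b
  and c then restores \<Delta>(d), so one dual basis replaces two.\<close>

lemma Db_dual_contraction:
  assumes A: "\<And>d. bilin (\<lambda>b c. Db (A b c) (\<lambda>s t. dual d s * \<psi> t))"
  shows "(\<Sum>b\<in>B. \<Sum>c\<in>B. Db (A b c) (\<lambda>s t. D s (\<lambda>e f. dual b e * dual c f) * \<psi> t)) =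
    (\<Sum>d\<in>B. D d (\<lambda>e f. Db (A e f) (\<lambda>s t. dual d s * \<psi> t)))"
proof -
  define G where "G d b c = Db (A b c) (\<lambda>s t. dual d s * \<psi> t)" for d b c
  define w where "w d b c = D d (\<lambda>e f. dual b e * dual c f)" for d b c
  have "lin (\<lambda>s. w s b c)" for b c unfolding w_def by (intro mlin)
  then have w: "w s b c = (\<Sum>d\<in>B. w d b c * dual d s)" for s b c
    by (subst lin_expand[of "\<lambda>s. w s b c" s]) (simp_all only: mult.commute)
  have "Db (A b c) (\<lambda>s t. w s b c * \<psi> t) = (\<Sum>d\<in>B. w d b c * G d b c)" for b c
    unfolding G_def Db_dual_lincomb[symmetric] w[symmetric] ..
  then have "(\<Sum>b\<in>B. \<Sum>c\<in>B. Db (A b c) (\<lambda>s t. w s b c * \<psi> t)) = (\<Sum>b\<in>B. \<Sum>c\<in>B. \<Sum>d\<in>B. w d b c * G d b c)"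
    by simp
  also have "\<dots> = (\<Sum>b\<in>B. \<Sum>d\<in>B. \<Sum>c\<in>B. w d b c * G d b c)"
    by (rule sum.cong[OF refl], rule sum.swap)
  also have "\<dots> = (\<Sum>d\<in>B. \<Sum>b\<in>B. \<Sum>c\<in>B. w d b c * G d b c)"
    by (rule sum.swap)
  also have "\<dots> = (\<Sum>d\<in>B. D d (G d))"
  proof -
    have "bilin (G d)" for d
      using A by (simp add: G_def[abs_def])
    then have "G d = (\<lambda>e f. \<Sum>b\<in>B. \<Sum>c\<in>B. dual b e * dual c f * G d b c)" for d
      by (intro ext bilin_expand)
    then have "D d (G d) = D d (\<lambda>e f. \<Sum>b\<in>B. \<Sum>c\<in>B. dual b e * dual c f * G d b c)" for d
      by (rule arg_cong)
    then show ?thesis by (simp only: sum2_sum w_def sum2_multc)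
  qed
  finally show ?thesis by (simp add: G_def[abs_def] w_def)
qed

text \<open>The coaction is encoded by the forms z \<mapsto> (dual c \<otimes> \<psi>) of the
  twisted comultiplication, paired with c. \<open>Db_Db\<close> makes the iteration explicit, the
  dual bases merge, \<open>QR_Psi\<close> produces an \<alpha>, and the antipode relations remove
  everything else.\<close>

lemma E_coaction:
  assumes \<psi>: "lin \<psi>"
  shows "(\<Sum>c\<in>B. E (\<lambda>z. Db z (\<lambda>u v. dual c u * \<psi> v)) (y \<cdot> S c)) = \<psi> y"
proof -
  note l = mlin lin_comp[OF \<psi>] lin_dual lin_Db_arg lin_Db lin_QR lin_PR lin_sum
  have 1: "E (\<lambda>z. Db z (\<lambda>u v. dual c u * \<psi> v)) (y \<cdot> S c) =
    (\<Sum>b\<in>B. QR (\<lambda>q1 q2. Psi (\<lambda>x y' z. Phi (\<lambda>X Y Z.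
      Db (T (q1 \<cdot> x) \<cdot> (y \<cdot> S (X \<cdot> (be \<cdot> (S (q2 \<cdot> b) \<cdot> c)))))
        (\<lambda>s t. D s (\<lambda>e f. dual b (y' \<cdot> (e \<cdot> Y)) * dual c (z \<cdot> (f \<cdot> Z))) * \<psi> t)))))" for c
  proof -
    have t: "trilin (\<lambda>x x' z'. dual b x * dual c x' * \<psi> z')" for b by (intro l)
    show ?thesis
      using Db_Db[OF t] by (simp add: E_def functional_cmult[symmetric] mult.assoc[symmetric] sum23_scalar)
  qed
  have 2: "(\<Sum>c\<in>B. \<Sum>b\<in>B. Db (T (q1 \<cdot> x) \<cdot> (y \<cdot> S (X \<cdot> (be \<cdot> (S (q2 \<cdot> b) \<cdot> c)))))
        (\<lambda>s t. D s (\<lambda>e f. dual b (y' \<cdot> (e \<cdot> Y)) * dual c (z \<cdot> (f \<cdot> Z))) * \<psi> t)) =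
     (\<Sum>d\<in>B. D d (\<lambda>e f. Db (T (q1 \<cdot> x) \<cdot> (y \<cdot> S (X \<cdot> (be \<cdot> (S Y \<cdot> (S e \<cdot> ((S (q2 \<cdot> y') \<cdot> z) \<cdot> (f \<cdot> Z))))))))
        (\<lambda>s t. dual d s * \<psi> t)))" for q1 x X q2 y' Y z Z
  proof -
    let ?a = "\<lambda>b c. T (q1 \<cdot> x) \<cdot> (y \<cdot> S (X \<cdot> (be \<cdot> (S (q2 \<cdot> b) \<cdot> c))))"
    have N_sum: "Db w (\<lambda>s t. D s (\<lambda>e f. g e * (\<Sum>i\<in>B. k i * dual i f)) * \<psi> t) = (\<Sum>i\<in>B. k i * Db w (\<lambda>s t. D s (\<lambda>e f. g e * dual i f) * \<psi> t))"
      "Db w (\<lambda>s t. D s (\<lambda>e f. (\<Sum>i\<in>B. k i * dual i e) * g f) * \<psi> t) = (\<Sum>i\<in>B. k i * Db w (\<lambda>s t. D s (\<lambda>e f. dual i e * g f) * \<psi> t))" for w g k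
      by (simp_all only: sum_distrib_left sum_distrib_right mult.assoc mult.left_commute[of "g _"] sum2_sum sum2_cmult functional_lincomb functional_cmult)
    have "(\<Sum>c\<in>B. \<Sum>b\<in>B. Db (?a b c) (\<lambda>s t. D s (\<lambda>e f. dual b (y' \<cdot> (e \<cdot> Y)) * dual c (z \<cdot> (f \<cdot> Z))) * \<psi> t)) =
      (\<Sum>b\<in>B. \<Sum>c\<in>B. Db (?a b c) (\<lambda>s t. D s (\<lambda>e f. dual b (y' \<cdot> (e \<cdot> Y)) * dual c (z \<cdot> (f \<cdot> Z))) * \<psi> t))"
      by (rule sum.swap)
    \<comment> \<open>Cyclicity in both summation variables moves z, Z and then y', Y from the dual
      basis to the arguments.\<close>
    also have "\<dots> = (\<Sum>b\<in>B. \<Sum>c\<in>B. Db (?a b (z \<cdot> (c \<cdot> Z))) (\<lambda>s t. D s (\<lambda>e f. dual b (y' \<cdot> (e \<cdot> Y)) * dual c f) * \<psi> t))"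
      by (rule sum.cong[OF refl], rule trace_swap[where N="\<lambda>c \<xi>. Db (?a _ c) (\<lambda>s t. D s (\<lambda>e f. dual _ (y' \<cdot> (e \<cdot> Y)) * \<xi> f) * \<psi> t)"])
        (intro l, rule N_sum, intro l)
    also have "\<dots> = (\<Sum>c\<in>B. \<Sum>b\<in>B. Db (?a b (z \<cdot> (c \<cdot> Z))) (\<lambda>s t. D s (\<lambda>e f. dual b (y' \<cdot> (e \<cdot> Y)) * dual c f) * \<psi> t))"
      by (rule sum.swap)
    also have "\<dots> = (\<Sum>c\<in>B. \<Sum>b\<in>B. Db (?a (y' \<cdot> (b \<cdot> Y)) (z \<cdot> (c \<cdot> Z))) (\<lambda>s t. D s (\<lambda>e f. dual b e * dual c f) * \<psi> t))"
      by (rule sum.cong[OF refl], rule trace_swap[where N="\<lambda>b \<xi>. Db (?a b (z \<cdot> (_ \<cdot> Z))) (\<lambda>s t. D s (\<lambda>e f. \<xi> e * dual _ f) * \<psi> t)"])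
        (intro l, rule N_sum, intro l)
    also have "\<dots> = (\<Sum>b\<in>B. \<Sum>c\<in>B. Db (?a (y' \<cdot> (b \<cdot> Y)) (z \<cdot> (c \<cdot> Z))) (\<lambda>s t. D s (\<lambda>e f. dual b e * dual c f) * \<psi> t))"
      by (rule sum.swap)
    also have "\<dots> = (\<Sum>d\<in>B. D d (\<lambda>e f. Db (?a (y' \<cdot> (e \<cdot> Y)) (z \<cdot> (f \<cdot> Z))) (\<lambda>s t. dual d s * \<psi> t)))"
      by (rule Db_dual_contraction) (intro l)
    finally show ?thesis by simp
  qed
  have "(\<Sum>c\<in>B. E (\<lambda>z. Db z (\<lambda>u v. dual c u * \<psi> v)) (y \<cdot> S c)) =
    QR (\<lambda>q1 q2. Psi (\<lambda>x y' z. Phi (\<lambda>X Y Z. \<Sum>d\<in>B. D d (\<lambda>e f.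
     Db (T (q1 \<cdot> x) \<cdot> (y \<cdot> S (X \<cdot> (be \<cdot> (S Y \<cdot> (S e \<cdot> ((S (q2 \<cdot> y') \<cdot> z) \<cdot> (f \<cdot> Z)))))))) (\<lambda>s t. dual d s * \<psi> t)))))"
    by (simp only: 1 functional_lincomb(2)[symmetric] sum3_sum[symmetric] 2)
  also have "\<dots> = Phi (\<lambda>X Y Z. \<Sum>d\<in>B. D d (\<lambda>e f.
     Db (y \<cdot> S (X \<cdot> (be \<cdot> (S Y \<cdot> (S e \<cdot> (al \<cdot> (f \<cdot> Z))))))) (\<lambda>s t. dual d s * \<psi> t)))"
  proof -
    have "bilin (\<lambda>m n. Phi (\<lambda>X Y Z. \<Sum>d\<in>B. D d (\<lambda>e f.
     Db (T m \<cdot> (y \<cdot> S (X \<cdot> (be \<cdot> (S Y \<cdot> (S e \<cdot> (n \<cdot> (f \<cdot> Z)))))))) (\<lambda>s t. dual d s * \<psi> t))))" by (intro l)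
    from QR_Psi[OF this] show ?thesis by simp
  qed
  also have "\<dots> = Phi (\<lambda>X Y Z. \<psi> (y \<cdot> S (X \<cdot> (be \<cdot> (S Y \<cdot> (al \<cdot> Z))))))"
  proof -
    have "D d (\<lambda>e f. Db (y \<cdot> S (X \<cdot> (be \<cdot> (S Y \<cdot> (S e \<cdot> (al \<cdot> (f \<cdot> Z))))))) (\<lambda>s t. dual d s * \<psi> t)) =
      eps d * Db (y \<cdot> S (X \<cdot> (be \<cdot> (S Y \<cdot> (al \<cdot> Z))))) (\<lambda>s t. dual d s * \<psi> t)" for d X Y Z
      using antipode_al[of "\<lambda>w. Db (y \<cdot> S (X \<cdot> (be \<cdot> (S Y \<cdot> (w \<cdot> Z))))) (\<lambda>s t. dual d s * \<psi> t)" d] by (simp add: l)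
    \<comment> \<open>\<epsilon> is the combination of the dual basis with coefficients
      \<epsilon>(d), so \<open>Db_eps\<close> applies.\<close>
    moreover have "(\<Sum>d\<in>B. eps d * Db w (\<lambda>s t. dual d s * \<psi> t)) = \<psi> w" for w
    proof -
      have "(\<Sum>d\<in>B. eps d * dual d s) = eps s" for s
        unfolding lin_expand[OF eps_lin, of s] by (simp only: mult.commute)
      then show ?thesis
        unfolding Db_dual_lincomb[symmetric] by (simp add: Db_eps[OF \<psi>])
    qed
    ultimately show ?thesis by simp
  qed
  also have "\<dots> = \<psi> y"
  proof -
    have "lin (\<lambda>w. \<psi> (y \<cdot> S w))" by (intro l)
    from antipode_phi[OF this] show ?thesis by simp
  qed
  finally show ?thesis .
qed

lemma lin_E_fun: "lin (E \<psi>)"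
  using lin_E[OF endo_id] by simp

text \<open>The transpose of \<open>E\<close>, an endomorphism of H by finite dimension. It turns
  the invariance of forms in \<open>E_right\<close> into the relation for elements that
  \<open>Db_E\<close> requires.\<close>

definition P where "P a = (\<Sum>b\<in>B. scale (E (dual b) a) b)"

lemma P_E:
  assumes \<psi>: "lin \<psi>"
  shows "\<psi> (P a) = E \<psi> a"
proof -
  have "\<psi> = (\<lambda>x. \<Sum>b\<in>B. \<psi> b * dual b x)"
    by (rule ext, subst lin_expand[OF \<psi>], simp only: mult.commute)
  then have "E \<psi> a = E (\<lambda>x. \<Sum>b\<in>B. \<psi> b * dual b x) a"
    by (rule arg_cong)
  also have "\<dots> = \<psi> (P a)"
    by (simp only: E_lincomb P_def lin_sum_scale[OF \<psi>] mult.commute)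
  finally show ?thesis ..
qed

lemma P_S: "P a \<cdot> S c = scale (eps c) (P a)"
proof (rule lin_ext)
  fix f assume f: "lin f"
  have "lin (\<lambda>x. f (x \<cdot> S c))" by (intro lin_comp[OF f] mlin)
  from P_E[OF this] show "f (P a \<cdot> S c) = f (scale (eps c) (P a))"
    using f by (simp add: E_right P_E lin_def)
qed

text \<open>In \<open>Db_E\<close> take \<xi> = \<epsilon> and r = P a; the counit deletes the first
  leg and leaves E \<psi> (P a) = \<psi> (P a).\<close>

lemma E_E:
  assumes \<psi>: "lin \<psi>"
  shows "E (E \<psi>) = E \<psi>"
proof
  fix a
  have "E (E \<psi>) a = E \<psi> (P a)"
    by (rule P_E[OF lin_E_fun, symmetric])
  also have "\<dots> = \<psi> (P a)"
    using Db_E[OF \<psi> eps_lin P_S, of a] by (simp add: Db_eps[OF lin_E_fun])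
  finally show "E (E \<psi>) a = E \<psi> a" by (simp add: P_E[OF \<psi>])
qed

section \<open>Existence, nondegeneracy and uniqueness of cointegrals\<close>

definition cointegral where "cointegral l \<longleftrightarrow> lin l \<and> E l = l"

lemma cointegral_E: "lin \<psi> \<Longrightarrow> cointegral (E \<psi>)"
  by (simp add: cointegral_def lin_E_fun E_E)

text \<open>If E were zero, \<open>E_coaction\<close> for \<psi> = \<epsilon> at the unit would read
  0 = 1.\<close>

lemma exists_cointegral: "\<exists>l. cointegral l \<and> l \<noteq> (\<lambda>_. 0)"
proof (rule ccontr)
  assume "\<not> ?thesis"
  then have "E \<psi> = (\<lambda>_. 0)" if "lin \<psi>" for \<psi>
    using cointegral_E[OF that] by blast
  moreover have "lin (\<lambda>z. Db z (\<lambda>u v. dual c u * eps v))" for c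
    by (intro lin_Db_arg mlin)
  ultimately have "(\<Sum>c\<in>B. E (\<lambda>z. Db z (\<lambda>u v. dual c u * eps v)) (one \<cdot> S c)) = 0"
    by simp
  then show False
    using E_coaction[OF eps_lin, of one] by simp
qed

text \<open>\<open>Db_right\<close> moves S(a) into the argument and the first leg; P x absorbs the
  former by \<open>P_S\<close>, so the whole of a ends in \<xi> and \<open>Db_E\<close>
  applies.\<close>

lemma cointegral_coinvariant:
  assumes l: "cointegral l" and \<xi>: "lin \<xi>"
  shows "Db (P x) (\<lambda>s t. \<xi> s * l (t \<cdot> S a)) = l x * \<xi> a"
proof -
  have l1: "lin l" and l2: "E l = l"
    using l by (auto simp: cointegral_def)
  have b: "bilin (\<lambda>s t. \<xi> s * l t)" and \<xi>a: "lin (\<lambda>s. \<xi> (s \<cdot> a))"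
    by (intro mlin lin_comp[OF l1] lin_comp[OF \<xi>])+
  have "lin (\<lambda>w. Db w (\<lambda>s t. \<xi> (s \<cdot> a2) * l t))" for a2 by (intro lin_Db_arg mlin)
  then have "Db (P x \<cdot> S a1) (\<lambda>s t. \<xi> (s \<cdot> a2) * l t) = eps a1 * Db (P x) (\<lambda>s t. \<xi> (s \<cdot> a2) * l t)" for a1 a2
    by (simp add: P_S lin_def)
  then have "Db (P x) (\<lambda>s t. \<xi> s * l (t \<cdot> S a)) = D a (\<lambda>a1 a2. eps a1 * Db (P x) (\<lambda>s t. \<xi> (s \<cdot> a2) * l t))"
    using Db_right[OF b, of "P x" a] by simp
  also have "\<dots> = Db (P x) (\<lambda>s t. \<xi> (s \<cdot> a) * l t)"
    by (intro counit_l lin_Db mlin lin_comp[OF \<xi>])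
  also have "\<dots> = l x * \<xi> a"
    using Db_E[OF l1 \<xi>a P_S, of x] by (simp add: l2 P_E[OF l1])
  finally show ?thesis .
qed

text \<open>For x with l x \<noteq> 0, \<open>cointegral_coinvariant\<close> recovers every \<xi>(a)
  from the values l(t S(a)).\<close>

lemma cointegral_nondegenerate:
  assumes l: "cointegral l" "l \<noteq> (\<lambda>_. 0)" and a: "\<And>y. l (y \<cdot> S a) = 0"
  shows "a = 0"
proof -
  obtain x where x: "l x \<noteq> 0" using l by auto
  show ?thesis
  proof (rule lin_ext)
    fix f assume f: "lin f"
    have "Db (P x) (\<lambda>s t. f s * l (t \<cdot> S a)) = 0"
      by (simp add: a) (simp add: Db_def VR_def QR_def UR_def PR_def sum2_def sum3_def)
    then have "f a = 0"
      using cointegral_coinvariant[OF l(1) f, of x a] x by simp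
    moreover have "f 0 = 0"
      using lin_sum_scale[OF f, of "\<lambda>_. 0" "\<lambda>_. 0" "{}"] by simp
    ultimately show "f a = f 0" by simp
  qed
qed

lemma linear_endo: "endo g \<Longrightarrow> Vector_Spaces.linear scale scale g"
  using vector_space_axioms
  by (intro Vector_Spaces.linear.intro module_hom.intro module_hom_axioms.intro)
    (auto simp: endo_def module_iff_vector_space vector_space_def)

lemma cointegral_generates:
  assumes l: "cointegral l" "l \<noteq> (\<lambda>_. 0)" and \<chi>: "lin \<chi>"
  shows "\<exists>a. \<forall>y. \<chi> y = l (y \<cdot> S a)"
proof -
  have l1: "lin l" using l(1) by (simp add: cointegral_def)
  \<comment> \<open>The form b \<mapsto> l(b S(a)) is stored as the vector of its values on
    \<open>B\<close>; thus the map to the dual becomes an endomorphism of H, for which injective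
    implies surjective.\<close>
  define g where "g a = (\<Sum>b\<in>B. scale (l (b \<cdot> S a)) b)" for a
  have dual_g: "dual c (g a) = l (c \<cdot> S a)" if "c \<in> B" for a c
  proof -
    have "dual c b = (if b = c then 1 else 0)" if "b \<in> B" for b
      unfolding dual_def using representation_basis[OF independent_Basis that] by simp
    then have "dual c (g a) = (\<Sum>b\<in>B. l (b \<cdot> S a) * (if b = c then 1 else 0))"
      unfolding g_def lin_sum_scale[OF lin_dual[OF endo_id, simplified]] by simp
    also have "\<dots> = (\<Sum>b\<in>B. if b = c then l (b \<cdot> S a) else 0)"
      by (rule sum.cong) auto
    finally show ?thesis using that finite_Basis by simp
  qed
  have "endo g"
  proof -
    have "lin (\<lambda>a. l (b \<cdot> S a))" for b by (intro lin_comp[OF l1] mlin)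
    then show ?thesis
      by (simp add: endo_def g_def lin_def scale_left_distrib sum.distrib scale_sum_right)
  qed
  have expand: "\<chi> y = l (y \<cdot> S a)" if "\<And>b. b \<in> B \<Longrightarrow> \<chi> b = l (b \<cdot> S a)" "lin \<chi>" for \<chi> y a
  proof -
    have "lin (\<lambda>y. l (y \<cdot> S a))" by (intro lin_comp[OF l1] mlin)
    then show ?thesis
      using that lin_expand[OF \<open>lin \<chi>\<close>, of y] lin_expand[of "\<lambda>y. l (y \<cdot> S a)" y] by simp
  qed
  have "inj g"
  proof (rule injI)
    fix a a' assume eq: "g a = g a'"
    have "l (y \<cdot> S (a - a')) = 0" for y
    proof -
      have L: "lin (\<lambda>a. l (y \<cdot> S a))" and L': "lin (\<lambda>y. l (y \<cdot> S a))" for a y by (intro lin_comp[OF l1] mlin)+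
      have "l (b \<cdot> S a) = l (b \<cdot> S a')" if "b \<in> B" for b
        using dual_g[OF that] eq by metis
      then have "l (y \<cdot> S a) = l (y \<cdot> S a')"
        using expand[of "\<lambda>y. l (y \<cdot> S a)" a' y] L' by blast
      moreover have "l (y \<cdot> S (a - a')) + l (y \<cdot> S a') = l (y \<cdot> S a)"
        using L unfolding lin_def by (metis diff_add_cancel)
      ultimately show ?thesis by simp
    qed
    then have "a - a' = 0" by (rule cointegral_nondegenerate[OF l])
    then show "a = a'" by simp
  qed
  then have "surj g"
    by (intro linear_inj_imp_surj linear_endo \<open>endo g\<close>)
  then obtain a where a: "g a = (\<Sum>b\<in>B. scale (\<chi> b) b)"
    by (metis surjD)
  then have "\<chi> b = l (b \<cdot> S a)" if "b \<in> B" for b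
  proof -
    have "dual b (\<Sum>c\<in>B. scale (\<chi> c) c) = \<chi> b"
    proof -
      have "dual b c = (if c = b then 1 else 0)" if "c \<in> B" for c
        unfolding dual_def using representation_basis[OF independent_Basis that] by simp
      then have "dual b (\<Sum>c\<in>B. scale (\<chi> c) c) = (\<Sum>c\<in>B. \<chi> c * (if c = b then 1 else 0))"
        unfolding lin_sum_scale[OF lin_dual[OF endo_id, simplified]] by simp
      also have "\<dots> = (\<Sum>c\<in>B. if c = b then \<chi> c else 0)"
        by (rule sum.cong) auto
      finally show ?thesis using that finite_Basis by simp
    qed
    then show ?thesis using dual_g[OF that, of a] a by simp
  qed
  then show ?thesis using expand \<chi> by blast
qed

text \<open>Write l' as l(y S(a)) and compare the coinvariance of l' with that of l for \<xi> =
  \<epsilon>; the factor is \<epsilon>(a).\<close>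

lemma cointegral_unique:
  assumes l: "cointegral l" "l \<noteq> (\<lambda>_. 0)" and l': "cointegral l'"
  shows "\<exists>c. l' = (\<lambda>x. c * l x)"
proof -
  have l'1: "lin l'" using l' by (simp add: cointegral_def)
  obtain a where a: "l' y = l (y \<cdot> S a)" for y
    using cointegral_generates[OF l l'1] by auto
  have "l' x = eps a * l x" for x
    using cointegral_coinvariant[OF l' eps_lin, of x one] cointegral_coinvariant[OF l(1) eps_lin, of x a]
    by (simp add: a mult.commute)
  then show ?thesis by blast
qed

text \<open>This makes a \<mapsto> E(l(S\<inverse>(a) _)) an action on cointegrals. Expand the inner
  E by \<open>E_left\<close>; the outer E then sees S(a2) only through \<epsilon>(a2).\<close>

lemma E_left_E:
  assumes \<psi>: "lin \<psi>"
  shows "E (\<lambda>z. E \<psi> (T a \<cdot> z)) = E (\<lambda>z. \<psi> (T a \<cdot> z))"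
proof
  fix y
  have lT: "lin (\<lambda>z. \<psi> (T a1 \<cdot> z))" for a1 by (intro lin_comp[OF \<psi>] mlin)
  have "E (\<lambda>z. E \<psi> (T a \<cdot> z)) y = D a (\<lambda>a1 a2. E (\<lambda>z. E (\<lambda>z. \<psi> (T a1 \<cdot> z)) (z \<cdot> S a2)) y)"
    unfolding E_left[OF \<psi>, symmetric] by (rule E_sum2)
  also have "\<dots> = D a (\<lambda>a1 a2. eps a2 * E (\<lambda>z. \<psi> (T a1 \<cdot> z)) y)"
    by (simp add: E_right[OF lin_E_fun] E_E[OF lT])
  also have "\<dots> = E (\<lambda>z. \<psi> (T a \<cdot> z)) y"
    by (intro counit_r lin_E_form lin_comp[OF \<psi>] mlin)
  finally show "E (\<lambda>z. E \<psi> (T a \<cdot> z)) y = E (\<lambda>z. \<psi> (T a \<cdot> z)) y" .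
qed

lemma cointegral_character:
  obtains \<gamma> where "lin \<gamma>" "\<gamma> one = 1" "\<And>a b. \<gamma> (a \<cdot> b) = \<gamma> a * \<gamma> b"
    "\<And>l a. cointegral l \<Longrightarrow> E (\<lambda>z. l (T a \<cdot> z)) = (\<lambda>z. \<gamma> a * l z)"
proof -
  obtain l where l: "cointegral l" "l \<noteq> (\<lambda>_. 0)" using exists_cointegral by blast
  then obtain x where x: "l x \<noteq> 0" by auto
  have l1: "lin l" and l2: "E l = l" using l(1) by (auto simp: cointegral_def)
  have lT: "lin (\<lambda>z. l (T a \<cdot> z))" for a by (intro lin_comp[OF l1] mlin)
  \<comment> \<open>By uniqueness E maps these forms to multiples of l; the quotient at one x with l
    x \<noteq> 0 reads off the factor.\<close>
  define \<gamma> where "\<gamma> a = E (\<lambda>z. l (T a \<cdot> z)) x / l x" for a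
  have \<gamma>: "E (\<lambda>z. l (T a \<cdot> z)) = (\<lambda>z. \<gamma> a * l z)" for a
  proof -
    obtain c where c: "E (\<lambda>z. l (T a \<cdot> z)) = (\<lambda>z. c * l z)"
      using cointegral_unique[OF l cointegral_E[OF lT]] by blast
    then have "c = \<gamma> a" using x by (simp add: \<gamma>_def)
    with c show ?thesis by simp
  qed
  show ?thesis
  proof
    have "lin (\<lambda>a. E (\<lambda>z. l (T a \<cdot> z)) x)" by (intro lin_E_form lin_comp[OF l1] mlin)
    then show "lin \<gamma>" by (simp add: lin_def \<gamma>_def add_divide_distrib)
    show "\<gamma> one = 1" using x by (simp add: \<gamma>_def l2)
    show "\<gamma> (a \<cdot> b) = \<gamma> a * \<gamma> b" for a b
    proof -
      have "E (\<lambda>z. E (\<lambda>z. l (T b \<cdot> z)) (T a \<cdot> z)) x = E (\<lambda>z. l (T (a \<cdot> b) \<cdot> z)) x"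
        by (simp add: E_left_E[OF lT])
      then show ?thesis using x fun_cong[OF \<gamma>[of "a \<cdot> b"], of x]
        by (simp add: \<gamma> E_cmult mult.commute)
    qed
    show "E (\<lambda>z. l' (T a \<cdot> z)) = (\<lambda>z. \<gamma> a * l' z)" if "cointegral l'" for l' a
    proof -
      obtain c where "l' = (\<lambda>z. c * l z)" using cointegral_unique[OF l \<open>cointegral l'\<close>] by blast
      then show ?thesis by (auto simp: E_cmult \<gamma>)
    qed
  qed
qed

text \<open>\<open>E_left\<close> with S(a) in place of a. The element h a stands for the hit of
  S(a) by \<gamma> and is described by its values under linear forms, independently of any model of
  the tensors.\<close>

lemma cointegral_modular:
  assumes l: "cointegral l" and \<gamma>: "\<And>a. E (\<lambda>z. l (T a \<cdot> z)) = (\<lambda>z. \<gamma> a * l z)"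
    and h: "\<And>f. lin f \<Longrightarrow> f (h a) = D (S a) (\<lambda>x y. \<gamma> x * f y)"
  shows "l (a \<cdot> b) = l (b \<cdot> S (h a))"
proof -
  have l1: "lin l" and l2: "E l = l" using l by (auto simp: cointegral_def)
  have "lin (\<lambda>x. l (b \<cdot> S x))" by (intro lin_comp[OF l1] mlin)
  from h[OF this] show ?thesis
    using E_left[OF l1, of "S a" b] by (simp add: l2 \<gamma>)
qed

text \<open>Otherwise \<gamma> applied to X \<beta> S(Y) \<alpha> Z = 1 would give 0 = 1.\<close>

lemma character_beta:
  assumes \<gamma>: "lin \<gamma>" "\<gamma> one = 1" "\<And>a b. \<gamma> (a \<cdot> b) = \<gamma> a * \<gamma> b"
  shows "\<gamma> be \<noteq> 0"
  using antipode_phi[OF \<gamma>(1)] \<gamma>(2,3) by (auto simp: sum3_def)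

text \<open>Apply \<gamma> to x1 \<beta> S(x2) = \<epsilon>(x) \<beta> and cancel
  \<gamma>(\<beta>).\<close>

lemma character_antipode:
  assumes \<gamma>: "lin \<gamma>" "\<gamma> one = 1" "\<And>a b. \<gamma> (a \<cdot> b) = \<gamma> a * \<gamma> b"
  shows "D x (\<lambda>u v. \<gamma> u * \<gamma> (S v)) = eps x"
proof -
  have "D x (\<lambda>u v. \<gamma> u * \<gamma> (S v)) * \<gamma> be = eps x * \<gamma> be"
    using antipode_be[OF \<gamma>(1), of x] unfolding sum2_multc[symmetric] by (simp add: \<gamma>(3) mult.commute mult.left_commute)
  then show ?thesis using character_beta[OF \<gamma>] by simp
qed

end

section \<open>Tensors as functionals\<close>

locale fd_quasi_hopf = quasi_hopf_algebra H + finite_dimensional_vector_space "scal H" B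
  for H :: "('k::field, 'a::ring_1) quasi_hopf_data" and B :: "'a set"
begin

sublocale dual_basis "scal H" B ..

section \<open>Multilinear forms on lists and the tensors evaluated at them\<close>

lemma linear_iff_lin: "Vector_Spaces.linear (scal H) (*) f \<longleftrightarrow> lin f"
proof -
  have "vector_space ((*) :: 'k \<Rightarrow> 'k \<Rightarrow> 'k)"
    by unfold_locales (simp_all add: algebra_simps)
  then show ?thesis
    using vector_space_axioms by (auto simp: Vector_Spaces.linear_iff lin_def)
qed

lemma linear_iff_endo: "Vector_Spaces.linear (scal H) (scal H) f \<longleftrightarrow> endo f"
  using vector_space_axioms by (auto simp: Vector_Spaces.linear_iff endo_def)

lemma multilinear_iff:
  "multilinear H n F \<longleftrightarrow> (\<forall>w i. length w = n \<longrightarrow> i < n \<longrightarrow> lin (\<lambda>x. F (w[i := x])))"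
  by (simp add: multilinear_def linear_iff_lin)

lemma all_length_Suc: "(\<forall>w. length w = Suc n \<longrightarrow> Q w) \<longleftrightarrow> (\<forall>x w. length w = n \<longrightarrow> Q (x # w))"
  by (auto simp: length_Suc_conv)

lemma multilinear_iff_less:
  "multilinear H n F \<longleftrightarrow> (\<forall>w. length w = n \<longrightarrow> (\<forall>i<n. lin (\<lambda>x. F (w[i := x]))))"
  unfolding multilinear_iff by blast

lemma multilinear_1: "multilinear H (Suc 0) F \<longleftrightarrow> lin (\<lambda>x. F [x])"
  unfolding multilinear_iff_less by (simp add: all_length_Suc All_less_Suc2)

lemma multilinear_2: "multilinear H 2 F \<longleftrightarrow> bilin (\<lambda>x y. F [x, y])"
  unfolding multilinear_iff_less bilin_def eval_nat_numeral
  by (simp add: all_length_Suc All_less_Suc2)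

lemma multilinear_3: "multilinear H 3 F \<longleftrightarrow> trilin (\<lambda>x y z. F [x, y, z])"
  unfolding multilinear_iff_less trilin_def eval_nat_numeral
  by (simp add: all_length_Suc All_less_Suc2) blast

lemma multilinear_4: "multilinear H 4 F \<longleftrightarrow> quadlin (\<lambda>x y z u. F [x, y, z, u])"
proof -
  have 4: "4 = Suc (Suc (Suc (Suc 0)))" by simp
  show ?thesis
    unfolding multilinear_iff_less quadlin_def 4
    by (simp add: all_length_Suc All_less_Suc2) blast
qed

lemma multilinear_cong:
  "(\<And>w. length w = n \<Longrightarrow> F w = G w) \<Longrightarrow> multilinear H n F \<longleftrightarrow> multilinear H n G"
  by (simp add: multilinear_iff)

lemma pure_eval: "pure H w F = (if multilinear H (length w) F then F w else 0)"
  by (simp add: pure_def)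

lemma tensorsE:
  assumes "t \<in> tensors H n"
  obtains ws where "\<And>w. w \<in> set ws \<Longrightarrow> length w = n"
    "\<And>F. t F = (if multilinear H n F then \<Sum>w\<leftarrow>ws. F w else 0)"
proof -
  from assms obtain ws where ws: "\<forall>w\<in>set ws. length w = n" and t: "t = (\<lambda>F. \<Sum>w\<leftarrow>ws. pure H w F)"
    by (auto simp: tensors_def)
  have "(\<Sum>w\<leftarrow>ws. pure H w F) = (if multilinear H n F then \<Sum>w\<leftarrow>ws. F w else 0)" for F
    using ws by (induction ws) (auto simp: pure_eval)
  with ws t show ?thesis by (intro that[of ws]) auto
qed

lemma tensorsI:
  assumes "\<And>w. w \<in> set ws \<Longrightarrow> length w = n"
    "\<And>F. t F = (if multilinear H n F then \<Sum>w\<leftarrow>ws. F w else 0)"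
  shows "t \<in> tensors H n"
proof -
  have "(\<Sum>w\<leftarrow>ws. pure H w F) = (if multilinear H n F then \<Sum>w\<leftarrow>ws. F w else 0)" for F
    using assms(1) by (induction ws) (auto simp: pure_eval)
  then show ?thesis
    unfolding tensors_def using assms by (auto intro!: exI[of _ ws])
qed

lemma tensor_cong:
  assumes t: "t \<in> tensors H n" and FG: "\<And>w. length w = n \<Longrightarrow> F w = G w"
  shows "t F = t G"
proof -
  from t obtain ws where ws: "\<And>w. w \<in> set ws \<Longrightarrow> length w = n"
    "\<And>F. t F = (if multilinear H n F then \<Sum>w\<leftarrow>ws. F w else 0)" by (rule tensorsE) blast
  have "map F ws = map G ws" using ws(1) FG by simp
  then show ?thesis using multilinear_cong[of n F G, OF FG] unfolding ws(2) by presburger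
qed

lemma tensor_not_multilinear: "t \<in> tensors H n \<Longrightarrow> \<not> multilinear H n F \<Longrightarrow> t F = 0"
  by (auto elim!: tensorsE)

lemma tensor_zero: "t \<in> tensors H n \<Longrightarrow> t (\<lambda>_. 0) = 0"
  by (auto elim!: tensorsE simp: multilinear_iff lin_def)

lemma tensor_ext:
  assumes "t \<in> tensors H n" "s \<in> tensors H n" "\<And>F. multilinear H n F \<Longrightarrow> t F = s F"
  shows "t = s"
  using assms tensor_not_multilinear by (intro ext) metis

lemma lin_sum_list: "(\<And>w. w \<in> set ws \<Longrightarrow> lin (F w)) \<Longrightarrow> lin (\<lambda>x. \<Sum>w\<leftarrow>ws. F w x)"
  by (induction ws) (auto simp: lin_def algebra_simps)

lemma lin_tensor:
  assumes t: "t \<in> tensors H n" and F: "\<And>x. multilinear H n (F x)" and l: "\<And>w. length w = n \<Longrightarrow> lin (\<lambda>x. F x w)"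
  shows "lin (\<lambda>x. t (F x))"
  using t by (rule tensorsE) (simp add: F lin_sum_list l)

lemma pure_in_tensors: "length w = n \<Longrightarrow> pure H w \<in> tensors H n"
  by (rule tensorsI[of "[w]"]) (auto simp: pure_eval)

lemma zero_in_tensors: "(\<lambda>_. 0) \<in> tensors H n"
  by (rule tensorsI[of "[]"]) auto

lemma add_in_tensors:
  assumes "s \<in> tensors H n" "t \<in> tensors H n"
  shows "(\<lambda>F. s F + t F) \<in> tensors H n"
proof -
  from assms(1) obtain vs where vs: "\<And>w. w \<in> set vs \<Longrightarrow> length w = n"
    "\<And>F. s F = (if multilinear H n F then \<Sum>w\<leftarrow>vs. F w else 0)" by (rule tensorsE) blast
  from assms(2) obtain ws where ws: "\<And>w. w \<in> set ws \<Longrightarrow> length w = n"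
    "\<And>F. t F = (if multilinear H n F then \<Sum>w\<leftarrow>ws. F w else 0)" by (rule tensorsE) blast
  show ?thesis
    by (rule tensorsI[of "vs @ ws"]) (use vs ws in auto)
qed

lemma sum_list_in_tensors:
  "(\<And>w. w \<in> set ws \<Longrightarrow> G w \<in> tensors H n) \<Longrightarrow> (\<lambda>F. \<Sum>w\<leftarrow>ws. G w F) \<in> tensors H n"
  by (induction ws) (auto simp: zero_in_tensors add_in_tensors)

text \<open>A form F that is not n-linear must be covered as well: every \<open>G w\<close> vanishes
  at it, so the form on lists of length m is zero there and hence multilinear.\<close>

lemma tensor_lift_in_tensors:
  assumes t: "t \<in> tensors H m" and G: "\<And>w. length w = m \<Longrightarrow> G w \<in> tensors H n"
    and l: "\<And>F. multilinear H n F \<Longrightarrow> multilinear H m (\<lambda>w. G w F)"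
  shows "tensor_lift t G \<in> tensors H n"
proof -
  from t obtain ws where ws: "\<And>w. w \<in> set ws \<Longrightarrow> length w = m"
    "\<And>F. t F = (if multilinear H m F then \<Sum>w\<leftarrow>ws. F w else 0)" by (rule tensorsE) blast
  have "multilinear H m (\<lambda>w. G w F)" for F
  proof (cases "multilinear H n F")
    case False
    then have "multilinear H m (\<lambda>w. G w F) \<longleftrightarrow> multilinear H m (\<lambda>w. 0)"
      by (intro multilinear_cong tensor_not_multilinear[OF G])
    then show ?thesis by (simp add: multilinear_iff lin_def)
  qed (rule l)
  then have "tensor_lift t G = (\<lambda>F. \<Sum>w\<leftarrow>ws. G w F)"
    by (simp add: tensor_lift_def ws(2) fun_eq_iff)
  then show ?thesis using sum_list_in_tensors[of ws G n] G ws(1) by simp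
qed

section \<open>The multiplication of tensor powers and inverses\<close>

lemma endo_mult: "endo (\<lambda>x. x * c)" "endo (\<lambda>x. c * x)"
  by (simp_all add: endo_def algebra_simps scal_mult_left[symmetric] scal_mult_right[symmetric])

lemma map2_update:
  "length v = length w \<Longrightarrow> i < length v \<Longrightarrow> map2 (*) (v[i := x]) w = (map2 (*) v w)[i := x * (w ! i)]"
  "length v = length w \<Longrightarrow> i < length v \<Longrightarrow> map2 (*) v (w[i := x]) = (map2 (*) v w)[i := (v ! i) * x]"
  by (auto simp: list_eq_iff_nth_eq nth_list_update)

lemma multilinear_mult:
  assumes "multilinear H n F"
  shows "length v = n \<Longrightarrow> multilinear H n (\<lambda>w. F (map2 (*) v w))"
    and "length w = n \<Longrightarrow> multilinear H n (\<lambda>v. F (map2 (*) v w))"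
  using assms by (auto simp: multilinear_iff map2_update
      intro: lin_comp[where f = "\<lambda>x. F (list_update _ _ x)", OF _ endo_mult(1)] lin_comp[where f = "\<lambda>x. F (list_update _ _ x)", OF _ endo_mult(2)])

lemma multilinear_append:
  assumes "multilinear H (m + n) F"
  shows "length v = m \<Longrightarrow> multilinear H n (\<lambda>w. F (v @ w))"
    and "length w = n \<Longrightarrow> multilinear H m (\<lambda>v. F (v @ w))"
proof -
  assume v: "length v = m"
  show "multilinear H n (\<lambda>w. F (v @ w))"
    unfolding multilinear_iff
  proof (intro allI impI)
    fix w :: "'a list" and i assume "length w = n" "i < n"
    then show "lin (\<lambda>x. F (v @ w[i := x]))"
      using assms[unfolded multilinear_iff, rule_format, of "v @ w" "m + i"] v by (simp add: list_update_append)
  qed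
next
  assume w: "length w = n"
  show "multilinear H m (\<lambda>v. F (v @ w))"
    unfolding multilinear_iff
  proof (intro allI impI)
    fix v :: "'a list" and i assume "length v = m" "i < m"
    then show "lin (\<lambda>x. F (v[i := x] @ w))"
      using assms[unfolded multilinear_iff, rule_format, of "v @ w" "i"] w by (simp add: list_update_append)
  qed
qed

lemma multilinear_tensor:
  assumes t: "t \<in> tensors H n" and 1: "\<And>v. length v = m \<Longrightarrow> multilinear H n (F v)"
    and 2: "\<And>w. length w = n \<Longrightarrow> multilinear H m (\<lambda>v. F v w)"
  shows "multilinear H m (\<lambda>v. t (F v))"
  unfolding multilinear_iff
proof (intro allI impI)
  fix w :: "'a list" and i assume "length w = m" "i < m"
  then show "lin (\<lambda>x. t (F (w[i := x])))"
    by (intro lin_tensor[OF t 1]) (use 2 in \<open>auto simp: multilinear_iff\<close>)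
qed

lemma tensor_mult_eval:
  assumes s: "s \<in> tensors H n" and t: "t \<in> tensors H n" and F: "multilinear H n F"
  shows "(s \<odot>\<^bsub>H\<^esub> t) F = s (\<lambda>v. t (\<lambda>w. F (map2 (*) v w)))"
  unfolding tensor_mult_def tensor_lift_def
  by (intro tensor_cong[OF s] tensor_cong[OF t]) (use F in \<open>simp add: pure_eval\<close>)

lemma tensor_prod_eval:
  assumes s: "s \<in> tensors H m" and t: "t \<in> tensors H n" and F: "multilinear H (m + n) F"
  shows "(s \<otimes>\<^bsub>H\<^esub> t) F = s (\<lambda>v. t (\<lambda>w. F (v @ w)))"
  unfolding tensor_prod_def tensor_lift_def
  by (intro tensor_cong[OF s] tensor_cong[OF t]) (use F in \<open>simp add: pure_eval\<close>)

lemma tensor_mult_in_tensors: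
  assumes s: "s \<in> tensors H n" and t: "t \<in> tensors H n"
  shows "s \<odot>\<^bsub>H\<^esub> t \<in> tensors H n"
  unfolding tensor_mult_def
proof (intro tensor_lift_in_tensors[OF s] tensor_lift_in_tensors[OF t] pure_in_tensors)
  fix F assume F: "multilinear H n F"
  show "multilinear H n (\<lambda>w. pure H (map2 (*) v w) F)" if "length v = n" for v
    using multilinear_mult(1)[OF F that] by (rule multilinear_cong[THEN iffD1, rotated]) (simp add: pure_eval F that)
  have *: "multilinear H n (\<lambda>v. t (\<lambda>w. F (map2 (*) v w)))"
    by (intro multilinear_tensor[OF t] multilinear_mult F)
  show "multilinear H n (\<lambda>v. tensor_lift t (\<lambda>w. pure H (map2 (*) v w)) F)"
    unfolding tensor_lift_def
    by (rule multilinear_cong[THEN iffD1, OF _ *]) (use F in \<open>auto intro!: tensor_cong[OF t] simp: pure_eval\<close>)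
qed auto

lemma tensor_prod_in_tensors:
  assumes s: "s \<in> tensors H m" and t: "t \<in> tensors H n"
  shows "s \<otimes>\<^bsub>H\<^esub> t \<in> tensors H (m + n)"
  unfolding tensor_prod_def
proof (intro tensor_lift_in_tensors[OF s] tensor_lift_in_tensors[OF t] pure_in_tensors)
  fix F assume F: "multilinear H (m + n) F"
  show "multilinear H n (\<lambda>w. pure H (v @ w) F)" if "length v = m" for v
    using multilinear_append(1)[OF F that] by (rule multilinear_cong[THEN iffD1, rotated]) (simp add: pure_eval F that)
  have *: "multilinear H m (\<lambda>v. t (\<lambda>w. F (v @ w)))"
    by (intro multilinear_tensor[OF t] multilinear_append[OF F])
  show "multilinear H m (\<lambda>v. tensor_lift t (\<lambda>w. pure H (v @ w)) F)"
    unfolding tensor_lift_def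
    by (rule multilinear_cong[THEN iffD1, OF _ *]) (use F in \<open>auto intro!: tensor_cong[OF t] simp: pure_eval\<close>)
qed auto

lemma tensor_one_in_tensors: "tensor_one H n \<in> tensors H n"
  unfolding tensor_one_def by (rule pure_in_tensors) simp

lemma tensor_one_eval: "multilinear H n F \<Longrightarrow> tensor_one H n F = F (replicate n 1)"
  by (simp add: tensor_one_def pure_eval)

lemma tensor_mult_assoc:
  assumes "r \<in> tensors H n" "s \<in> tensors H n" "t \<in> tensors H n"
  shows "r \<odot>\<^bsub>H\<^esub> s \<odot>\<^bsub>H\<^esub> t = r \<odot>\<^bsub>H\<^esub> (s \<odot>\<^bsub>H\<^esub> t)"
proof (rule tensor_ext)
  note m = tensor_mult_in_tensors
  show "r \<odot>\<^bsub>H\<^esub> s \<odot>\<^bsub>H\<^esub> t \<in> tensors H n" "r \<odot>\<^bsub>H\<^esub> (s \<odot>\<^bsub>H\<^esub> t) \<in> tensors H n"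
    by (intro m assms)+
  fix F assume F: "multilinear H n F"
  have *: "multilinear H n (\<lambda>v. t (\<lambda>w. F (map2 (*) v w)))"
    by (intro multilinear_tensor[OF assms(3)] multilinear_mult F)
  have "(r \<odot>\<^bsub>H\<^esub> s \<odot>\<^bsub>H\<^esub> t) F = r (\<lambda>u. s (\<lambda>v. t (\<lambda>w. F (map2 (*) (map2 (*) u v) w))))"
    by (simp add: tensor_mult_eval[OF m[OF assms(1,2)] assms(3) F] tensor_mult_eval[OF assms(1,2) *])
  also have "\<dots> = r (\<lambda>u. s (\<lambda>v. t (\<lambda>w. F (map2 (*) u (map2 (*) v w)))))"
  proof (intro tensor_cong[OF assms(1)] tensor_cong[OF assms(2)] tensor_cong[OF assms(3)])
    fix u v w :: "'a list" assume "length u = n" "length v = n" "length w = n"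
    then have "map2 (*) (map2 (*) u v) w = map2 (*) u (map2 (*) v w)"
      by (auto simp: list_eq_iff_nth_eq mult.assoc)
    then show "F (map2 (*) (map2 (*) u v) w) = F (map2 (*) u (map2 (*) v w))" by simp
  qed
  also have "\<dots> = r (\<lambda>u. (s \<odot>\<^bsub>H\<^esub> t) (\<lambda>w. F (map2 (*) u w)))"
    by (intro tensor_cong[OF assms(1)] tensor_mult_eval[OF assms(2,3), symmetric] multilinear_mult F)
  also have "\<dots> = (r \<odot>\<^bsub>H\<^esub> (s \<odot>\<^bsub>H\<^esub> t)) F"
    by (intro tensor_mult_eval[where n = n, symmetric] m assms F)
  finally show "(r \<odot>\<^bsub>H\<^esub> s \<odot>\<^bsub>H\<^esub> t) F = (r \<odot>\<^bsub>H\<^esub> (s \<odot>\<^bsub>H\<^esub> t)) F" .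
qed

lemma tensor_mult_one:
  assumes t: "t \<in> tensors H n"
  shows "tensor_one H n \<odot>\<^bsub>H\<^esub> t = t" "t \<odot>\<^bsub>H\<^esub> tensor_one H n = t"
proof -
  note m = tensor_mult_in_tensors tensor_one_in_tensors t
  show "tensor_one H n \<odot>\<^bsub>H\<^esub> t = t"
  proof (rule tensor_ext)
    fix F assume F: "multilinear H n F"
    have "(tensor_one H n \<odot>\<^bsub>H\<^esub> t) F = tensor_one H n (\<lambda>v. t (\<lambda>w. F (map2 (*) v w)))"
      by (intro tensor_mult_eval[where n = n] m F)
    also have "\<dots> = t (\<lambda>w. F (map2 (*) (replicate n 1) w))"
      by (intro tensor_one_eval multilinear_tensor[OF t] multilinear_mult F)
    also have "\<dots> = t F"
    proof (rule tensor_cong[OF t])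
      fix w :: "'a list" assume "length w = n"
      then have "map2 (*) (replicate n 1) w = w" by (auto simp: list_eq_iff_nth_eq)
      then show "F (map2 (*) (replicate n 1) w) = F w" by simp
    qed
    finally show "(tensor_one H n \<odot>\<^bsub>H\<^esub> t) F = t F" .
  qed (intro m)+
  show "t \<odot>\<^bsub>H\<^esub> tensor_one H n = t"
  proof (rule tensor_ext)
    fix F assume F: "multilinear H n F"
    have "(t \<odot>\<^bsub>H\<^esub> tensor_one H n) F = t (\<lambda>v. tensor_one H n (\<lambda>w. F (map2 (*) v w)))"
      by (intro tensor_mult_eval[where n = n] m F)
    also have "\<dots> = t F"
    proof (rule tensor_cong[OF t])
      fix w :: "'a list" assume w: "length w = n"
      then have "map2 (*) w (replicate n 1) = w" by (auto simp: list_eq_iff_nth_eq)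
      then show "tensor_one H n (\<lambda>v. F (map2 (*) w v)) = F w"
        using tensor_one_eval[OF multilinear_mult(1)[OF F w]] by simp
    qed
    finally show "(t \<odot>\<^bsub>H\<^esub> tensor_one H n) F = t F" .
  qed (intro m)+
qed

lemma is_tensor_inverse_unique:
  assumes t: "t \<in> tensors H n" and s: "is_tensor_inverse H n t s"
  shows "tensor_inverse H n t = s"
  unfolding tensor_inverse_def
proof (rule the_equality[where a = s])
  show "is_tensor_inverse H n t s" by (rule s)
  fix r assume r: "is_tensor_inverse H n t r"
  have "r \<odot>\<^bsub>H\<^esub> t \<odot>\<^bsub>H\<^esub> s = r \<odot>\<^bsub>H\<^esub> (t \<odot>\<^bsub>H\<^esub> s)"
    using r s t by (intro tensor_mult_assoc) (auto simp: is_tensor_inverse_def)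
  then show "r = s"
    using r s by (simp add: is_tensor_inverse_def tensor_mult_one)
qed

text \<open>Tensors vanish at forms that are not multilinear, while the functionals of the calculus
  are plain sums defined at every function. The two are therefore compared at multilinear forms
  only.\<close>

definition represents2 where
  "represents2 t L \<longleftrightarrow> t \<in> tensors H 2 \<and> (\<forall>F. multilinear H 2 F \<longrightarrow> t F = L (\<lambda>x y. F [x, y]))"

definition represents3 where
  "represents3 t L \<longleftrightarrow> t \<in> tensors H 3 \<and> (\<forall>F. multilinear H 3 F \<longrightarrow> t F = L (\<lambda>x y z. F [x, y, z]))"

definition represents4 where
  "represents4 t L \<longleftrightarrow> t \<in> tensors H 4 \<and> (\<forall>F. multilinear H 4 F \<longrightarrow> t F = L (\<lambda>x y z u. F [x, y, z, u]))"

lemma represents2_eval: "represents2 t L \<Longrightarrow> bilin F \<Longrightarrow> t (\<lambda>w. F (w ! 0) (w ! 1)) = L F"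
  by (simp add: represents2_def multilinear_2)

lemma represents3_eval: "represents3 t L \<Longrightarrow> trilin F \<Longrightarrow> t (\<lambda>w. F (w ! 0) (w ! 1) (w ! 2)) = L F"
  by (simp add: represents3_def multilinear_3)

lemma represents4_eval: "represents4 t L \<Longrightarrow> quadlin F \<Longrightarrow> t (\<lambda>w. F (w ! 0) (w ! 1) (w ! 2) (w ! 3)) = L F"
  by (simp add: represents4_def multilinear_4 numeral_3_eq_3)

lemma represents2_cong: "represents2 t L \<Longrightarrow> (\<And>F. bilin F \<Longrightarrow> L F = M F) \<Longrightarrow> represents2 t M"
  by (simp add: represents2_def multilinear_2)

lemma represents2_unique:
  assumes "represents2 t L" "represents2 s M" "\<And>F. bilin F \<Longrightarrow> L F = M F"
  shows "t = s"
  using assms by (intro tensor_ext[of t 2 s]) (auto simp: represents2_def multilinear_2)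

lemma represents3_agree:
  assumes "t = s" "represents3 t L" "represents3 s M" "trilin F"
  shows "L F = M F"
  using represents3_eval[OF assms(2,4)] represents3_eval[OF assms(3,4)] assms(1) by simp

lemma represents4_agree:
  assumes "t = s" "represents4 t L" "represents4 s M" "quadlin F"
  shows "L F = M F"
  using represents4_eval[OF assms(2,4)] represents4_eval[OF assms(3,4)] assms(1) by simp

lemma represents2_pure: "represents2 (pure H [x, y]) (\<lambda>F. F x y)"
  by (auto simp: represents2_def pure_in_tensors pure_eval numeral_2_eq_2)

lemma represents2_mult:
  assumes s: "represents2 s L" and t: "represents2 t M"
  shows "represents2 (s \<odot>\<^bsub>H\<^esub> t) (\<lambda>F. L (\<lambda>x y. M (\<lambda>u v. F (x * u) (y * v))))"
proof -
  from s t have st: "s \<in> tensors H 2" "t \<in> tensors H 2" by (auto simp: represents2_def)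
  have "(s \<odot>\<^bsub>H\<^esub> t) F = L (\<lambda>x y. M (\<lambda>u v. F [x * u, y * v]))" if F: "multilinear H 2 F" for F
  proof -
    have 1: "multilinear H 2 (\<lambda>v. t (\<lambda>w. F (map2 (*) v w)))"
      by (intro multilinear_tensor[OF st(2)] multilinear_mult F)
    have 2: "multilinear H 2 (\<lambda>w. F (map2 (*) [x, y] w))" for x y
      by (intro multilinear_mult F) simp
    show ?thesis
      using 1 2 s t by (simp add: tensor_mult_eval[OF st F] represents2_def)
  qed
  then show ?thesis using st by (simp add: represents2_def tensor_mult_in_tensors)
qed

lemma represents3_mult:
  assumes s: "represents3 s L" and t: "represents3 t M"
  shows "represents3 (s \<odot>\<^bsub>H\<^esub> t) (\<lambda>F. L (\<lambda>x y z. M (\<lambda>u v w. F (x * u) (y * v) (z * w))))"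
proof -
  from s t have st: "s \<in> tensors H 3" "t \<in> tensors H 3" by (auto simp: represents3_def)
  have "(s \<odot>\<^bsub>H\<^esub> t) F = L (\<lambda>x y z. M (\<lambda>u v w. F [x * u, y * v, z * w]))" if F: "multilinear H 3 F" for F
  proof -
    have 1: "multilinear H 3 (\<lambda>v. t (\<lambda>w. F (map2 (*) v w)))"
      by (intro multilinear_tensor[OF st(2)] multilinear_mult F)
    have 2: "multilinear H 3 (\<lambda>w. F (map2 (*) [x, y, z] w))" for x y z
      by (intro multilinear_mult F) simp
    show ?thesis
      using 1 2 s t by (simp add: tensor_mult_eval[OF st F] represents3_def)
  qed
  then show ?thesis using st by (simp add: represents3_def tensor_mult_in_tensors)
qed

lemma represents4_mult:
  assumes s: "represents4 s L" and t: "represents4 t M"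
  shows "represents4 (s \<odot>\<^bsub>H\<^esub> t) (\<lambda>F. L (\<lambda>x y z a. M (\<lambda>u v w b. F (x * u) (y * v) (z * w) (a * b))))"
proof -
  from s t have st: "s \<in> tensors H 4" "t \<in> tensors H 4" by (auto simp: represents4_def)
  have "(s \<odot>\<^bsub>H\<^esub> t) F = L (\<lambda>x y z a. M (\<lambda>u v w b. F [x * u, y * v, z * w, a * b]))" if F: "multilinear H 4 F" for F
  proof -
    have 1: "multilinear H 4 (\<lambda>v. t (\<lambda>w. F (map2 (*) v w)))"
      by (intro multilinear_tensor[OF st(2)] multilinear_mult F)
    have 2: "multilinear H 4 (\<lambda>w. F (map2 (*) [x, y, z, a] w))" for x y z a
      by (intro multilinear_mult F) simp
    show ?thesis
      using 1 2 s t by (simp add: tensor_mult_eval[OF st F] represents4_def)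
  qed
  then show ?thesis using st by (simp add: represents4_def tensor_mult_in_tensors)
qed

lemma pure_prod_eval:
  assumes t: "t \<in> tensors H n" and F: "multilinear H (Suc n) F"
  shows "(pure H [x] \<otimes>\<^bsub>H\<^esub> t) F = t (\<lambda>w. F (x # w))" "(t \<otimes>\<^bsub>H\<^esub> pure H [x]) F = t (\<lambda>w. F (w @ [x]))"
    and "multilinear H n (\<lambda>w. F (x # w))" "multilinear H n (\<lambda>w. F (w @ [x]))"
proof -
  have p: "pure H [x] \<in> tensors H 1" by (rule pure_in_tensors) simp
  have F1: "multilinear H (1 + n) F" and F2: "multilinear H (n + 1) F" using F by simp_all
  have "multilinear H 1 (\<lambda>v. t (\<lambda>w. F (v @ w)))"
    by (intro multilinear_tensor[OF t] multilinear_append[OF F1])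
  then show "(pure H [x] \<otimes>\<^bsub>H\<^esub> t) F = t (\<lambda>w. F (x # w))"
    by (simp add: tensor_prod_eval[OF p t F1]) (simp add: pure_eval)
  have "pure H [x] (\<lambda>w. F (v @ w)) = F (v @ [x])" if "length v = n" for v
    using multilinear_append(1)[OF F2 that] by (simp add: pure_eval)
  then show "(t \<otimes>\<^bsub>H\<^esub> pure H [x]) F = t (\<lambda>w. F (w @ [x]))"
    unfolding tensor_prod_eval[OF t p F2] by (rule tensor_cong[OF t])
  show "multilinear H n (\<lambda>w. F (x # w))" "multilinear H n (\<lambda>w. F (w @ [x]))"
    using multilinear_append(1)[OF F1, of "[x]"] multilinear_append(2)[OF F2, of "[x]"] by simp_all
qed

lemma pure_prod_in_tensors:
  assumes t: "t \<in> tensors H n"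
  shows "pure H [x] \<otimes>\<^bsub>H\<^esub> t \<in> tensors H (Suc n)" "t \<otimes>\<^bsub>H\<^esub> pure H [x] \<in> tensors H (Suc n)"
  using tensor_prod_in_tensors[OF pure_in_tensors[of "[x]" 1] t] tensor_prod_in_tensors[OF t pure_in_tensors[of "[x]" 1]] by simp_all

lemma represents3_prod:
  assumes t: "represents2 t L"
  shows "represents3 (pure H [x] \<otimes>\<^bsub>H\<^esub> t) (\<lambda>F. L (\<lambda>u v. F x u v))"
    and "represents3 (t \<otimes>\<^bsub>H\<^esub> pure H [x]) (\<lambda>F. L (\<lambda>u v. F u v x))"
proof -
  have t2: "t \<in> tensors H 2" using t by (simp add: represents2_def)
  have 3: "3 = Suc 2" by simp
  show "represents3 (pure H [x] \<otimes>\<^bsub>H\<^esub> t) (\<lambda>F. L (\<lambda>u v. F x u v))"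
    "represents3 (t \<otimes>\<^bsub>H\<^esub> pure H [x]) (\<lambda>F. L (\<lambda>u v. F u v x))"
    using pure_prod_eval[OF t2, folded 3] pure_prod_in_tensors[OF t2, folded 3] t unfolding represents3_def represents2_def by auto
qed

lemma represents4_prod:
  assumes t: "represents3 t L"
  shows "represents4 (pure H [x] \<otimes>\<^bsub>H\<^esub> t) (\<lambda>F. L (\<lambda>u v w. F x u v w))"
    and "represents4 (t \<otimes>\<^bsub>H\<^esub> pure H [x]) (\<lambda>F. L (\<lambda>u v w. F u v w x))"
proof -
  have t3: "t \<in> tensors H 3" using t by (simp add: represents3_def)
  have 4: "4 = Suc 3" by simp
  show "represents4 (pure H [x] \<otimes>\<^bsub>H\<^esub> t) (\<lambda>F. L (\<lambda>u v w. F x u v w))"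
    "represents4 (t \<otimes>\<^bsub>H\<^esub> pure H [x]) (\<lambda>F. L (\<lambda>u v w. F u v w x))"
    using pure_prod_eval[OF t3, folded 4] pure_prod_in_tensors[OF t3, folded 4] t unfolding represents4_def represents3_def by auto
qed

text \<open>The tensor product associates to the right, so the two pure factors are grouped first
  and \<open>represents4_prod\<close> does not match.\<close>

lemma represents4_prod2:
  assumes t: "represents2 t L"
  shows "represents4 (t \<otimes>\<^bsub>H\<^esub> pure H [x] \<otimes>\<^bsub>H\<^esub> pure H [y]) (\<lambda>F. L (\<lambda>u v. F u v x y))"
proof -
  have t2: "t \<in> tensors H 2" using t by (simp add: represents2_def)
  have y: "pure H [y] \<in> tensors H 1" by (rule pure_in_tensors) simp
  have 2: "2 = Suc 1" by simp
  have p: "represents2 (pure H [x] \<otimes>\<^bsub>H\<^esub> pure H [y]) (\<lambda>F. F x y)"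
    unfolding represents2_def
    using pure_prod_in_tensors(1)[OF y, folded 2] pure_prod_eval(1,3)[OF y, folded 2] by (auto simp: pure_eval)
  then have p2: "pure H [x] \<otimes>\<^bsub>H\<^esub> pure H [y] \<in> tensors H 2" by (simp add: represents2_def)
  have "(t \<otimes>\<^bsub>H\<^esub> pure H [x] \<otimes>\<^bsub>H\<^esub> pure H [y]) F = L (\<lambda>u v. F [u, v, x, y])" if F: "multilinear H 4 F" for F
  proof -
    have F': "multilinear H (2 + 2) F" using F by simp
    have 1: "multilinear H 2 (\<lambda>v. (pure H [x] \<otimes>\<^bsub>H\<^esub> pure H [y]) (\<lambda>w. F (v @ w)))"
      by (intro multilinear_tensor[OF p2] multilinear_append[OF F'])
    have 2: "multilinear H 2 (\<lambda>w. F ([u, v] @ w))" for u v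
      by (intro multilinear_append[OF F']) simp
    show ?thesis
      using 1 2 p t by (simp add: tensor_prod_eval[OF t2 p2 F'] represents2_def)
  qed
  then show ?thesis
    using tensor_prod_in_tensors[OF t2 p2] by (simp add: represents4_def)
qed

lemma sweedler2_in_tensors:
  assumes "t \<in> tensors H 2" "\<And>x y. G x y \<in> tensors H n" "\<And>F. multilinear H n F \<Longrightarrow> bilin (\<lambda>x y. G x y F)"
  shows "sweedler2 t G \<in> tensors H n"
  unfolding sweedler2_def
  by (rule tensor_lift_in_tensors[OF assms(1,2)]) (simp add: multilinear_2 assms(3))

lemma sweedler3_in_tensors:
  assumes "t \<in> tensors H 3" "\<And>x y z. G x y z \<in> tensors H n" "\<And>F. multilinear H n F \<Longrightarrow> trilin (\<lambda>x y z. G x y z F)"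
  shows "sweedler3 t G \<in> tensors H n"
  unfolding sweedler3_def
  by (rule tensor_lift_in_tensors[OF assms(1,2)]) (simp add: multilinear_3 assms(3))

lemma sweedler4_in_tensors:
  assumes "t \<in> tensors H 4" "\<And>x y z u. G x y z u \<in> tensors H n" "\<And>F. multilinear H n F \<Longrightarrow> quadlin (\<lambda>x y z u. G x y z u F)"
  shows "sweedler4 t G \<in> tensors H n"
  unfolding sweedler4_def
  by (rule tensor_lift_in_tensors[OF assms(1,2)]) (simp add: multilinear_4 assms(3) numeral_3_eq_3)

lemma sweedler2_represents2:
  assumes t: "represents2 t L" and G: "\<And>x y. represents2 (G x y) (M x y)"
    and l: "\<And>F. bilin F \<Longrightarrow> bilin (\<lambda>x y. M x y F)"
  shows "represents2 (sweedler2 t G) (\<lambda>F. L (\<lambda>x y. M x y F))"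
proof -
  have GM: "G x y F = M x y (\<lambda>x y. F [x, y])" if "multilinear H 2 F" for x y F
    using G that by (simp add: represents2_def)
  have b: "bilin (\<lambda>x y. G x y F)" if "multilinear H 2 F" for F
    using l[of "\<lambda>x y. F [x, y]"] that by (simp add: GM[OF that] multilinear_2)
  have "sweedler2 t G \<in> tensors H 2"
    using t G b by (intro sweedler2_in_tensors) (auto simp: represents2_def)
  moreover have "sweedler2 t G F = L (\<lambda>x y. M x y (\<lambda>x y. F [x, y]))" if "multilinear H 2 F" for F
    using represents2_eval[OF t b[OF that]] by (simp add: sweedler2_def tensor_lift_def GM[OF that])
  ultimately show ?thesis by (simp add: represents2_def)
qed

lemma sweedler3_represents2:
  assumes t: "represents3 t L" and G: "\<And>x y z. represents2 (G x y z) (M x y z)"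
    and l: "\<And>F. bilin F \<Longrightarrow> trilin (\<lambda>x y z. M x y z F)"
  shows "represents2 (sweedler3 t G) (\<lambda>F. L (\<lambda>x y z. M x y z F))"
proof -
  have GM: "G x y z F = M x y z (\<lambda>x y. F [x, y])" if "multilinear H 2 F" for x y z F
    using G that by (simp add: represents2_def)
  have b: "trilin (\<lambda>x y z. G x y z F)" if "multilinear H 2 F" for F
    using l[of "\<lambda>x y. F [x, y]"] that by (simp add: GM[OF that] multilinear_2)
  have "sweedler3 t G \<in> tensors H 2"
    using t G b by (intro sweedler3_in_tensors) (auto simp: represents2_def represents3_def)
  moreover have "sweedler3 t G F = L (\<lambda>x y z. M x y z (\<lambda>x y. F [x, y]))" if "multilinear H 2 F" for F
    using represents3_eval[OF t b[OF that]] by (simp add: sweedler3_def tensor_lift_def GM[OF that])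
  ultimately show ?thesis by (simp add: represents2_def)
qed

lemma sweedler4_represents2:
  assumes t: "represents4 t L" and G: "\<And>x y z u. represents2 (G x y z u) (M x y z u)"
    and l: "\<And>F. bilin F \<Longrightarrow> quadlin (\<lambda>x y z u. M x y z u F)"
  shows "represents2 (sweedler4 t G) (\<lambda>F. L (\<lambda>x y z u. M x y z u F))"
proof -
  have GM: "G x y z u F = M x y z u (\<lambda>x y. F [x, y])" if "multilinear H 2 F" for x y z u F
    using G that by (simp add: represents2_def)
  have b: "quadlin (\<lambda>x y z u. G x y z u F)" if "multilinear H 2 F" for F
    using l[of "\<lambda>x y. F [x, y]"] that by (simp add: GM[OF that] multilinear_2)
  have "sweedler4 t G \<in> tensors H 2"
    using t G b by (intro sweedler4_in_tensors) (auto simp: represents2_def represents4_def)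
  moreover have "sweedler4 t G F = L (\<lambda>x y z u. M x y z u (\<lambda>x y. F [x, y]))" if "multilinear H 2 F" for F
    using represents4_eval[OF t b[OF that]] by (simp add: sweedler4_def tensor_lift_def GM[OF that])
  ultimately show ?thesis by (simp add: represents2_def)
qed

lemma sweedler2_represents3:
  assumes t: "represents2 t L" and G: "\<And>x y. represents3 (G x y) (M x y)"
    and l: "\<And>F. trilin F \<Longrightarrow> bilin (\<lambda>x y. M x y F)"
  shows "represents3 (sweedler2 t G) (\<lambda>F. L (\<lambda>x y. M x y F))"
proof -
  have GM: "G x y F = M x y (\<lambda>x y z. F [x, y, z])" if "multilinear H 3 F" for x y F
    using G that by (simp add: represents3_def)
  have b: "bilin (\<lambda>x y. G x y F)" if "multilinear H 3 F" for F
    using l[of "\<lambda>x y z. F [x, y, z]"] that by (simp add: GM[OF that] multilinear_3)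
  have "sweedler2 t G \<in> tensors H 3"
    using t G b by (intro sweedler2_in_tensors) (auto simp: represents2_def represents3_def)
  moreover have "sweedler2 t G F = L (\<lambda>x y. M x y (\<lambda>x y z. F [x, y, z]))" if "multilinear H 3 F" for F
    using represents2_eval[OF t b[OF that]] by (simp add: sweedler2_def tensor_lift_def GM[OF that])
  ultimately show ?thesis by (simp add: represents3_def)
qed

lemma sweedler3_represents4:
  assumes t: "represents3 t L" and G: "\<And>x y z. represents4 (G x y z) (M x y z)"
    and l: "\<And>F. quadlin F \<Longrightarrow> trilin (\<lambda>x y z. M x y z F)"
  shows "represents4 (sweedler3 t G) (\<lambda>F. L (\<lambda>x y z. M x y z F))"
proof -
  have GM: "G x y z F = M x y z (\<lambda>x y z u. F [x, y, z, u])" if "multilinear H 4 F" for x y z F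
    using G that by (simp add: represents4_def)
  have b: "trilin (\<lambda>x y z. G x y z F)" if "multilinear H 4 F" for F
    using l[of "\<lambda>x y z u. F [x, y, z, u]"] that by (simp add: GM[OF that] multilinear_4)
  have "sweedler3 t G \<in> tensors H 4"
    using t G b by (intro sweedler3_in_tensors) (auto simp: represents4_def represents3_def)
  moreover have "sweedler3 t G F = L (\<lambda>x y z. M x y z (\<lambda>x y z u. F [x, y, z, u]))" if "multilinear H 4 F" for F
    using represents3_eval[OF t b[OF that]] by (simp add: sweedler3_def tensor_lift_def GM[OF that])
  ultimately show ?thesis by (simp add: represents4_def)
qed

lemma elem_of_pure: "elem_of H (pure H [x]) = x"
  unfolding elem_of_def
proof (rule the_equality)
  fix y assume eq: "pure H [x] = pure H [y]"
  show "y = x"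
  proof (rule lin_ext)
    fix f assume "lin f"
    then show "f y = f x"
      using fun_cong[OF eq, of "\<lambda>w. f (w ! 0)"] by (simp add: pure_eval multilinear_1)
  qed
qed simp

text \<open>Adding up the entries \<open>g\<close> of a representing list inside H gives the element
  named by the definite description.\<close>

lemma elem_of_sweedler2:
  assumes t: "represents2 t L" and g: "\<And>f. lin f \<Longrightarrow> bilin (\<lambda>x y. f (g x y))" and f: "lin f"
  shows "f (elem_of H (sweedler2 t (\<lambda>x y. pure H [g x y]))) = L (\<lambda>x y. f (g x y))"
proof -
  have t2: "t \<in> tensors H 2" using t by (simp add: represents2_def)
  then obtain ws where ws: "\<And>F. t F = (if multilinear H 2 F then \<Sum>w\<leftarrow>ws. F w else 0)"
    by (rule tensorsE) blast
  define y where "y = (\<Sum>w\<leftarrow>ws. g (w ! 0) (w ! 1))"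
  have f_y: "f y = (\<Sum>w\<leftarrow>ws. f (g (w ! 0) (w ! 1)))" if "lin f" for f
  proof -
    have "f 0 = 0" using lin_sum_scale[OF that, of "\<lambda>_. 0" "\<lambda>_. 0" "{}"] by simp
    then have "f (sum_list vs) = (\<Sum>v\<leftarrow>vs. f v)" for vs
      using that by (induction vs) (auto simp: lin_def)
    then show ?thesis by (simp add: y_def comp_def)
  qed
  have "sweedler2 t (\<lambda>x y. pure H [g x y]) = pure H [y]"
  proof
    fix F
    show "sweedler2 t (\<lambda>x y. pure H [g x y]) F = pure H [y] F"
    proof (cases "multilinear H (Suc 0) F")
      case True
      then have "lin (\<lambda>x. F [x])" by (simp add: multilinear_1)
      with True g[OF this] show ?thesis
        by (simp add: sweedler2_def tensor_lift_def pure_eval ws multilinear_2 f_y[of "\<lambda>x. F [x]"])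
    next
      case False
      then show ?thesis using tensor_zero[OF t2] by (simp add: sweedler2_def tensor_lift_def pure_eval)
    qed
  qed
  then show ?thesis
    using represents2_eval[OF t g[OF f]] g[OF f] by (simp add: elem_of_pure f_y[OF f] ws multilinear_2)
qed

text \<open>Coordinates with respect to \<open>B\<close>, the coefficient functions that the
  calculus takes as parameters.\<close>

definition coeff2 where "coeff2 t x y = t (\<lambda>w. dual x (w ! 0) * dual y (w ! 1))"
definition coeff3 where "coeff3 t x y z = t (\<lambda>w. dual x (w ! 0) * dual y (w ! 1) * dual z (w ! 2))"

lemma trilin_expand:
  assumes F: "trilin F"
  shows "F x y z = (\<Sum>b\<in>B. \<Sum>c\<in>B. \<Sum>d\<in>B. dual b x * dual c y * dual d z * F b c d)"
proof -
  have "F x y z = (\<Sum>b\<in>B. dual b x * F b y z)"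
    using F by (intro lin_expand[of "\<lambda>x. F x y z"]) (simp add: trilin_def)
  also have "\<dots> = (\<Sum>b\<in>B. dual b x * (\<Sum>c\<in>B. \<Sum>d\<in>B. dual c y * dual d z * F b c d))"
  proof -
    have "F b y z = (\<Sum>c\<in>B. \<Sum>d\<in>B. dual c y * dual d z * F b c d)" for b
      using F by (intro bilin_expand) (simp add: bilin_def trilin_def)
    then show ?thesis by simp
  qed
  finally show ?thesis by (simp only: sum_distrib_left mult.assoc)
qed

lemma lin_dual_id: "lin (dual b)"
  using lin_dual[OF endo_id] by simp

lemma represents2_coeff:
  assumes t: "t \<in> tensors H 2"
  shows "represents2 t (sum2 B (coeff2 t))"
proof -
  obtain ws where len: "\<And>w. w \<in> set ws \<Longrightarrow> length w = 2"
    and ws: "\<And>F. t F = (if multilinear H 2 F then \<Sum>w\<leftarrow>ws. F w else 0)" using t by (rule tensorsE) blast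
  have "bilin (\<lambda>x y. dual b x * dual c y)" for b c
    by (intro bilinI lin_cmult lin_multc lin_dual_id)
  then have c: "coeff2 t = (\<lambda>b c. \<Sum>w\<leftarrow>ws. dual b (w ! 0) * dual c (w ! 1))"
    by (simp add: fun_eq_iff coeff2_def ws multilinear_2)
  have "(\<Sum>w\<leftarrow>ws. F w) = sum2 B (\<lambda>b c. \<Sum>w\<leftarrow>ws. dual b (w ! 0) * dual c (w ! 1)) (\<lambda>x y. F [x, y])"
    if "multilinear H 2 F" for F
    using len
  proof (induction ws)
    case Nil
    then show ?case by (simp add: sum2_def)
  next
    case (Cons w ws)
    obtain x y where w: "w = [x, y]" using Cons.prems[of w] by (auto simp: numeral_2_eq_2 length_Suc_conv)
    have "F [x, y] = sum2 B (\<lambda>b c. dual b x * dual c y) (\<lambda>x y. F [x, y])"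
      using bilin_expand[of "\<lambda>x y. F [x, y]" x y] that by (simp add: multilinear_2 sum2_def)
    then show ?case
      using Cons by (simp add: w sum2_def distrib_right sum.distrib)
  qed
  then show ?thesis using t by (simp add: represents2_def c ws)
qed

lemma represents3_coeff:
  assumes t: "t \<in> tensors H 3"
  shows "represents3 t (sum3 B (coeff3 t))"
proof -
  obtain ws where len: "\<And>w. w \<in> set ws \<Longrightarrow> length w = 3"
    and ws: "\<And>F. t F = (if multilinear H 3 F then \<Sum>w\<leftarrow>ws. F w else 0)" using t by (rule tensorsE) blast
  have "trilin (\<lambda>x y z. dual b x * dual c y * dual d z)" for b c d
    by (intro trilinI lin_cmult lin_multc lin_dual_id)
  then have c: "coeff3 t = (\<lambda>b c d. \<Sum>w\<leftarrow>ws. dual b (w ! 0) * dual c (w ! 1) * dual d (w ! 2))"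
    by (simp add: fun_eq_iff coeff3_def ws multilinear_3)
  have "(\<Sum>w\<leftarrow>ws. F w) = sum3 B (\<lambda>b c d. \<Sum>w\<leftarrow>ws. dual b (w ! 0) * dual c (w ! 1) * dual d (w ! 2)) (\<lambda>x y z. F [x, y, z])"
    if "multilinear H 3 F" for F
    using len
  proof (induction ws)
    case Nil
    then show ?case by (simp add: sum3_def)
  next
    case (Cons w ws)
    obtain x y z where w: "w = [x, y, z]" using Cons.prems[of w] by (auto simp: numeral_3_eq_3 length_Suc_conv)
    have "F [x, y, z] = sum3 B (\<lambda>b c d. dual b x * dual c y * dual d z) (\<lambda>x y z. F [x, y, z])"
      using trilin_expand[of "\<lambda>x y z. F [x, y, z]" x y z] that by (simp add: multilinear_3 sum3_def)
    then show ?case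
      using Cons by (simp add: w sum3_def distrib_right sum.distrib)
  qed
  then show ?thesis using t by (simp add: represents3_def c ws)
qed

section \<open>The given quasi-Hopf algebra as an instance of the calculus\<close>

lemma reassoc_inverse: "is_tensor_inverse H 3 (reassoc H) (reassoc_inv H)"
  unfolding reassoc_inv_def
  using reassoc_invertible is_tensor_inverse_unique[OF reassoc_closed] by metis

abbreviation "comul \<equiv> \<lambda>a. coeff2 (comult H a)"
abbreviation "D a \<equiv> sum2 B (coeff2 (comult H a))"
abbreviation "Phi \<equiv> sum3 B (coeff3 (reassoc H))"
abbreviation "Psi \<equiv> sum3 B (coeff3 (reassoc_inv H))"

lemma represents_comult: "represents2 (comult H a) (D a)"
  by (intro represents2_coeff comult_closed)

lemma represents_reassoc: "represents3 (reassoc H) Phi"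
  by (intro represents3_coeff reassoc_closed)

lemma represents_reassoc_inv: "represents3 (reassoc_inv H) Psi"
  using reassoc_inverse by (intro represents3_coeff) (simp add: is_tensor_inverse_def)

lemma represents_one:
  "represents2 (tensor_one H 2) (\<lambda>F. F 1 1)" "represents3 (tensor_one H 3) (\<lambda>F. F 1 1 1)"
  by (auto simp: represents2_def represents3_def tensor_one_in_tensors tensor_one_eval numeral_3_eq_3 numeral_2_eq_2)

lemma endo_antipode: "endo (antipode H)"
  using antipode_linear by (simp add: linear_iff_endo)

lemma antipode_inverse: "antipode H (antipode_inv H x) = x" "antipode_inv H (antipode H x) = x"
  using antipode_bij by (simp_all add: surj_f_inv_f bij_is_surj inv_f_f bij_is_inj)

lemma lin_coeff: "lin (\<lambda>a. coeff2 (comult H a) b c)"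
  by (simp add: lin_def coeff2_def comult_add comult_scal)

lemma lin_D': "endo g \<Longrightarrow> lin (\<lambda>x. D (g x) F)"
  unfolding sum2_def by (intro lin_sum lin_multc lin_comp[OF lin_coeff])

lemma lin_counit: "lin (counit H)"
  using counit_linear by (simp add: linear_iff_lin)

lemma scal_lin: "lin f \<Longrightarrow> f (scal H c x) = c * f x"
  by (simp add: lin_def)

lemmas basic_lin = bilinI trilinI quadlinI lin_D' lin_sum2 lin_sum3 lin_cmult lin_multc endo_id
  endo_comp[OF endo_antipode] endo_comp[OF endo_mult(1)] endo_comp[OF endo_mult(2)] lin_comp[OF lin_counit]

text \<open>Turns an equation in the first tensor power into its values under a linear form, the
  shape of the counit and antipode axioms in the calculus.\<close>

lemma sweedler_pure_eq:
  "\<lbrakk>represents2 t L; sweedler2 t (\<lambda>x y. pure H [g x y]) = pure H [a]; bilin (\<lambda>x y. f (g x y)); lin f\<rbrakk>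
    \<Longrightarrow> L (\<lambda>x y. f (g x y)) = f a"
  "\<lbrakk>represents3 t M; sweedler3 t (\<lambda>x y z. pure H [h x y z]) = pure H [a]; trilin (\<lambda>x y z. f (h x y z)); lin f\<rbrakk>
    \<Longrightarrow> M (\<lambda>x y z. f (h x y z)) = f a"
  by (drule fun_cong[of _ _ "\<lambda>w. f (w ! 0)"], drule (1) represents2_eval represents3_eval,
    simp add: sweedler2_def sweedler3_def tensor_lift_def pure_eval multilinear_1)+

sublocale q: quasi_hopf_calculus "scal H" B "(*)" 1 comul "coeff3 (reassoc H)" "coeff3 (reassoc_inv H)" "counit H"
  "antipode H" "antipode_inv H" "elem_alpha H" "elem_beta H"
proof unfold_locales
  show "endo (\<lambda>x. x * c)" "endo (\<lambda>x. c * x)" for c by (rule endo_mult)+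
  show "lin (\<lambda>a. coeff2 (comult H a) b c)" for b c by (rule lin_coeff)
  show "D 1 F = F 1 1" if "bilin F" for F
    using represents2_eval[OF represents_comult that] represents2_eval[OF represents_one(1) that] comult_one by metis
  show "D (a * b) F = D a (\<lambda>x y. D b (\<lambda>u v. F (x * u) (y * v)))" if "bilin F" for F a b
    using represents2_eval[OF represents_comult that]
      represents2_eval[OF represents2_mult[OF represents_comult represents_comult] that] comult_mult by metis
  show "lin (counit H)" by (rule lin_counit)
  show "Phi (\<lambda>X Y Z. Psi (\<lambda>x y z. F (X * x) (Y * y) (Z * z))) = F 1 1 1" if "trilin F" for F
    using represents3_agree[OF _ represents3_mult[OF represents_reassoc represents_reassoc_inv] represents_one(2) that]
      reassoc_inverse by (simp add: is_tensor_inverse_def)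
  show "Psi (\<lambda>X Y Z. Phi (\<lambda>x y z. F (X * x) (Y * y) (Z * z))) = F 1 1 1" if "trilin F" for F
    using represents3_agree[OF _ represents3_mult[OF represents_reassoc_inv represents_reassoc] represents_one(2) that]
      reassoc_inverse by (simp add: is_tensor_inverse_def)
  show "D a (\<lambda>x y. D y (\<lambda>u v. Phi (\<lambda>X Y Z. G (x * X) (u * Y) (v * Z)))) =
        D a (\<lambda>x y. D x (\<lambda>u v. Phi (\<lambda>X Y Z. G (X * u) (Y * v) (Z * y))))" if G: "trilin G" for G a
  proof -
    have 1: "represents3 (sweedler2 (comult H a) (\<lambda>x y. pure H [x] \<otimes>\<^bsub>H\<^esub> comult H y)) (\<lambda>F. D a (\<lambda>x y. D y (\<lambda>u v. F x u v)))"
      by (rule sweedler2_represents3[OF represents_comult represents3_prod(1)[OF represents_comult]])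
        (intro basic_lin | erule trilin_comp)+
    have 2: "represents3 (sweedler2 (comult H a) (\<lambda>x y. comult H x \<otimes>\<^bsub>H\<^esub> pure H [y])) (\<lambda>F. D a (\<lambda>x y. D x (\<lambda>u v. F u v y)))"
      by (rule sweedler2_represents3[OF represents_comult represents3_prod(2)[OF represents_comult]])
        (intro basic_lin | erule trilin_comp)+
    have "D a (\<lambda>x y. D y (\<lambda>u v. Phi (\<lambda>X Y Z. G (x * X) (u * Y) (v * Z)))) =
       Phi (\<lambda>X Y Z. D a (\<lambda>x y. D x (\<lambda>u v. G (X * u) (Y * v) (Z * y))))"
      using represents3_agree[OF quasi_coassoc represents3_mult[OF 1 represents_reassoc] represents3_mult[OF represents_reassoc 2] G] .
    then show ?thesis by (simp only: sum2_sum3)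
  qed
  show "Phi (\<lambda>X Y Z. Phi (\<lambda>X' Y' Z'. D Z (\<lambda>u v. D X' (\<lambda>s t. K (X * s) (Y * t) (u * Y') (v * Z'))))) =
        Phi (\<lambda>x y z. Phi (\<lambda>X Y Z. Phi (\<lambda>X' Y' Z'. D Y (\<lambda>u v. K (X * X') (x * (u * Y')) (y * (v * Z')) (z * Z)))))"
    if K: "quadlin K" for K
  proof -
    have 1: "represents4 (sweedler3 (reassoc H) (\<lambda>x y z. pure H [x] \<otimes>\<^bsub>H\<^esub> pure H [y] \<otimes>\<^bsub>H\<^esub> comult H z))
      (\<lambda>F. Phi (\<lambda>x y z. D z (\<lambda>u v. F x y u v)))"
      by (rule sweedler3_represents4[OF represents_reassoc represents4_prod(1)[OF represents3_prod(1)[OF represents_comult]]])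
        (intro basic_lin | erule quadlin_comp)+
    have 2: "represents4 (sweedler3 (reassoc H) (\<lambda>x y z. comult H x \<otimes>\<^bsub>H\<^esub> pure H [y] \<otimes>\<^bsub>H\<^esub> pure H [z]))
      (\<lambda>F. Phi (\<lambda>x y z. D x (\<lambda>u v. F u v y z)))"
      by (rule sweedler3_represents4[OF represents_reassoc represents4_prod2[OF represents_comult]])
        (intro basic_lin | erule quadlin_comp)+
    have 3: "represents4 (sweedler3 (reassoc H) (\<lambda>x y z. pure H [x] \<otimes>\<^bsub>H\<^esub> comult H y \<otimes>\<^bsub>H\<^esub> pure H [z]))
      (\<lambda>F. Phi (\<lambda>x y z. D y (\<lambda>u v. F x u v z)))"
      by (rule sweedler3_represents4[OF represents_reassoc represents4_prod(1)[OF represents3_prod(2)[OF represents_comult]]])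
        (intro basic_lin | erule quadlin_comp)+
    have one: "tensor_one H 1 = pure H [1]" by (simp add: tensor_one_def)
    note 4 = represents4_prod(1)[OF represents_reassoc, of 1, folded one]
    note 5 = represents4_prod(2)[OF represents_reassoc, of 1, folded one]
    show ?thesis
      using represents4_agree[OF pentagon represents4_mult[OF 1 2] represents4_mult[OF represents4_mult[OF 4 3] 5] K]
      by (simp add: sum2_sum3 mult.assoc)
  qed
  show "D a (\<lambda>x y. counit H x * f y) = f a" if f: "lin f" for f a
    using sweedler_pure_eq(1)[OF represents_comult counit_left _ f, of a]
    by (simp add: scal_lin[OF f]) (simp add: f bilinI lin_cmult lin_multc lin_counit)
  show "D a (\<lambda>x y. counit H y * f x) = f a" if f: "lin f" for f a
    using sweedler_pure_eq(1)[OF represents_comult counit_right _ f, of a]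
    by (simp add: scal_lin[OF f]) (simp add: f bilinI lin_cmult lin_multc lin_counit)
  show "Phi (\<lambda>X Y Z. counit H Y * F X Z) = F 1 1" if F: "bilin F" for F
  proof -
    have scal: "F (scal H c x) y = c * F x y" for c x y using F by (simp add: bilin_def lin_def)
    have "represents2 (sweedler3 (reassoc H) (\<lambda>x y z. pure H [scal H (counit H y) x, z]))
      (\<lambda>F. Phi (\<lambda>x y z. F (scal H (counit H y) x) z))"
    proof (rule sweedler3_represents2[OF represents_reassoc represents2_pure])
      fix F assume "bilin F"
      then show "trilin (\<lambda>x y z. F (scal H (counit H y) x) z)"
        using lin_counit by (simp add: trilin_def bilin_def lin_def algebra_simps)
    qed
    from represents2_eval[OF this F] represents2_eval[OF represents_one(1) F] show ?thesis
      by (simp add: counit_reassoc scal)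
  qed
  show "endo (antipode H)" by (rule endo_antipode)
  show "antipode H (antipode_inv H x) = x" "antipode_inv H (antipode H x) = x" for x
    by (rule antipode_inverse)+
  show "antipode H 1 = 1" by (rule antipode_one)
  show "antipode H (x * y) = antipode H y * antipode H x" for x y by (rule antipode_mult)
  show "D a (\<lambda>x y. f (antipode H x * (elem_alpha H * y))) = counit H a * f (elem_alpha H)" if f: "lin f" for f a
    using sweedler_pure_eq(1)[OF represents_comult antipode_alpha _ f, of a]
    by (simp add: scal_lin[OF f] mult.assoc) (simp add: basic_lin lin_comp[OF f])
  show "D a (\<lambda>x y. f (x * (elem_beta H * antipode H y))) = counit H a * f (elem_beta H)" if f: "lin f" for f a
    using sweedler_pure_eq(1)[OF represents_comult antipode_beta _ f, of a]
    by (simp add: scal_lin[OF f] mult.assoc) (simp add: basic_lin lin_comp[OF f])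
  show "Phi (\<lambda>X Y Z. f (X * (elem_beta H * (antipode H Y * (elem_alpha H * Z))))) = f 1" if f: "lin f" for f
    using sweedler_pure_eq(2)[OF represents_reassoc antipode_reassoc _ f]
    by (simp add: mult.assoc) (simp add: basic_lin lin_comp[OF f])
  show "Psi (\<lambda>X Y Z. f (antipode H X * (elem_alpha H * (Y * (elem_beta H * antipode H Z))))) = f 1" if f: "lin f" for f
    using sweedler_pure_eq(2)[OF represents_reassoc_inv antipode_reassoc_inv _ f]
    by (simp add: mult.assoc) (simp add: basic_lin lin_comp[OF f])
qed (simp_all add: mult.assoc counit_one counit_mult counit_alpha counit_beta)

section \<open>Comparison with the special elements\<close>

lemmas all_lin = q.mlin q.lin_PR q.lin_QR q.lin_UR q.lin_VR q.lin_GR q.lin_FR q.lin_WR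

lemma represents_flip: "represents2 t L \<Longrightarrow> represents2 (tensor_flip H t) (\<lambda>F. L (\<lambda>x y. F y x))"
  unfolding tensor_flip_def
  by (rule sweedler2_represents2[OF _ represents2_pure]) (auto simp: bilin_def)

lemma represents_map2:
  assumes "represents2 t L" "endo g"
  shows "represents2 (tensor_map2 H g t) (\<lambda>F. L (\<lambda>x y. F (g x) (g y)))"
  unfolding tensor_map2_def
proof (rule sweedler2_represents2[OF assms(1) represents2_pure])
  fix F assume F: "bilin F"
  show "bilin (\<lambda>x y. F (g x) (g y))" by (intro bilinI bilin_comp[OF F] assms(2))
qed

lemma represents_qR: "represents2 (qR H) q.QR"
  unfolding qR_def q.QR_def[abs_def]
  by (rule sweedler3_represents2[OF represents_reassoc represents2_pure]) (intro all_lin | erule bilin_comp)+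

lemma represents_pR: "represents2 (pR H) q.PR"
  unfolding pR_def q.PR_def[abs_def] mult.assoc
  by (rule sweedler3_represents2[OF represents_reassoc_inv represents2_pure]) (intro all_lin | erule bilin_comp)+

lemma represents_drinfeld_g: "represents2 (drinfeld_g H) q.GR"
proof -
  have 1: "represents4 (sweedler3 (reassoc H) (\<lambda>x y z. pure H [x] \<otimes>\<^bsub>H\<^esub> pure H [y] \<otimes>\<^bsub>H\<^esub> comult H z))
      (\<lambda>F. Phi (\<lambda>x y z. D z (\<lambda>u v. F x y u v)))"
    by (rule sweedler3_represents4[OF represents_reassoc represents4_prod(1)[OF represents3_prod(1)[OF represents_comult]]])
      (intro all_lin | erule quadlin_comp)+
  have one: "tensor_one H 1 = pure H [1]" by (simp add: tensor_one_def)
  note 2 = represents4_mult[OF represents4_prod(1)[OF represents_reassoc_inv, of 1, folded one] 1]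
  have "represents2 (drinfeld_g H) (\<lambda>F. Psi (\<lambda>u v w. Phi (\<lambda>x y z. D z (\<lambda>s t.
     F (antipode H (u * y) * elem_alpha H * (v * s)) (antipode H (1 * x) * elem_alpha H * (w * t))))))"
    unfolding drinfeld_g_def
    by (rule sweedler4_represents2[OF 2 represents2_pure]) (intro all_lin | erule bilin_comp)+
  then show ?thesis
    by (rule represents2_cong) (simp add: q.GR_def q.order mult.assoc)
qed

lemma represents_drinfeld_f: "represents2 (drinfeld_f H) q.FR"
proof -
  have "represents2 (drinfeld_f H) (\<lambda>F. Psi (\<lambda>X Y Z. D X (\<lambda>x1 x2. q.GR (\<lambda>g1 g2. D (Y * elem_beta H * antipode H Z) (\<lambda>u v.
    F (antipode H x2 * g1 * u) (antipode H x1 * g2 * v))))))"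
    unfolding drinfeld_f_def
    by (rule sweedler3_represents2[OF represents_reassoc_inv represents2_mult[OF represents2_mult[OF
      represents_map2[OF represents_flip[OF represents_comult] endo_antipode] represents_drinfeld_g] represents_comult]])
      (intro all_lin | erule bilin_comp)+
  then show ?thesis
    by (rule represents2_cong) (simp add: q.FR_def mult.assoc)
qed

lemma endo_antipode_inv: "endo (antipode_inv H)"
  by (rule q.T_endo)

text \<open>\<open>tensor_inverse\<close> asks for a tensor and not a functional, so U and W are
  first assembled from \<Delta>, \<open>p\<^sub>R\<close> and S; then \<open>FR_WR\<close> and
  \<open>WR_FR\<close> are the two inverse laws.\<close>

lemma drinfeld_f_inverse:
  obtains W where "represents2 W q.WR" "tensor_inverse H 2 (drinfeld_f H) = W"
proof -
  define U where "U = sweedler3 (reassoc_inv H) (\<lambda>x y z.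
    comult H (antipode H x * (elem_alpha H * y)) \<odot>\<^bsub>H\<^esub> pR H \<odot>\<^bsub>H\<^esub> pure H [1, antipode H z])"
  define W where "W = sweedler2 (pR H) (\<lambda>x y. comult H (antipode H x) \<odot>\<^bsub>H\<^esub> U \<odot>\<^bsub>H\<^esub> pure H [y, 1])"
  have U: "represents2 U q.UR"
  proof -
    have "represents2 U (\<lambda>F. Psi (\<lambda>x y z. D (antipode H x * (elem_alpha H * y)) (\<lambda>u v. q.PR (\<lambda>p1 p2. F (u * p1 * 1) (v * p2 * antipode H z)))))"
      unfolding U_def
      by (rule sweedler3_represents2[OF represents_reassoc_inv represents2_mult[OF represents2_mult[OF
          represents_comult represents_pR] represents2_pure]])
        (intro all_lin | erule bilin_comp)+
    then show ?thesis by (rule represents2_cong) (simp add: q.UR_def mult.assoc)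
  qed
  have W: "represents2 W q.WR"
  proof -
    have "represents2 W (\<lambda>F. q.PR (\<lambda>x y. D (antipode H x) (\<lambda>s t. q.UR (\<lambda>u v. F (s * u * y) (t * v * 1)))))"
      unfolding W_def
      by (rule sweedler2_represents2[OF represents_pR represents2_mult[OF represents2_mult[OF
          represents_comult U] represents2_pure]])
        (intro all_lin | erule bilin_comp)+
    then show ?thesis by (rule represents2_cong) (simp add: q.WR_def mult.assoc)
  qed
  have "drinfeld_f H \<odot>\<^bsub>H\<^esub> W = tensor_one H 2"
    by (rule represents2_unique[OF represents2_mult[OF represents_drinfeld_f W] represents_one(1) q.FR_WR])
  moreover have "W \<odot>\<^bsub>H\<^esub> drinfeld_f H = tensor_one H 2"
    by (rule represents2_unique[OF represents2_mult[OF W represents_drinfeld_f] represents_one(1) q.WR_FR])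
  ultimately have "is_tensor_inverse H 2 (drinfeld_f H) W"
    using W by (simp add: is_tensor_inverse_def represents2_def)
  then have "tensor_inverse H 2 (drinfeld_f H) = W"
    using represents_drinfeld_f by (intro is_tensor_inverse_unique) (auto simp: represents2_def)
  with W show ?thesis by (rule that)
qed

text \<open>By \<open>FR_UR\<close> the defining product is f\<inverse> (f U).\<close>

lemma represents_U: "represents2 (elem_U H) q.UR"
proof -
  obtain W where W: "represents2 W q.WR" "tensor_inverse H 2 (drinfeld_f H) = W"
    by (rule drinfeld_f_inverse)
  have "represents2 (elem_U H) (\<lambda>F. q.WR (\<lambda>x y. q.QR (\<lambda>q1 q2. F (x * antipode H q2) (y * antipode H q1))))"
    unfolding elem_U_def W(2)
    by (rule represents2_mult[OF W(1) represents_map2[OF represents_flip[OF represents_qR] endo_antipode]])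
  then show ?thesis
  proof (rule represents2_cong)
    fix F assume F: "bilin F"
    have 1: "bilin (\<lambda>a b. F (x * a) (y * b))" for x y by (intro all_lin bilin_comp[OF F])
    have 2: "bilin (\<lambda>a b. q.UR (\<lambda>u v. F (a * u) (b * v)))" by (intro all_lin bilin_comp[OF F])
    show "q.WR (\<lambda>x y. q.QR (\<lambda>q1 q2. F (x * antipode H q2) (y * antipode H q1))) = q.UR F"
      using q.WR_FR[OF 2] by (simp add: q.FR_UR[OF 1, symmetric] mult.assoc)
  qed
qed

text \<open>Both factors carry the antimorphism S\<inverse> and a flip, so their product is the
  image of f times \<open>p\<^sub>R\<close>, which \<open>FR_PR\<close> evaluates.\<close>

lemma represents_V: "represents2 (elem_V H) q.VR"
proof -
  have "represents2 (elem_V H) (\<lambda>F. q.PR (\<lambda>p1 p2. q.FR (\<lambda>f1 f2.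
      F (antipode_inv H p2 * antipode_inv H f2) (antipode_inv H p1 * antipode_inv H f1))))"
    unfolding elem_V_def elem_h_def
    by (rule represents2_mult[OF represents_map2[OF represents_flip[OF represents_pR] endo_antipode_inv]
          represents_map2[OF represents_flip[OF represents_drinfeld_f] endo_antipode_inv]])
  then show ?thesis
  proof (rule represents2_cong)
    fix F assume F: "bilin F"
    have "bilin (\<lambda>a b. F (antipode_inv H b) (antipode_inv H a))" by (intro all_lin bilin_comp[OF F])
    from q.FR_PR[OF this]
    show "q.PR (\<lambda>p1 p2. q.FR (\<lambda>f1 f2.
      F (antipode_inv H p2 * antipode_inv H f2) (antipode_inv H p1 * antipode_inv H f1))) = q.VR F"
      by (simp add: q.FR_PR_commute)
  qed
qed

lemma represents_comult_bar: "represents2 (comult_bar H a) (q.Db a)"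
  unfolding comult_bar_def
  by (rule represents2_cong[OF represents2_mult[OF represents2_mult[OF represents_V represents_comult] represents_U]])
    (simp add: q.Db_def mult.assoc)

section \<open>Cointegrals, modular automorphisms and the modulus of the given data\<close>

lemma cointegral_proj_eq:
  assumes \<psi>: "lin \<psi>"
  shows "cointegral_proj H B \<psi> = q.E \<psi>"
proof
  fix a
  have "comult_bar H (elem_of H (sweedler2 (qR H)
          (\<lambda>q1 q2. pure H [antipode_inv H q1 * a * antipode H (antipode H (q2 * b)) * antipode H (elem_beta H)])))
       (\<lambda>w. representation B (w ! 0) b * \<psi> (w ! 1)) =
    q.QR (\<lambda>q1 q2. q.Db (antipode_inv H q1 * (a * antipode H (elem_beta H * antipode H (q2 * b)))) (\<lambda>x z. dual b x * \<psi> z))" for b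
  proof -
    have "bilin (\<lambda>x z. dual b x * \<psi> z)" by (intro bilinI lin_multc lin_cmult lin_dual_id \<psi>)
    from represents2_eval[OF represents_comult_bar this]
    have "comult_bar H y (\<lambda>w. representation B (w ! 0) b * \<psi> (w ! 1)) = q.Db y (\<lambda>x z. dual b x * \<psi> z)" for y
      by (simp add: dual_def)
    \<comment> \<open>\<open>elem_of\<close> is accessible only through linear forms; here the form
      is the evaluated twisted comultiplication as a function of its argument.\<close>
    moreover have "lin (\<lambda>y. q.Db y (\<lambda>x z. dual b x * \<psi> z))" by (intro q.lin_Db_arg all_lin)
    moreover have "bilin (\<lambda>q1 q2. f (antipode_inv H q1 * a * antipode H (antipode H (q2 * b)) * antipode H (elem_beta H)))"
      if "lin f" for f
      by (intro all_lin lin_comp[OF that])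
    ultimately show ?thesis
      using elem_of_sweedler2[OF represents_qR, where f = "\<lambda>y. q.Db y (\<lambda>x z. dual b x * \<psi> z)"
        and g = "\<lambda>q1 q2. antipode_inv H q1 * a * antipode H (antipode H (q2 * b)) * antipode H (elem_beta H)"]
      by (simp add: mult.assoc)
  qed
  then show "cointegral_proj H B \<psi> a = q.E \<psi> a"
    by (simp add: cointegral_proj_def q.E_def)
qed

lemma dual_space_eq: "dual_space H = {\<psi>. lin \<psi>}"
  by (simp add: dual_space_def linear_iff_lin)

lemma left_cointegrals_eq: "left_cointegrals H B = {l. q.cointegral l}"
proof -
  have "q.cointegral l \<longleftrightarrow> (\<exists>\<psi>. lin \<psi> \<and> l = q.E \<psi>)" for l
    using q.cointegral_E unfolding q.cointegral_def by metis
  then show ?thesis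
    by (auto simp: left_cointegrals_def dual_space_eq cointegral_proj_eq)
qed

lemma hit_right_eval:
  assumes "lin \<gamma>" "lin f"
  shows "f (hit_right H a \<gamma>) = D a (\<lambda>x y. \<gamma> x * f y)"
proof -
  have "bilin (\<lambda>x y. f (scal H (\<gamma> x) y))" if "lin f" for f
    using that assms(1) by (simp add: bilin_def lin_def algebra_simps)
  from elem_of_sweedler2[where g = "\<lambda>x y. scal H (\<gamma> x) y", OF represents_comult this assms(2)] show ?thesis
    by (simp add: hit_right_def scal_lin[OF assms(2)])
qed

text \<open>One kernel vanishes because every form is some l(y S(c)), so a would be killed by all
  forms; for the other, b is written as S(S\<inverse>(b)) and the result of the calculus
  applies.\<close>

lemma cointegral_nondegenerate:
  assumes l: "q.cointegral l" "l \<noteq> (\<lambda>_. 0)"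
  shows "nondegenerate H l"
proof -
  have l1: "lin l" using l by (simp add: q.cointegral_def)
  have "a = 0" if "\<And>b. l (a * b) = 0" for a
  proof (rule lin_ext)
    fix f assume f: "lin f"
    then obtain c where "\<And>y. f y = l (y * antipode H c)" using q.cointegral_generates[OF l] by blast
    then show "f a = f 0" using that l1 by (simp add: lin_def) (metis add_cancel_right_right)
  qed
  moreover have "b = 0" if "\<And>a. l (a * b) = 0" for b
  proof -
    have "antipode_inv H b = 0" by (rule q.cointegral_nondegenerate[OF l]) (simp add: that)
    then have "b = antipode H 0" using antipode_inverse(1)[of b] by simp
    also have "antipode H 0 = 0" using endo_antipode unfolding endo_def by (metis add_cancel_right_right)
    finally show ?thesis .
  qed
  ultimately show ?thesis using l1 by (auto simp: nondegenerate_def dual_space_eq)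
qed

lemma nondegenerate_cancel:
  assumes "nondegenerate H l"
  shows "(\<And>b. l (b * x) = l (b * y)) \<Longrightarrow> x = y" "(\<And>b. l (x * b) = l (y * b)) \<Longrightarrow> x = y"
proof -
  have l: "l (x - y) = l x - l y" for x y
    using assms by (simp add: nondegenerate_def dual_space_eq lin_def) (metis add_diff_cancel diff_add_cancel)
  show "x = y" if "\<And>b. l (b * x) = l (b * y)"
  proof -
    have "l (b * (x - y)) = 0" for b using that by (simp add: right_diff_distrib l)
    then have "x - y = 0" using assms unfolding nondegenerate_def by blast
    then show ?thesis by simp
  qed
  show "x = y" if "\<And>b. l (x * b) = l (y * b)"
  proof -
    have "l ((x - y) * b) = 0" for b using that by (simp add: left_diff_distrib l)
    then have "x - y = 0" using assms unfolding nondegenerate_def by blast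
    then show ?thesis by simp
  qed
qed

lemma surj_if_inj: "endo g \<Longrightarrow> inj g \<Longrightarrow> surj g"
  by (rule linear_inj_imp_surj[OF q.linear_endo])

text \<open>Nondegeneracy makes the map determined by the modular identity unital, multiplicative
  and injective; finite dimension adds surjectivity.\<close>

lemma cointegral_modular_automorphism:
  assumes l: "q.cointegral l" "l \<noteq> (\<lambda>_. 0)" and \<gamma>: "lin \<gamma>" "\<And>a. q.E (\<lambda>z. l (antipode_inv H a * z)) = (\<lambda>z. \<gamma> a * l z)"
  shows "is_modular_automorphism H l (\<lambda>a. antipode H (hit_right H (antipode H a) \<gamma>))"
proof -
  define \<theta> where "\<theta> a = antipode H (hit_right H (antipode H a) \<gamma>)" for a
  note nd = cointegral_nondegenerate[OF l]
  have modular: "l (a * b) = l (b * \<theta> a)" for a b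
    unfolding \<theta>_def
    by (rule q.cointegral_modular[OF l(1) \<gamma>(2)]) (rule hit_right_eval[OF \<gamma>(1)])
  have endo: "endo \<theta>"
  proof -
    have "lin (\<lambda>a. f (\<theta> a))" if f: "lin f" for f
    proof -
      have "lin (\<lambda>x. f (antipode H x))" by (intro lin_comp[OF f] endo_antipode)
      from hit_right_eval[OF \<gamma>(1) this] show ?thesis by (simp add: \<theta>_def lin_D'[OF endo_antipode])
    qed
    then have "f (\<theta> (x + y)) = f (\<theta> x + \<theta> y)" "f (\<theta> (scal H c x)) = f (scal H c (\<theta> x))" if "lin f" for f x y c
      using that by (simp_all add: lin_def)
    then show ?thesis unfolding endo_def by (blast intro: lin_ext)
  qed
  have "\<theta> 1 = 1"
    by (rule nondegenerate_cancel(1)[OF nd]) (simp add: modular[of 1, symmetric])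
  moreover have "\<theta> (a * b) = \<theta> a * \<theta> b" for a b
  proof (rule nondegenerate_cancel(1)[OF nd])
    fix c
    have "l (c * \<theta> (a * b)) = l (a * (b * c))" by (simp only: modular[of "a * b", symmetric] mult.assoc)
    also have "\<dots> = l (b * (c * \<theta> a))" by (simp only: modular[of a "b * c"] mult.assoc)
    also have "\<dots> = l (c * (\<theta> a * \<theta> b))" by (simp only: modular[of b "c * \<theta> a"] mult.assoc)
    finally show "l (c * \<theta> (a * b)) = l (c * (\<theta> a * \<theta> b))" .
  qed
  moreover have "inj \<theta>"
  proof (rule injI)
    fix a b assume "\<theta> a = \<theta> b"
    then have "l (a * c) = l (b * c)" for c by (simp only: modular[of a] modular[of b])
    then show "a = b" by (rule nondegenerate_cancel(2)[OF nd])
  qed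
  ultimately have "algebra_automorphism H \<theta>"
    using endo surj_if_inj[OF endo] by (simp add: algebra_automorphism_def linear_iff_endo bij_def)
  then show ?thesis
    using nd modular unfolding is_modular_automorphism_def \<theta>_def by blast
qed

lemma modulus_eq:
  assumes l: "q.cointegral l" "l \<noteq> (\<lambda>_. 0)"
    and \<gamma>: "lin \<gamma>" "\<gamma> 1 = 1" "\<And>a b. \<gamma> (a * b) = \<gamma> a * \<gamma> b"
    and act: "\<And>a. q.E (\<lambda>z. l (antipode_inv H a * z)) = (\<lambda>z. \<gamma> a * l z)"
  shows "modulus H = \<gamma>"
proof -
  define \<theta> where "\<theta> a = antipode H (hit_right H (antipode H a) \<gamma>)" for a
  have \<theta>: "is_modular_automorphism H l \<theta>"
    unfolding \<theta>_def[abs_def] by (rule cointegral_modular_automorphism[OF l \<gamma>(1) act])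
  \<comment> \<open>\<gamma>(\<theta>(a)) is \<gamma>(u) \<gamma>(S(v)) over the coproduct of S(a),
    hence \<epsilon>(S(a)) = \<epsilon>(a).\<close>
  have \<gamma>_\<theta>: "\<gamma> (\<theta> a) = counit H a" for a
  proof -
    have "lin (\<lambda>x. \<gamma> (antipode H x))" by (intro lin_comp[OF \<gamma>(1)] endo_antipode)
    from hit_right_eval[OF \<gamma>(1) this] show ?thesis
      using q.character_antipode[OF \<gamma>] by (simp add: \<theta>_def)
  qed
  have \<gamma>_modular: "counit H \<circ> inv \<theta>' = \<gamma>" if "is_modular_automorphism H \<omega> \<theta>'" for \<omega> \<theta>'
  proof -
    have nd: "nondegenerate H \<omega>" and bij: "bij \<theta>'" and \<omega>: "\<And>a b. \<omega> (a * b) = \<omega> (b * \<theta>' a)"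
      using that by (auto simp: is_modular_automorphism_def algebra_automorphism_def)
    have l_\<theta>: "l (a * b) = l (b * \<theta> a)" for a b
      using \<theta> by (simp add: is_modular_automorphism_def)
    have "lin \<omega>" using nd by (simp add: nondegenerate_def dual_space_eq)
    then obtain c where c: "\<omega> y = l (y * c)" for y
      using q.cointegral_generates[OF l] by metis
    \<comment> \<open>\<theta>' is \<theta> up to conjugation by c; as \<gamma> has commuting
      values, it takes the same values on both once \<gamma>(c) \<noteq> 0.\<close>
    have comm: "c * \<theta> a = \<theta>' a * c" for a
    proof (rule nondegenerate_cancel(1)[OF cointegral_nondegenerate[OF l]])
      fix b
      have "l (b * (c * \<theta> a)) = \<omega> (a * b)"
        using l_\<theta>[of a "b * c"] by (simp only: c mult.assoc)
      also have "\<dots> = l (b * (\<theta>' a * c))"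
        using \<omega>[of a b] by (simp only: c mult.assoc)
      finally show "l (b * (c * \<theta> a)) = l (b * (\<theta>' a * c))" .
    qed
    \<comment> \<open>Nondegeneracy of \<omega> gives injectivity, dimension gives a left inverse d
      of c, and then \<gamma>(d) \<gamma>(c) = 1.\<close>
    have "inj (\<lambda>x. x * c)"
    proof (rule injI)
      fix x y assume "x * c = y * c"
      then show "x = y" by (intro nondegenerate_cancel(1)[OF nd]) (simp add: c mult.assoc)
    qed
    then have "surj (\<lambda>x. x * c)" by (intro surj_if_inj endo_mult)
    then obtain d where "d * c = 1" by (metis surjD)
    then have "\<gamma> c \<noteq> 0" using \<gamma>(2) \<gamma>(3)[of d c] by auto
    then have \<gamma>_\<theta>': "\<gamma> (\<theta>' a) = counit H a" for a
      using arg_cong[OF comm, of \<gamma> a] by (simp add: \<gamma>(3) \<gamma>_\<theta>)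
    show ?thesis
    proof
      fix x
      show "(counit H \<circ> inv \<theta>') x = \<gamma> x"
        using \<gamma>_\<theta>'[of "inv \<theta>' x"] bij by (simp add: bij_is_surj surj_f_inv_f)
    qed
  qed
  show ?thesis
    unfolding modulus_def using \<theta> \<gamma>_modular by (intro the_equality) metis+
qed

end

theorem lemma5p1:
  fixes H :: "('k::field, 'a::ring_1) quasi_hopf_data" and B :: "'a set"
  assumes "quasi_hopf_algebra H"
    and "finite_dimensional_vector_space (scal H) B"
  shows "(\<exists>!\<gamma>. is_cointegral_character H B \<gamma>) \<and>
         (THE \<gamma>. is_cointegral_character H B \<gamma>) = modulus H \<and>
         (\<forall>l\<in>left_cointegrals H B. l \<noteq> (\<lambda>_. 0) \<longrightarrow>
            is_modular_automorphism H l
              (\<lambda>a. antipode H (hit_right H (antipode H a) (modulus H)))) \<and>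
         (modulus H = counit H \<longleftrightarrow>
            (\<forall>l\<in>left_cointegrals H B. \<forall>a b. l (a * b) = l (b * antipode H (antipode H a))))"
proof -
  interpret quasi_hopf_algebra H by (rule assms(1))
  interpret finite_dimensional_vector_space "scal H" B by (rule assms(2))
  interpret fd_quasi_hopf H B ..
  obtain \<gamma> where \<gamma>: "lin \<gamma>" "\<gamma> 1 = 1" "\<And>a b. \<gamma> (a * b) = \<gamma> a * \<gamma> b"
    and act: "\<And>l a. q.cointegral l \<Longrightarrow> q.E (\<lambda>z. l (antipode_inv H a * z)) = (\<lambda>z. \<gamma> a * l z)"
    by (rule q.cointegral_character) blast
  obtain l where l: "q.cointegral l" "l \<noteq> (\<lambda>_. 0)" using q.exists_cointegral by blast
  have act': "cointegral_act H B a l' = (\<lambda>z. \<gamma> a * l' z)" if "q.cointegral l'" for l' a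
  proof -
    have "lin l'" using that by (simp add: q.cointegral_def)
    then have "lin (\<lambda>z. l' (antipode_inv H a * z))" by (rule lin_comp) (rule endo_mult)
    then show ?thesis by (simp add: cointegral_act_def cointegral_proj_eq act[OF that])
  qed
  have char: "is_cointegral_character H B \<chi> \<longleftrightarrow> \<chi> = \<gamma>" for \<chi>
  proof
    assume \<chi>: "is_cointegral_character H B \<chi>"
    obtain x where x: "l x \<noteq> 0" using l(2) by auto
    have "\<chi> a * l x = \<gamma> a * l x" for a
      using \<chi> l(1) act'[OF l(1), of a] unfolding is_cointegral_character_def left_cointegrals_eq by (metis mem_Collect_eq)
    then show "\<chi> = \<gamma>" using x by (simp add: fun_eq_iff)
  next
    assume "\<chi> = \<gamma>"
    then show "is_cointegral_character H B \<chi>"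
      using \<gamma> act' by (simp add: is_cointegral_character_def algebra_character_def linear_iff_lin left_cointegrals_eq)
  qed
  have \<mu>: "modulus H = \<gamma>" by (rule modulus_eq[OF l \<gamma> act[OF l(1)]])
  have modular: "is_modular_automorphism H l' (\<lambda>a. antipode H (hit_right H (antipode H a) \<gamma>))"
    if "q.cointegral l'" "l' \<noteq> (\<lambda>_. 0)" for l'
    by (rule cointegral_modular_automorphism[OF that \<gamma>(1) act[OF that(1)]])
  have "\<gamma> = counit H \<longleftrightarrow> (\<forall>l\<in>left_cointegrals H B. \<forall>a b. l (a * b) = l (b * antipode H (antipode H a)))"
  proof
    assume eq: "\<gamma> = counit H"
    \<comment> \<open>For \<gamma> = \<epsilon> this is the counit axiom, and the modular
      automorphism becomes the square of the antipode.\<close>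
    have hit: "hit_right H a \<gamma> = a" for a
      by (rule lin_ext) (simp add: eq hit_right_eval[OF lin_counit] q.counit_l)
    have "l' (a * b) = l' (b * antipode H (antipode H a))" if "q.cointegral l'" for l' a b
    proof (cases "l' = (\<lambda>_. 0)")
      case False
      then show ?thesis
        using modular[OF that] unfolding is_modular_automorphism_def hit by blast
    qed simp
    then show "\<forall>l\<in>left_cointegrals H B. \<forall>a b. l (a * b) = l (b * antipode H (antipode H a))"
      by (simp add: left_cointegrals_eq)
  next
    assume *: "\<forall>l\<in>left_cointegrals H B. \<forall>a b. l (a * b) = l (b * antipode H (antipode H a))"
    \<comment> \<open>Both maps satisfy the modular identity for the same nondegenerate l.
      Cancelling the bijective S then gives \<gamma>(a1) a2 = a, to which \<epsilon> is
      applied.\<close>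
    have S2: "antipode H (hit_right H (antipode H a) \<gamma>) = antipode H (antipode H a)" for a
    proof (rule nondegenerate_cancel(1)[OF cointegral_nondegenerate[OF l]])
      fix b
      show "l (b * antipode H (hit_right H (antipode H a) \<gamma>)) = l (b * antipode H (antipode H a))"
        using modular[OF l] * l(1) unfolding is_modular_automorphism_def left_cointegrals_eq by (metis mem_Collect_eq)
    qed
    have "hit_right H a \<gamma> = a" for a
      using S2[of "antipode_inv H a"] by (metis antipode_inverse)
    then have "\<gamma> a = counit H a" for a
      using hit_right_eval[OF \<gamma>(1) lin_counit, of a] q.counit_r[OF \<gamma>(1), of a] by (simp add: mult.commute)
    then show "\<gamma> = counit H" by (simp add: fun_eq_iff)
  qed
  then show ?thesis
    using char modular by (simp add: \<mu> left_cointegrals_eq)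
qed

end
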